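(* Let $H=\{H_\alpha\}_{\alpha\in\pi}$ be a Hopf $\pi$-coalgebra, let $(C,\sigma)$ be a left $\pi$-coisotropic quantum subgroup of $H$, and let $V=\{V_\alpha\}_{\alpha\in\pi}$ be a right $\pi$-comodule over $C$ with coaction $\rho=\{\rho_{\alpha,\beta}:V_{\alpha\beta}\to V_\alpha\otimes C_\beta\}_{\alpha,\beta\in\pi}$. For $\alpha\in\pi$ put $$Ind(\rho)_\alpha=\{x\in V_1\otimes H_\alpha:\ (I_{V_1}\otimes L_{1,\alpha})(x)=(\rho_{1,1}\otimes I_{H_\alpha})(x)\},\qquad L_{1,\alpha}=(\sigma_1\otimes I_{H_\alpha})\Delta^H_{1,\alpha}:H_\alpha\to C_1\otimes H_\alpha .$$ Then $Ind(\rho)=\{Ind(\rho)_\alpha\}_{\alpha\in\pi}$ is a right $\pi$-comodule over $H$ with coaction $I\otimes\Delta=\{(I\otimes\Delta)_{\alpha,\beta}=I_{V_1}\otimes\Delta^H_{\alpha,\beta}\}_{\alpha,\beta\in\pi}$ (restricted to $Ind(\rho)_{\alpha\beta}$, with values in $Ind(\rho)_\alpha\otimes H_\beta$).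
   Context: Everything is over a field $K$: spaces, linear maps, tensor products; algebras are associative and unital. $I$ denotes identity maps. $\pi$ is a group with neutral element $1$. A $\pi$-coalgebra is a family $C=\{C_\alpha\}_{\alpha\in\pi}$ of $K$-spaces with linear maps $\Delta_{\alpha,\beta}:C_{\alpha\beta}\to C_\alpha\otimes C_\beta$ ($\alpha,\beta\in\pi$) and $\epsilon:C_1\to K$ such that $(\Delta_{\alpha,\beta}\otimes I)\Delta_{\alpha\beta,\gamma}=(I\otimes\Delta_{\beta,\gamma})\Delta_{\alpha,\beta\gamma}$ and $(\epsilon\otimes I)\Delta_{1,\alpha}=I=(I\otimes\epsilon)\Delta_{\alpha,1}$ (identifying $K\otimes C_\alpha\cong C_\alpha\cong C_\alpha\otimes K$). A Hopf $\pi$-coalgebra is a $\pi$-coalgebra $H=\{H_\alpha\}$ with linear maps $S_\alpha:H_\alpha\to H_{\alpha^{-1}}$ such that each $H_\alpha$ is an algebra (multiplication $\mu_\alpha$, unit $1_\alpha$), all $\Delta_{\alpha,\beta}$ and $\epsilon$ are algebra maps, and $\mu_\alpha(S_{\alpha^{-1}}\otimes I)\Delta_{\alpha^{-1},\alpha}=1_\alpha\epsilon=\mu_\alpha(I\otimes S_{\alpha^{-1}})\Delta_{\alpha,\alpha^{-1}}$. A right $\pi$-comodule over a $\pi$-coalgebra $C$ is a family $M=\{M_\alpha\}_{\alpha\in\pi}$ of spaces with linear maps $\theta_{\alpha,\beta}:M_{\alpha\beta}\to M_\alpha\otimes C_\beta$ such that $(\theta_{\alpha,\beta}\otimes I)\theta_{\alpha\beta,\gamma}=(I\otimes\Delta_{\beta,\gamma})\theta_{\alpha,\beta\gamma}$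 and $(I\otimes\epsilon)\theta_{\alpha,1}=I$ (up to $M_\alpha\otimes K\cong M_\alpha$). A right $\pi$-comodule over $H$ means over the underlying $\pi$-coalgebra of $H$. A left $\pi$-coisotropic quantum subgroup of $H$ is a pair $(C,\sigma)$ where $C$ is a $\pi$-coalgebra, each $C_\alpha$ carries a left $H_\alpha$-module structure, and $\sigma=\{\sigma_\alpha:H_\alpha\to C_\alpha\}$ is a family of surjective linear maps such that each $\sigma_\alpha$ is left $H_\alpha$-linear, $\Delta^C_{\alpha,\beta}\sigma_{\alpha\beta}=(\sigma_\alpha\otimes\sigma_\beta)\Delta^H_{\alpha,\beta}$ for all $\alpha,\beta$, and $\epsilon^C\sigma_1=\epsilon^H$. *)

theory Defs
  imports "HOL-Algebra.AbelCoset" "Jordan_Normal_Form.Missing_VectorSpace"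
begin

text \<open>
  Spaces are \<^locale>\<open>vectorspace\<close>s over the field \<open>K\<close>, given as records of type \<open>module\<close>; linear maps
  are elements of \<^const>\<open>module_hom\<close>. All members of a family \<open>C \<alpha>\<close> of spaces live in one type,
  with \<open>carrier (C \<alpha>)\<close> depending on \<open>\<alpha>\<close>. The record fields \<open>mult\<close> and \<open>one\<close> carry the
  algebra structure where there is one, and are irrelevant otherwise.
\<close>

section \<open>Tensor products\<close>

definition ground :: "('k, 'z) ring_scheme \<Rightarrow> ('k, 'k) module" where
  "ground K = \<lparr>carrier = carrier K, mult = mult K, one = one K, zero = zero K, add = add K,
     smult = mult K\<rparr>"

text \<open>The space of finitely supported functions from \<open>X\<close> to \<open>K\<close>, extended by zero outside \<open>X\<close>.\<close>

definition free_space :: "('k, 'z) ring_scheme \<Rightarrow> 'x set \<Rightarrow> ('k, 'x \<Rightarrow> 'k) module" where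
  "free_space K X =
    \<lparr>carrier = {f. range f \<subseteq> carrier K \<and> finite {x. f x \<noteq> \<zero>\<^bsub>K\<^esub>} \<and> {x. f x \<noteq> \<zero>\<^bsub>K\<^esub>} \<subseteq> X},
     mult = undefined, one = undefined,
     zero = (\<lambda>x. \<zero>\<^bsub>K\<^esub>), add = (\<lambda>f g x. f x \<oplus>\<^bsub>K\<^esub> g x),
     smult = (\<lambda>k f x. k \<otimes>\<^bsub>K\<^esub> f x)\<rparr>"

definition free_gen :: "('k, 'z) ring_scheme \<Rightarrow> 'x \<Rightarrow> 'x \<Rightarrow> 'k" where
  "free_gen K x = (\<lambda>y. if y = x then \<one>\<^bsub>K\<^esub> else \<zero>\<^bsub>K\<^esub>)"

definition quotient_space ::
  "('k, 'z) ring_scheme \<Rightarrow> ('k, 'm) module \<Rightarrow> 'm set \<Rightarrow> ('k, 'm set) module" where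
  "quotient_space K M N =
    \<lparr>carrier = a_rcosets\<^bsub>M\<^esub> N, mult = undefined, one = undefined,
     zero = N, add = set_add M,
     smult = (\<lambda>k X. \<Union>x\<in>X. N +>\<^bsub>M\<^esub> (k \<odot>\<^bsub>M\<^esub> x))\<rparr>"

definition tensor_free ::
  "('k, 'z) ring_scheme \<Rightarrow> ('k, 'm) module \<Rightarrow> ('k, 'n) module \<Rightarrow> ('k, 'm \<times> 'n \<Rightarrow> 'k) module" where
  "tensor_free K M N = free_space K (carrier M \<times> carrier N)"

definition tensor_rels ::
  "('k, 'z) ring_scheme \<Rightarrow> ('k, 'm) module \<Rightarrow> ('k, 'n) module \<Rightarrow> ('m \<times> 'n \<Rightarrow> 'k) set" where
  "tensor_rels K M N =
    (let F = tensor_free K M N; e = (\<lambda>m n. free_gen K (m, n)) in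
      {e (m \<oplus>\<^bsub>M\<^esub> m') n \<ominus>\<^bsub>F\<^esub> (e m n \<oplus>\<^bsub>F\<^esub> e m' n) | m m' n.
         m \<in> carrier M \<and> m' \<in> carrier M \<and> n \<in> carrier N} \<union>
      {e m (n \<oplus>\<^bsub>N\<^esub> n') \<ominus>\<^bsub>F\<^esub> (e m n \<oplus>\<^bsub>F\<^esub> e m n') | m n n'.
         m \<in> carrier M \<and> n \<in> carrier N \<and> n' \<in> carrier N} \<union>
      {e (k \<odot>\<^bsub>M\<^esub> m) n \<ominus>\<^bsub>F\<^esub> k \<odot>\<^bsub>F\<^esub> e m n | k m n.
         k \<in> carrier K \<and> m \<in> carrier M \<and> n \<in> carrier N} \<union>
      {e m (k \<odot>\<^bsub>N\<^esub> n) \<ominus>\<^bsub>F\<^esub> k \<odot>\<^bsub>F\<^esub> e m n | k m n.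
         k \<in> carrier K \<and> m \<in> carrier M \<and> n \<in> carrier N})"

definition tensor_null ::
  "('k, 'z) ring_scheme \<Rightarrow> ('k, 'm) module \<Rightarrow> ('k, 'n) module \<Rightarrow> ('m \<times> 'n \<Rightarrow> 'k) set" where
  "tensor_null K M N = LinearCombinations.module.span K (tensor_free K M N) (tensor_rels K M N)"

definition tensor ::
  "('k, 'z) ring_scheme \<Rightarrow> ('k, 'm) module \<Rightarrow> ('k, 'n) module \<Rightarrow> ('k, ('m \<times> 'n \<Rightarrow> 'k) set) module" where
  "tensor K M N = quotient_space K (tensor_free K M N) (tensor_null K M N)"

definition pure ::
  "('k, 'z) ring_scheme \<Rightarrow> ('k, 'm) module \<Rightarrow> ('k, 'n) module \<Rightarrow> 'm \<Rightarrow> 'n \<Rightarrow> ('m \<times> 'n \<Rightarrow> 'k) set" where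
  "pure K M N m n = tensor_null K M N +>\<^bsub>tensor_free K M N\<^esub> free_gen K (m, n)"

text \<open>The linear map to \<open>P\<close> induced by a bilinear map \<open>b\<close>. For bilinear \<open>b\<close> the value does not
  depend on the chosen representative of the coset \<open>X\<close>.\<close>

definition tensor_lift ::
  "('k, 'z) ring_scheme \<Rightarrow> ('k, 'p) module \<Rightarrow> ('m \<Rightarrow> 'n \<Rightarrow> 'p) \<Rightarrow> ('m \<times> 'n \<Rightarrow> 'k) set \<Rightarrow> 'p" where
  "tensor_lift K P b X =
    (let f = (SOME f. f \<in> X) in
      (\<Oplus>\<^bsub>P\<^esub>p\<in>{p. f p \<noteq> \<zero>\<^bsub>K\<^esub>}. f p \<odot>\<^bsub>P\<^esub> b (fst p) (snd p)))"

text \<open>\<open>f \<otimes> g\<close>, where \<open>P\<close> and \<open>Q\<close> are the codomains of \<open>f\<close> and \<open>g\<close>.\<close>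

definition tensor_map ::
  "('k, 'z) ring_scheme \<Rightarrow> ('k, 'p) module \<Rightarrow> ('k, 'q) module \<Rightarrow> ('m \<Rightarrow> 'p) \<Rightarrow> ('n \<Rightarrow> 'q) \<Rightarrow>
    ('m \<times> 'n \<Rightarrow> 'k) set \<Rightarrow> ('p \<times> 'q \<Rightarrow> 'k) set" where
  "tensor_map K P Q f g = tensor_lift K (tensor K P Q) (\<lambda>m n. pure K P Q (f m) (g n))"

text \<open>The canonical identifications \<open>(A \<otimes> B) \<otimes> C \<cong> A \<otimes> (B \<otimes> C)\<close>, \<open>K \<otimes> M \<cong> M\<close>, \<open>M \<otimes> K \<cong> M\<close>.\<close>

definition tensor_assoc ::
  "('k, 'z) ring_scheme \<Rightarrow> ('k, 'a) module \<Rightarrow> ('k, 'b) module \<Rightarrow> ('k, 'c) module \<Rightarrow>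
    (('a \<times> 'b \<Rightarrow> 'k) set \<times> 'c \<Rightarrow> 'k) set \<Rightarrow> ('a \<times> ('b \<times> 'c \<Rightarrow> 'k) set \<Rightarrow> 'k) set" where
  "tensor_assoc K A B C =
    (let T = tensor K A (tensor K B C) in
      tensor_lift K T
        (\<lambda>t c. tensor_lift K T (\<lambda>a b. pure K A (tensor K B C) a (pure K B C b c)) t))"

definition left_unitor ::
  "('k, 'z) ring_scheme \<Rightarrow> ('k, 'm) module \<Rightarrow> ('k \<times> 'm \<Rightarrow> 'k) set \<Rightarrow> 'm" where
  "left_unitor K M = tensor_lift K M (\<lambda>k m. k \<odot>\<^bsub>M\<^esub> m)"

definition right_unitor ::
  "('k, 'z) ring_scheme \<Rightarrow> ('k, 'm) module \<Rightarrow> ('m \<times> 'k \<Rightarrow> 'k) set \<Rightarrow> 'm" where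
  "right_unitor K M = tensor_lift K M (\<lambda>m k. k \<odot>\<^bsub>M\<^esub> m)"


section \<open>Algebras and their modules\<close>

text \<open>The library locale \<open>algebra\<close> requires the multiplication to be commutative.\<close>

locale assoc_algebra = V: vectorspace K A + R: ring A
  for K :: "('k, 'z) ring_scheme" and A :: "('k, 'a) module" +
  assumes smult_mult_left: "\<lbrakk>k \<in> carrier K; a \<in> carrier A; b \<in> carrier A\<rbrakk> \<Longrightarrow>
      (k \<odot>\<^bsub>A\<^esub> a) \<otimes>\<^bsub>A\<^esub> b = k \<odot>\<^bsub>A\<^esub> (a \<otimes>\<^bsub>A\<^esub> b)"
    and smult_mult_right: "\<lbrakk>k \<in> carrier K; a \<in> carrier A; b \<in> carrier A\<rbrakk> \<Longrightarrow>
      a \<otimes>\<^bsub>A\<^esub> (k \<odot>\<^bsub>A\<^esub> b) = k \<odot>\<^bsub>A\<^esub> (a \<otimes>\<^bsub>A\<^esub> b)"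

definition algebra_hom ::
  "('k, 'z) ring_scheme \<Rightarrow> ('k, 'a) module \<Rightarrow> ('k, 'b) module \<Rightarrow> ('a \<Rightarrow> 'b) set" where
  "algebra_hom K A B = module_hom K A B \<inter> ring_hom A B"

definition mult_map ::
  "('k, 'z) ring_scheme \<Rightarrow> ('k, 'a) module \<Rightarrow> ('a \<times> 'a \<Rightarrow> 'k) set \<Rightarrow> 'a" where
  "mult_map K A = tensor_lift K A (\<lambda>a b. a \<otimes>\<^bsub>A\<^esub> b)"

text \<open>The algebra \<open>A \<otimes> B\<close>, with \<open>(a \<otimes> b)(c \<otimes> d) = ac \<otimes> bd\<close>.\<close>

definition tensor_algebra ::
  "('k, 'z) ring_scheme \<Rightarrow> ('k, 'a) module \<Rightarrow> ('k, 'b) module \<Rightarrow> ('k, ('a \<times> 'b \<Rightarrow> 'k) set) module" where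
  "tensor_algebra K A B = (tensor K A B)
    \<lparr>mult := (\<lambda>x y.
       tensor_lift K (tensor K A B)
         (\<lambda>a b. tensor_lift K (tensor K A B)
            (\<lambda>c d. pure K A B (a \<otimes>\<^bsub>A\<^esub> c) (b \<otimes>\<^bsub>B\<^esub> d)) y) x),
     one := pure K A B \<one>\<^bsub>A\<^esub> \<one>\<^bsub>B\<^esub>\<rparr>"

locale left_module = A: assoc_algebra K A + M: vectorspace K M
  for K :: "('k, 'z) ring_scheme" and A :: "('k, 'a) module" and M :: "('k, 'm) module" +
  fixes act :: "'a \<Rightarrow> 'm \<Rightarrow> 'm"
  assumes act_linear_right: "a \<in> carrier A \<Longrightarrow> act a \<in> module_hom K M M"
    and act_linear_left: "m \<in> carrier M \<Longrightarrow> (\<lambda>a. act a m) \<in> module_hom K A M"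
    and act_one: "m \<in> carrier M \<Longrightarrow> act \<one>\<^bsub>A\<^esub> m = m"
    and act_mult: "\<lbrakk>a \<in> carrier A; b \<in> carrier A; m \<in> carrier M\<rbrakk> \<Longrightarrow>
      act (a \<otimes>\<^bsub>A\<^esub> b) m = act a (act b m)"


section \<open>Hopf group coalgebras, comodules, coisotropic quantum subgroups\<close>

locale pi_coalgebra = K: field K + G: group G
  for K :: "('k, 'z) ring_scheme" and G :: "('g, 'y) monoid_scheme" +
  fixes C :: "'g \<Rightarrow> ('k, 'c) module"
    and \<Delta> :: "'g \<Rightarrow> 'g \<Rightarrow> 'c \<Rightarrow> ('c \<times> 'c \<Rightarrow> 'k) set"
    and \<epsilon> :: "'c \<Rightarrow> 'k"
  assumes space: "\<alpha> \<in> carrier G \<Longrightarrow> vectorspace K (C \<alpha>)"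
    and comult_linear: "\<lbrakk>\<alpha> \<in> carrier G; \<beta> \<in> carrier G\<rbrakk> \<Longrightarrow>
      \<Delta> \<alpha> \<beta> \<in> module_hom K (C (\<alpha> \<otimes>\<^bsub>G\<^esub> \<beta>)) (tensor K (C \<alpha>) (C \<beta>))"
    and counit_linear: "\<epsilon> \<in> module_hom K (C \<one>\<^bsub>G\<^esub>) (ground K)"
    and coassoc: "\<lbrakk>\<alpha> \<in> carrier G; \<beta> \<in> carrier G; \<gamma> \<in> carrier G;
        x \<in> carrier (C (\<alpha> \<otimes>\<^bsub>G\<^esub> \<beta> \<otimes>\<^bsub>G\<^esub> \<gamma>))\<rbrakk> \<Longrightarrow>
      tensor_assoc K (C \<alpha>) (C \<beta>) (C \<gamma>)
        (tensor_map K (tensor K (C \<alpha>) (C \<beta>)) (C \<gamma>) (\<Delta> \<alpha> \<beta>) id (\<Delta> (\<alpha> \<otimes>\<^bsub>G\<^esub> \<beta>) \<gamma> x)) =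
      tensor_map K (C \<alpha>) (tensor K (C \<beta>) (C \<gamma>)) id (\<Delta> \<beta> \<gamma>) (\<Delta> \<alpha> (\<beta> \<otimes>\<^bsub>G\<^esub> \<gamma>) x)"
    and counit_left: "\<lbrakk>\<alpha> \<in> carrier G; x \<in> carrier (C \<alpha>)\<rbrakk> \<Longrightarrow>
      left_unitor K (C \<alpha>) (tensor_map K (ground K) (C \<alpha>) \<epsilon> id (\<Delta> \<one>\<^bsub>G\<^esub> \<alpha> x)) = x"
    and counit_right: "\<lbrakk>\<alpha> \<in> carrier G; x \<in> carrier (C \<alpha>)\<rbrakk> \<Longrightarrow>
      right_unitor K (C \<alpha>) (tensor_map K (C \<alpha>) (ground K) id \<epsilon> (\<Delta> \<alpha> \<one>\<^bsub>G\<^esub> x)) = x"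

locale hopf_pi_coalgebra = pi_coalgebra K G H \<Delta> \<epsilon>
  for K :: "('k, 'z) ring_scheme" and G :: "('g, 'y) monoid_scheme"
    and H :: "'g \<Rightarrow> ('k, 'h) module" and \<Delta> \<epsilon> +
  fixes S :: "'g \<Rightarrow> 'h \<Rightarrow> 'h"
  assumes alg: "\<alpha> \<in> carrier G \<Longrightarrow> assoc_algebra K (H \<alpha>)"
    and comult_algebra_hom: "\<lbrakk>\<alpha> \<in> carrier G; \<beta> \<in> carrier G\<rbrakk> \<Longrightarrow>
      \<Delta> \<alpha> \<beta> \<in> algebra_hom K (H (\<alpha> \<otimes>\<^bsub>G\<^esub> \<beta>)) (tensor_algebra K (H \<alpha>) (H \<beta>))"
    and counit_algebra_hom: "\<epsilon> \<in> algebra_hom K (H \<one>\<^bsub>G\<^esub>) (ground K)"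
    and antipode_linear: "\<alpha> \<in> carrier G \<Longrightarrow> S \<alpha> \<in> module_hom K (H \<alpha>) (H (inv\<^bsub>G\<^esub> \<alpha>))"
    and antipode_left: "\<lbrakk>\<alpha> \<in> carrier G; x \<in> carrier (H \<one>\<^bsub>G\<^esub>)\<rbrakk> \<Longrightarrow>
      mult_map K (H \<alpha>)
        (tensor_map K (H \<alpha>) (H \<alpha>) (S (inv\<^bsub>G\<^esub> \<alpha>)) id (\<Delta> (inv\<^bsub>G\<^esub> \<alpha>) \<alpha> x)) =
      \<epsilon> x \<odot>\<^bsub>H \<alpha>\<^esub> \<one>\<^bsub>H \<alpha>\<^esub>"
    and antipode_right: "\<lbrakk>\<alpha> \<in> carrier G; x \<in> carrier (H \<one>\<^bsub>G\<^esub>)\<rbrakk> \<Longrightarrow>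
      mult_map K (H \<alpha>)
        (tensor_map K (H \<alpha>) (H \<alpha>) id (S (inv\<^bsub>G\<^esub> \<alpha>)) (\<Delta> \<alpha> (inv\<^bsub>G\<^esub> \<alpha>) x)) =
      \<epsilon> x \<odot>\<^bsub>H \<alpha>\<^esub> \<one>\<^bsub>H \<alpha>\<^esub>"

locale right_pi_comodule = C: pi_coalgebra K G C \<Delta> \<epsilon>
  for K :: "('k, 'z) ring_scheme" and G :: "('g, 'y) monoid_scheme"
    and C :: "'g \<Rightarrow> ('k, 'c) module" and \<Delta> \<epsilon> +
  fixes M :: "'g \<Rightarrow> ('k, 'm) module"
    and \<theta> :: "'g \<Rightarrow> 'g \<Rightarrow> 'm \<Rightarrow> ('m \<times> 'c \<Rightarrow> 'k) set"
  assumes comodule_space: "\<alpha> \<in> carrier G \<Longrightarrow> vectorspace K (M \<alpha>)"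
    and coaction_linear: "\<lbrakk>\<alpha> \<in> carrier G; \<beta> \<in> carrier G\<rbrakk> \<Longrightarrow>
      \<theta> \<alpha> \<beta> \<in> module_hom K (M (\<alpha> \<otimes>\<^bsub>G\<^esub> \<beta>)) (tensor K (M \<alpha>) (C \<beta>))"
    and coaction_coassoc: "\<lbrakk>\<alpha> \<in> carrier G; \<beta> \<in> carrier G; \<gamma> \<in> carrier G;
        x \<in> carrier (M (\<alpha> \<otimes>\<^bsub>G\<^esub> \<beta> \<otimes>\<^bsub>G\<^esub> \<gamma>))\<rbrakk> \<Longrightarrow>
      tensor_assoc K (M \<alpha>) (C \<beta>) (C \<gamma>)
        (tensor_map K (tensor K (M \<alpha>) (C \<beta>)) (C \<gamma>) (\<theta> \<alpha> \<beta>) id (\<theta> (\<alpha> \<otimes>\<^bsub>G\<^esub> \<beta>) \<gamma> x)) =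
      tensor_map K (M \<alpha>) (tensor K (C \<beta>) (C \<gamma>)) id (\<Delta> \<beta> \<gamma>) (\<theta> \<alpha> (\<beta> \<otimes>\<^bsub>G\<^esub> \<gamma>) x)"
    and coaction_counit: "\<lbrakk>\<alpha> \<in> carrier G; x \<in> carrier (M \<alpha>)\<rbrakk> \<Longrightarrow>
      right_unitor K (M \<alpha>) (tensor_map K (M \<alpha>) (ground K) id \<epsilon> (\<theta> \<alpha> \<one>\<^bsub>G\<^esub> x)) = x"

locale left_coisotropic_subgroup =
  H: hopf_pi_coalgebra K G H \<Delta>H \<epsilon>H S + C: pi_coalgebra K G C \<Delta>C \<epsilon>C
  for K :: "('k, 'z) ring_scheme" and G :: "('g, 'y) monoid_scheme"
    and H :: "'g \<Rightarrow> ('k, 'h) module" and \<Delta>H \<epsilon>H S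
    and C :: "'g \<Rightarrow> ('k, 'c) module" and \<Delta>C \<epsilon>C +
  fixes act :: "'g \<Rightarrow> 'h \<Rightarrow> 'c \<Rightarrow> 'c"
    and \<sigma> :: "'g \<Rightarrow> 'h \<Rightarrow> 'c"
  assumes left_mod: "\<alpha> \<in> carrier G \<Longrightarrow> left_module K (H \<alpha>) (C \<alpha>) (act \<alpha>)"
    and proj_linear: "\<alpha> \<in> carrier G \<Longrightarrow> \<sigma> \<alpha> \<in> module_hom K (H \<alpha>) (C \<alpha>)"
    and proj_surj: "\<alpha> \<in> carrier G \<Longrightarrow> \<sigma> \<alpha> ` carrier (H \<alpha>) = carrier (C \<alpha>)"
    and proj_equivariant: "\<lbrakk>\<alpha> \<in> carrier G; a \<in> carrier (H \<alpha>); b \<in> carrier (H \<alpha>)\<rbrakk> \<Longrightarrow>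
      \<sigma> \<alpha> (a \<otimes>\<^bsub>H \<alpha>\<^esub> b) = act \<alpha> a (\<sigma> \<alpha> b)"
    and proj_comult: "\<lbrakk>\<alpha> \<in> carrier G; \<beta> \<in> carrier G; x \<in> carrier (H (\<alpha> \<otimes>\<^bsub>G\<^esub> \<beta>))\<rbrakk> \<Longrightarrow>
      \<Delta>C \<alpha> \<beta> (\<sigma> (\<alpha> \<otimes>\<^bsub>G\<^esub> \<beta>) x) = tensor_map K (C \<alpha>) (C \<beta>) (\<sigma> \<alpha>) (\<sigma> \<beta>) (\<Delta>H \<alpha> \<beta> x)"
    and proj_counit: "x \<in> carrier (H \<one>\<^bsub>G\<^esub>) \<Longrightarrow> \<epsilon>C (\<sigma> \<one>\<^bsub>G\<^esub> x) = \<epsilon>H x"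


section \<open>Induction\<close>

text \<open>The map \<open>L\<^bsub>1,\<alpha>\<^esub> = (\<sigma>\<^sub>1 \<otimes> I) \<Delta>\<^bsub>1,\<alpha>\<^esub>\<close>, a left \<open>C\<^sub>1\<close>-coaction on \<open>H\<^sub>\<alpha>\<close>.\<close>

definition coisotropic_coaction ::
  "('k, 'z) ring_scheme \<Rightarrow> ('g, 'y) monoid_scheme \<Rightarrow>
    ('g \<Rightarrow> ('k, 'h) module) \<Rightarrow> ('g \<Rightarrow> 'g \<Rightarrow> 'h \<Rightarrow> ('h \<times> 'h \<Rightarrow> 'k) set) \<Rightarrow>
    ('g \<Rightarrow> ('k, 'c) module) \<Rightarrow> ('g \<Rightarrow> 'h \<Rightarrow> 'c) \<Rightarrow>
    'g \<Rightarrow> 'h \<Rightarrow> ('c \<times> 'h \<Rightarrow> 'k) set" where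
  "coisotropic_coaction K G H \<Delta>H C \<sigma> \<alpha> x =
      tensor_map K (C \<one>\<^bsub>G\<^esub>) (H \<alpha>) (\<sigma> \<one>\<^bsub>G\<^esub>) id (\<Delta>H \<one>\<^bsub>G\<^esub> \<alpha> x)"

text \<open>Both sides of the defining equation are compared in \<open>V\<^sub>1 \<otimes> (C\<^sub>1 \<otimes> H\<^sub>\<alpha>)\<close>.\<close>

definition Ind ::
  "('k, 'z) ring_scheme \<Rightarrow> ('g, 'y) monoid_scheme \<Rightarrow>
    ('g \<Rightarrow> ('k, 'h) module) \<Rightarrow> ('g \<Rightarrow> 'g \<Rightarrow> 'h \<Rightarrow> ('h \<times> 'h \<Rightarrow> 'k) set) \<Rightarrow>
    ('g \<Rightarrow> ('k, 'c) module) \<Rightarrow> ('g \<Rightarrow> 'h \<Rightarrow> 'c) \<Rightarrow>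
    ('g \<Rightarrow> ('k, 'v) module) \<Rightarrow> ('g \<Rightarrow> 'g \<Rightarrow> 'v \<Rightarrow> ('v \<times> 'c \<Rightarrow> 'k) set) \<Rightarrow>
    'g \<Rightarrow> ('k, ('v \<times> 'h \<Rightarrow> 'k) set) module" where
  "Ind K G H \<Delta>H C \<sigma> V \<rho> \<alpha> = (tensor K (V \<one>\<^bsub>G\<^esub>) (H \<alpha>))
    \<lparr>carrier := {x \<in> carrier (tensor K (V \<one>\<^bsub>G\<^esub>) (H \<alpha>)).
       tensor_map K (V \<one>\<^bsub>G\<^esub>) (tensor K (C \<one>\<^bsub>G\<^esub>) (H \<alpha>))
         id (coisotropic_coaction K G H \<Delta>H C \<sigma> \<alpha>) x =
       tensor_assoc K (V \<one>\<^bsub>G\<^esub>) (C \<one>\<^bsub>G\<^esub>) (H \<alpha>)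
         (tensor_map K (tensor K (V \<one>\<^bsub>G\<^esub>) (C \<one>\<^bsub>G\<^esub>)) (H \<alpha>) (\<rho> \<one>\<^bsub>G\<^esub> \<one>\<^bsub>G\<^esub>) id x)}\<rparr>"

text \<open>\<open>I \<otimes> \<Delta>\<^bsub>\<alpha>,\<beta>\<^esub> : V\<^sub>1 \<otimes> H\<^bsub>\<alpha>\<beta>\<^esub> \<rightarrow> V\<^sub>1 \<otimes> (H\<^sub>\<alpha> \<otimes> H\<^sub>\<beta>)\<close>\<close>

definition id_comult ::
  "('k, 'z) ring_scheme \<Rightarrow> ('g, 'y) monoid_scheme \<Rightarrow>
    ('g \<Rightarrow> ('k, 'h) module) \<Rightarrow> ('g \<Rightarrow> 'g \<Rightarrow> 'h \<Rightarrow> ('h \<times> 'h \<Rightarrow> 'k) set) \<Rightarrow>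
    ('g \<Rightarrow> ('k, 'v) module) \<Rightarrow> 'g \<Rightarrow> 'g \<Rightarrow> ('v \<times> 'h \<Rightarrow> 'k) set \<Rightarrow>
    ('v \<times> ('h \<times> 'h \<Rightarrow> 'k) set \<Rightarrow> 'k) set" where
  "id_comult K G H \<Delta>H V \<alpha> \<beta> = tensor_map K (V \<one>\<^bsub>G\<^esub>) (tensor K (H \<alpha>) (H \<beta>)) id (\<Delta>H \<alpha> \<beta>)"

text \<open>\<open>Ind(\<rho>)\<^sub>\<alpha> \<otimes> H\<^sub>\<beta>\<close> is a set of cosets of its own, not literally a subset of
  \<open>V\<^sub>1 \<otimes> (H\<^sub>\<alpha> \<otimes> H\<^sub>\<beta>)\<close>. The map it is identified along is
  \<open>Ind(\<rho>)\<^sub>\<alpha> \<otimes> H\<^sub>\<beta> \<rightarrow> (V\<^sub>1 \<otimes> H\<^sub>\<alpha>) \<otimes> H\<^sub>\<beta> \<cong> V\<^sub>1 \<otimes> (H\<^sub>\<alpha> \<otimes> H\<^sub>\<beta>)\<close>, the first arrow being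
  induced by the inclusion.\<close>

definition Ind_embed ::
  "('k, 'z) ring_scheme \<Rightarrow> ('g, 'y) monoid_scheme \<Rightarrow>
    ('g \<Rightarrow> ('k, 'h) module) \<Rightarrow>
    ('g \<Rightarrow> ('k, 'v) module) \<Rightarrow> 'g \<Rightarrow> 'g \<Rightarrow> (('v \<times> 'h \<Rightarrow> 'k) set \<times> 'h \<Rightarrow> 'k) set \<Rightarrow>
    ('v \<times> ('h \<times> 'h \<Rightarrow> 'k) set \<Rightarrow> 'k) set" where
  "Ind_embed K G H V \<alpha> \<beta> y = tensor_assoc K (V \<one>\<^bsub>G\<^esub>) (H \<alpha>) (H \<beta>)
     (tensor_map K (tensor K (V \<one>\<^bsub>G\<^esub>) (H \<alpha>)) (H \<beta>) id id y)"

definition Ind_coaction ::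
  "('k, 'z) ring_scheme \<Rightarrow> ('g, 'y) monoid_scheme \<Rightarrow>
    ('g \<Rightarrow> ('k, 'h) module) \<Rightarrow> ('g \<Rightarrow> 'g \<Rightarrow> 'h \<Rightarrow> ('h \<times> 'h \<Rightarrow> 'k) set) \<Rightarrow>
    ('g \<Rightarrow> ('k, 'c) module) \<Rightarrow> ('g \<Rightarrow> 'h \<Rightarrow> 'c) \<Rightarrow>
    ('g \<Rightarrow> ('k, 'v) module) \<Rightarrow> ('g \<Rightarrow> 'g \<Rightarrow> 'v \<Rightarrow> ('v \<times> 'c \<Rightarrow> 'k) set) \<Rightarrow>
    'g \<Rightarrow> 'g \<Rightarrow> ('v \<times> 'h \<Rightarrow> 'k) set \<Rightarrow> (('v \<times> 'h \<Rightarrow> 'k) set \<times> 'h \<Rightarrow> 'k) set" where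
  "Ind_coaction K G H \<Delta>H C \<sigma> V \<rho> \<alpha> \<beta> x =
     inv_into (carrier (tensor K (Ind K G H \<Delta>H C \<sigma> V \<rho> \<alpha>) (H \<beta>)))
       (Ind_embed K G H V \<alpha> \<beta>) (id_comult K G H \<Delta>H V \<alpha> \<beta> x)"

end

theory Submission
  imports Defs
begin

text \<open>
  \<open>Ind(\<rho>)\<^sub>\<alpha>\<close> is the equalizer of two linear maps on \<open>V\<^sub>1 \<otimes> H\<^sub>\<alpha>\<close>. Over a field, tensoring with
  \<open>N\<close> preserves injections and equalizers: for a basis \<open>B\<close> of \<open>N\<close>, every \<open>x \<in> M \<otimes> N\<close> is the finite
  sum of \<open>x\<^sub>b \<otimes> b\<close>, where the slice \<open>x\<^sub>b \<in> M\<close> is obtained by applying the \<open>b\<close>-th coordinate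
  functional to the right factor, and slices commute with every \<open>f \<otimes> I\<close>. So
  \<open>Ind(\<rho>)\<^sub>\<alpha> \<otimes> H\<^sub>\<beta>\<close> is the equalizer of the two maps tensored with \<open>H\<^sub>\<beta>\<close>, and
  \<open>(I \<otimes> \<Delta>)x\<close> lies in it for \<open>x \<in> Ind(\<rho>)\<^bsub>\<alpha>\<beta>\<^esub>\<close>: up to associativity, the two maps send it to
  \<open>(I \<otimes> I \<otimes> \<Delta>)(I \<otimes> L)x\<close> and \<open>(I \<otimes> I \<otimes> \<Delta>)(\<rho> \<otimes> I)x\<close>, the first because
  \<open>(L \<otimes> I)\<Delta> = (I \<otimes> \<Delta>)L\<close>. The comodule axioms then hold because they hold for \<open>\<Delta>\<close> after the
  injection into \<open>V\<^sub>1 \<otimes> (H\<^sub>\<alpha> \<otimes> N)\<close>.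
\<close>

section \<open>Linear maps\<close>

text \<open>The identification of
  \<open>Ind(\<rho>)\<^sub>\<alpha> \<otimes> H\<^sub>\<beta>\<close> with a subspace of
  \<open>V\<^sub>1 \<otimes> (H\<^sub>\<alpha> \<otimes> H\<^sub>\<beta>)\<close> is itself a claim:
  tensoring the subspace yields other cosets than tensoring the ambient space, and
  \<open>Ind_coaction\<close> picks a preimage under \<open>Ind_embed\<close>. The range inclusion
  makes such a preimage exist and injectivity makes it unique, so both precede the comodule axioms.
  Linearity and coassociativity are then compared after the embedding. Coordinates are taken on the
  right factor, where the embedding and the two equalized maps act as the identity. Membership in
  the equalizer is thereby tested slice by slice, and no complement of the equalizer has to be
  chosen. Tensor products are associative only up to isomorphism. Expressions in three or four
  factors are brought to the right-nested bracketing, with naturality of the associator and the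
  pentagon accounting for the brackets. Equations between linear maps are reduced to pure tensors.
  The expansion into slices is an existence statement with an index set depending on the element, so
  it needs an induction on tensors instead.\<close>

lemma module_homI:
  assumes "\<And>x. x \<in> carrier M \<Longrightarrow> f x \<in> carrier N"
    and "\<And>x y. \<lbrakk>x \<in> carrier M; y \<in> carrier M\<rbrakk> \<Longrightarrow> f (x \<oplus>\<^bsub>M\<^esub> y) = f x \<oplus>\<^bsub>N\<^esub> f y"
    and "\<And>k x. \<lbrakk>k \<in> carrier K; x \<in> carrier M\<rbrakk> \<Longrightarrow> f (k \<odot>\<^bsub>M\<^esub> x) = k \<odot>\<^bsub>N\<^esub> f x"
  shows "f \<in> module_hom K M N"
  using assms unfolding module_hom_def by auto

lemma module_hom_in: "\<lbrakk>f \<in> module_hom K M N; x \<in> carrier M\<rbrakk> \<Longrightarrow> f x \<in> carrier N"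
  using module_hom_closed by blast

lemma module_hom_id: "id \<in> module_hom K M M"
  by (auto intro: module_homI)

lemma module_hom_compose:
  "\<lbrakk>f \<in> module_hom K M N; g \<in> module_hom K N P\<rbrakk> \<Longrightarrow> (\<lambda>x. g (f x)) \<in> module_hom K M P"
  by (auto intro!: module_homI simp: module_hom_in module_hom_add module_hom_smult)

lemma module_hom_zero:
  assumes "vectorspace K M" "vectorspace K N" "f \<in> module_hom K M N"
  shows "f \<zero>\<^bsub>M\<^esub> = \<zero>\<^bsub>N\<^esub>"
proof -
  interpret mod_hom K M N f
    using assms by (auto simp: mod_hom_def mod_hom_axioms_def vectorspace_def)
  show ?thesis by simp
qed

lemma module_hom_minus:
  assumes "vectorspace K M" "vectorspace K N" "f \<in> module_hom K M N"
    "x \<in> carrier M" "y \<in> carrier M"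
  shows "f (x \<ominus>\<^bsub>M\<^esub> y) = f x \<ominus>\<^bsub>N\<^esub> f y"
proof -
  interpret mod_hom K M N f
    using assms by (auto simp: mod_hom_def mod_hom_axioms_def vectorspace_def)
  show ?thesis using assms by simp
qed

lemma module_hom_finsum:
  assumes "vectorspace K M" "vectorspace K N" "f \<in> module_hom K M N"
    "g \<in> A \<rightarrow> carrier M" "finite A"
  shows "f (\<Oplus>\<^bsub>M\<^esub>a\<in>A. g a) = (\<Oplus>\<^bsub>N\<^esub>a\<in>A. f (g a))"
proof -
  interpret M: vectorspace K M by fact
  interpret N: vectorspace K N by fact
  show ?thesis
    using assms(5,4)
  proof (induction A rule: finite_induct)
    case empty
    then show ?case using module_hom_zero[OF assms(1-3)] by simp
  next
    case (insert a A)
    moreover have "(\<Oplus>\<^bsub>M\<^esub>a\<in>A. g a) \<in> carrier M" using insert by (intro M.finsum_closed) auto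
    moreover have "(\<lambda>a. f (g a)) \<in> A \<rightarrow> carrier N" "f (g a) \<in> carrier N"
      using insert module_hom_in[OF assms(3)] by auto
    ultimately show ?case
      using module_hom_add[OF assms(3)] by (simp add: M.finsum_insert N.finsum_insert Pi_def)
  qed
qed

section \<open>Quotients and free spaces\<close>

locale subspace_quotient = M: vectorspace K M + N: submodule K N M
  for K :: "('k, 'z) ring_scheme" and M :: "('k, 'm) module" and N
begin

sublocale S: abelian_subgroup N M
proof (intro abelian_subgroupI3 additive_subgroupI)
  show "abelian_group M" by unfold_locales
  show "subgroup N (add_monoid M)"
  proof (rule M.add.subgroupI)
    fix a assume a: "a \<in> N"
    \<comment> \<open>Negatives in a submodule arise as multiples by minus one.\<close>
    then have "\<ominus>\<^bsub>K\<^esub> \<one>\<^bsub>K\<^esub> \<odot>\<^bsub>M\<^esub> a \<in> N" by (intro N.smult_closed) auto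
    then show "\<ominus>\<^bsub>M\<^esub> a \<in> N" using a N.subset M.smult_minus_1[of a] by (metis subsetD)
  next
    show "N \<noteq> {}" using N.zero_closed by blast
  qed (use N.subset in auto)
qed

lemma coset_eq_iff:
  assumes "f \<in> carrier M" "g \<in> carrier M"
  shows "N +>\<^bsub>M\<^esub> f = N +>\<^bsub>M\<^esub> g \<longleftrightarrow> f \<ominus>\<^bsub>M\<^esub> g \<in> N"
  using assms S.a_repr_independence'[of f g] S.a_rcos_self[of f]
    S.a_rcos_module[of g f] S.a_repr_independenceD[of g f]
  unfolding a_minus_def by blast

lemma quotient_carrier: "carrier (quotient_space K M N) = (\<lambda>f. N +>\<^bsub>M\<^esub> f) ` carrier M"
  by (auto simp: quotient_space_def A_RCOSETS_def')

lemma quotient_zero: "\<zero>\<^bsub>quotient_space K M N\<^esub> = N +>\<^bsub>M\<^esub> \<zero>\<^bsub>M\<^esub>"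
  using N.subset by (simp add: quotient_space_def)

lemma quotient_add:
  "\<lbrakk>f \<in> carrier M; g \<in> carrier M\<rbrakk> \<Longrightarrow>
    (N +>\<^bsub>M\<^esub> f) \<oplus>\<^bsub>quotient_space K M N\<^esub> (N +>\<^bsub>M\<^esub> g) = N +>\<^bsub>M\<^esub> (f \<oplus>\<^bsub>M\<^esub> g)"
  by (simp add: quotient_space_def S.a_rcos_sum)

text \<open>The scalar action on cosets is a union over all representatives. Since \<open>k\<close>
  maps \<open>N\<close> into itself, every member of the union is the same coset.\<close>

lemma quotient_smult:
  assumes "k \<in> carrier K" "f \<in> carrier M"
  shows "k \<odot>\<^bsub>quotient_space K M N\<^esub> (N +>\<^bsub>M\<^esub> f) = N +>\<^bsub>M\<^esub> (k \<odot>\<^bsub>M\<^esub> f)"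
proof -
  have "N +>\<^bsub>M\<^esub> (k \<odot>\<^bsub>M\<^esub> x) = N +>\<^bsub>M\<^esub> (k \<odot>\<^bsub>M\<^esub> f)" if x: "x \<in> N +>\<^bsub>M\<^esub> f" for x
  proof -
    obtain n where n: "n \<in> N" "x = n \<oplus>\<^bsub>M\<^esub> f" using x by (auto simp: a_r_coset_defs)
    have nM: "n \<in> carrier M" using n N.subset by auto
    have kn: "k \<odot>\<^bsub>M\<^esub> n \<in> N" using n assms by auto
    have "k \<odot>\<^bsub>M\<^esub> x = k \<odot>\<^bsub>M\<^esub> n \<oplus>\<^bsub>M\<^esub> k \<odot>\<^bsub>M\<^esub> f"
      using n nM assms by (simp add: M.smult_r_distr)
    then have "k \<odot>\<^bsub>M\<^esub> x \<in> N +>\<^bsub>M\<^esub> (k \<odot>\<^bsub>M\<^esub> f)" using kn by (auto simp: a_r_coset_defs)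
    then show ?thesis using assms by (intro S.a_repr_independence'[symmetric]) auto
  qed
  then have "(\<Union>x\<in>N +>\<^bsub>M\<^esub> f. N +>\<^bsub>M\<^esub> (k \<odot>\<^bsub>M\<^esub> x)) = (\<Union>x\<in>N +>\<^bsub>M\<^esub> f. N +>\<^bsub>M\<^esub> (k \<odot>\<^bsub>M\<^esub> f))"
    by (intro SUP_cong refl)
  also have "\<dots> = N +>\<^bsub>M\<^esub> (k \<odot>\<^bsub>M\<^esub> f)"
    using S.a_rcos_self[OF assms(2)] by blast
  finally show ?thesis by (simp add: quotient_space_def)
qed

lemmas quotient_simps = quotient_carrier quotient_zero quotient_add quotient_smult

lemma quotient_vectorspace: "vectorspace K (quotient_space K M N)"
proof (rule vs_criteria)
  show "field K" by unfold_locales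
  show "\<forall>v\<in>carrier (quotient_space K M N). \<exists>w\<in>carrier (quotient_space K M N).
      v \<oplus>\<^bsub>quotient_space K M N\<^esub> w = \<zero>\<^bsub>quotient_space K M N\<^esub>"
  proof
    fix v assume "v \<in> carrier (quotient_space K M N)"
    then obtain f where f: "f \<in> carrier M" "v = N +>\<^bsub>M\<^esub> f" by (auto simp: quotient_carrier)
    then show "\<exists>w\<in>carrier (quotient_space K M N).
      v \<oplus>\<^bsub>quotient_space K M N\<^esub> w = \<zero>\<^bsub>quotient_space K M N\<^esub>"
      by (intro bexI[of _ "N +>\<^bsub>M\<^esub> (\<ominus>\<^bsub>M\<^esub> f)"]) (auto simp: quotient_simps M.r_neg)
  qed
qed (auto simp: quotient_simps M.a_ac M.smult_assoc1 M.smult_l_distr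
    M.smult_r_distr)

end

section \<open>Free spaces and linear extension from generators\<close>

lemma free_space_simps:
  "\<zero>\<^bsub>free_space K X\<^esub> = (\<lambda>x. \<zero>\<^bsub>K\<^esub>)"
  "f \<oplus>\<^bsub>free_space K X\<^esub> g = (\<lambda>x. f x \<oplus>\<^bsub>K\<^esub> g x)"
  "k \<odot>\<^bsub>free_space K X\<^esub> f = (\<lambda>x. k \<otimes>\<^bsub>K\<^esub> f x)"
  by (simp_all add: free_space_def)

lemma free_space_carrier:
  "f \<in> carrier (free_space K X) \<longleftrightarrow> (\<forall>x. f x \<in> carrier K) \<and>
     finite {x. f x \<noteq> \<zero>\<^bsub>K\<^esub>} \<and> {x. f x \<noteq> \<zero>\<^bsub>K\<^esub>} \<subseteq> X"
  by (auto simp: free_space_def)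

context field
begin

lemma free_space_add:
  assumes "f \<in> carrier (free_space R X)" "g \<in> carrier (free_space R X)"
  shows "(\<lambda>x. f x \<oplus> g x) \<in> carrier (free_space R X)"
proof -
  have "{x. f x \<oplus> g x \<noteq> \<zero>} \<subseteq> {x. f x \<noteq> \<zero>} \<union> {x. g x \<noteq> \<zero>}" by auto
  with assms show ?thesis unfolding free_space_carrier
    by (intro conjI) (auto intro: finite_subset)
qed

lemma free_space_smult:
  assumes "f \<in> carrier (free_space R X)" "k \<in> carrier R"
  shows "(\<lambda>x. k \<otimes> f x) \<in> carrier (free_space R X)"
proof -
  have "{x. k \<otimes> f x \<noteq> \<zero>} \<subseteq> {x. f x \<noteq> \<zero>}" using assms(2) by auto
  with assms show ?thesis unfolding free_space_carrier
    by (intro conjI) (auto intro: finite_subset)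
qed

lemma free_space_vectorspace: "vectorspace R (free_space R X)"
proof -
  have val: "f x \<in> carrier R" if "f \<in> carrier (free_space R X)" for f x
    using that by (simp add: free_space_carrier)
  show ?thesis
  proof (rule vs_criteria)
    show "field R" by unfold_locales
    show "\<forall>v\<in>carrier (free_space R X). \<exists>w\<in>carrier (free_space R X).
        v \<oplus>\<^bsub>free_space R X\<^esub> w = \<zero>\<^bsub>free_space R X\<^esub>"
    proof
      fix v assume v: "v \<in> carrier (free_space R X)"
      then have "v \<oplus>\<^bsub>free_space R X\<^esub> (\<lambda>x. \<ominus> \<one> \<otimes> v x) = \<zero>\<^bsub>free_space R X\<^esub>"
        by (auto simp: free_space_simps free_space_carrier l_minus r_neg)
      then show "\<exists>w\<in>carrier (free_space R X).
        v \<oplus>\<^bsub>free_space R X\<^esub> w = \<zero>\<^bsub>free_space R X\<^esub>"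
        using free_space_smult[OF v, of "\<ominus> \<one>"] by auto
    qed
  next
    show "\<zero>\<^bsub>free_space R X\<^esub> \<in> carrier (free_space R X)"
      by (simp add: free_space_simps free_space_carrier)
  qed (use val in \<open>simp_all add: free_space_simps free_space_add free_space_smult a_ac m_assoc
      l_distr r_distr\<close>)
qed

lemma free_gen_in: "x \<in> X \<Longrightarrow> free_gen R x \<in> carrier (free_space R X)"
  by (auto simp: free_gen_def free_space_carrier)

end

text \<open>The linear extension of a map given on generators. \<open>tensor_lift\<close> is this
  sum evaluated at a chosen representative of the coset.\<close>

definition free_lift ::
  "('k, 'z) ring_scheme \<Rightarrow> ('k, 'p, 'w) module_scheme \<Rightarrow> ('x \<Rightarrow> 'p) \<Rightarrow> ('x \<Rightarrow> 'k) \<Rightarrow> 'p" where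
  "free_lift K P b f = (\<Oplus>\<^bsub>P\<^esub>x\<in>{x. f x \<noteq> \<zero>\<^bsub>K\<^esub>}. f x \<odot>\<^bsub>P\<^esub> b x)"

context vectorspace
begin

text \<open>The support changes when functions are added or scaled. Over a common finite index set
  linearity becomes a termwise computation.\<close>

lemma free_lift_superset:
  assumes "finite A" "{x. f x \<noteq> \<zero>\<^bsub>K\<^esub>} \<subseteq> A" "A \<subseteq> X" "b \<in> X \<rightarrow> carrier V" "\<And>x. f x \<in> carrier K"
  shows "free_lift K V b f = (\<Oplus>\<^bsub>V\<^esub>x\<in>A. f x \<odot>\<^bsub>V\<^esub> b x)"
  unfolding free_lift_def
  using assms
  by (intro M.add.finprod_mono_neutral_cong_left) (auto simp: Pi_iff subset_iff)

lemma free_lift_hom: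
  assumes b: "b \<in> X \<rightarrow> carrier V"
  shows "free_lift K V b \<in> module_hom K (free_space K X) V"
proof (rule module_homI)
  fix f assume f: "f \<in> carrier (free_space K X)"
  with b show "free_lift K V b f \<in> carrier V"
    unfolding free_lift_def by (intro M.finsum_closed) (auto simp: free_space_carrier)
  fix k assume k: "k \<in> carrier K"
  let ?A = "{x. f x \<noteq> \<zero>\<^bsub>K\<^esub>}"
  have fb: "f x \<in> carrier K" "x \<in> ?A \<Longrightarrow> b x \<in> carrier V" for x
    using f b by (auto simp: free_space_carrier)
  have "free_lift K V b (\<lambda>x. k \<otimes>\<^bsub>K\<^esub> f x) = (\<Oplus>\<^bsub>V\<^esub>x\<in>?A. (k \<otimes>\<^bsub>K\<^esub> f x) \<odot>\<^bsub>V\<^esub> b x)"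
    using f k b by (intro free_lift_superset[where X = X]) (auto simp: free_space_carrier)
  also have "\<dots> = (\<Oplus>\<^bsub>V\<^esub>x\<in>?A. k \<odot>\<^bsub>V\<^esub> (f x \<odot>\<^bsub>V\<^esub> b x))"
    using fb k by (intro M.finsum_cong') (auto simp: smult_assoc1)
  also have "\<dots> = k \<odot>\<^bsub>V\<^esub> free_lift K V b f"
    using fb k unfolding free_lift_def by (intro finsum_smult[symmetric]) auto
  finally show "free_lift K V b (k \<odot>\<^bsub>free_space K X\<^esub> f) = k \<odot>\<^bsub>V\<^esub> free_lift K V b f"
    by (simp add: free_space_simps)
next
  fix f g assume f: "f \<in> carrier (free_space K X)" and g: "g \<in> carrier (free_space K X)"
  let ?A = "{x. f x \<noteq> \<zero>\<^bsub>K\<^esub>} \<union> {x. g x \<noteq> \<zero>\<^bsub>K\<^esub>}"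
  have A: "finite ?A" "?A \<subseteq> X" using f g by (auto simp: free_space_carrier)
  have fg: "f x \<in> carrier K" "g x \<in> carrier K" for x using f g by (auto simp: free_space_carrier)
  have bA: "b x \<in> carrier V" if "x \<in> ?A" for x using b A that by auto
  have "free_lift K V b (\<lambda>x. f x \<oplus>\<^bsub>K\<^esub> g x) = (\<Oplus>\<^bsub>V\<^esub>x\<in>?A. (f x \<oplus>\<^bsub>K\<^esub> g x) \<odot>\<^bsub>V\<^esub> b x)"
    using fg A b by (intro free_lift_superset[where X = X]) auto
  also have "\<dots> = (\<Oplus>\<^bsub>V\<^esub>x\<in>?A. f x \<odot>\<^bsub>V\<^esub> b x \<oplus>\<^bsub>V\<^esub> g x \<odot>\<^bsub>V\<^esub> b x)"
    using fg bA by (intro M.finsum_cong') (auto simp: smult_l_distr)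
  also have "\<dots> = (\<Oplus>\<^bsub>V\<^esub>x\<in>?A. f x \<odot>\<^bsub>V\<^esub> b x) \<oplus>\<^bsub>V\<^esub> (\<Oplus>\<^bsub>V\<^esub>x\<in>?A. g x \<odot>\<^bsub>V\<^esub> b x)"
    using fg bA by (intro M.finsum_addf) auto
  also have "\<dots> = free_lift K V b f \<oplus>\<^bsub>V\<^esub> free_lift K V b g"
    using fg A b by (subst (1 2) free_lift_superset[where X = X and A = ?A]) auto
  finally show "free_lift K V b (f \<oplus>\<^bsub>free_space K X\<^esub> g) = free_lift K V b f \<oplus>\<^bsub>V\<^esub> free_lift K V b g"
    by (simp add: free_space_simps)
qed

lemma free_lift_gen:
  assumes "b x \<in> carrier V"
  shows "free_lift K V b (free_gen K x) = b x"
proof -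
  have "free_lift K V b (free_gen K x) = (\<Oplus>\<^bsub>V\<^esub>y\<in>{x}. free_gen K x y \<odot>\<^bsub>V\<^esub> b y)"
    using assms by (intro free_lift_superset[where X = "{x}"]) (auto simp: free_gen_def)
  also have "\<dots> = b x" using assms by (simp add: free_gen_def M.finsum_insert)
  finally show ?thesis .
qed

end

lemma free_space_decomp:
  assumes "field K" and f: "f \<in> carrier (free_space K X)"
  shows "f = free_lift K (free_space K X) (free_gen K) f"
proof -
  interpret K: field K by fact
  interpret F: vectorspace K "free_space K X" by (rule K.free_space_vectorspace)
  let ?A = "{x. f x \<noteq> \<zero>\<^bsub>K\<^esub>}"
  have A: "finite ?A" "?A \<subseteq> X" and fK: "\<And>x. f x \<in> carrier K" using f by (auto simp: free_space_carrier)
  \<comment> \<open>Generalized for the induction: the partial sum over \<open>B\<close> is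
    \<open>f\<close> cut off outside \<open>B\<close>. For the support of \<open>f\<close> nothing
    is cut off.\<close>
  have "(\<Oplus>\<^bsub>free_space K X\<^esub>x\<in>B. f x \<odot>\<^bsub>free_space K X\<^esub> free_gen K x) =
      (\<lambda>x. if x \<in> B then f x else \<zero>\<^bsub>K\<^esub>)" if "finite B" "B \<subseteq> X" for B
    using that
  proof (induction B rule: finite_induct)
    case empty
    then show ?case by (simp add: free_space_simps)
  next
    case (insert y B)
    then have "(\<lambda>x. f x \<odot>\<^bsub>free_space K X\<^esub> free_gen K x) \<in> B \<rightarrow> carrier (free_space K X)"
        "f y \<odot>\<^bsub>free_space K X\<^esub> free_gen K y \<in> carrier (free_space K X)"
      using fK by (auto intro!: F.smult_closed K.free_gen_in)
    with insert show ?case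
      using fK by (simp add: F.finsum_insert) (auto simp: free_space_simps free_gen_def fun_eq_iff)
  qed
  from this[OF A] show ?thesis by (simp add: free_lift_def fun_eq_iff)
qed

text \<open>The value at \<open>u\<close> is forced by the expansion of \<open>u\<close> into
  generators, because linear maps commute with finite sums.\<close>

lemma free_hom_eqI:
  assumes "vectorspace K P" "f \<in> module_hom K (free_space K X) P" "g \<in> module_hom K (free_space K X) P"
    and "\<And>x. x \<in> X \<Longrightarrow> f (free_gen K x) = g (free_gen K x)" "u \<in> carrier (free_space K X)"
  shows "f u = g u"
proof -
  interpret P: vectorspace K P by fact
  interpret F: vectorspace K "free_space K X" by (rule P.free_space_vectorspace)
  let ?A = "{x. u x \<noteq> \<zero>\<^bsub>K\<^esub>}"
  have A: "finite ?A" "?A \<subseteq> X" and uK: "\<And>x. u x \<in> carrier K"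
    using assms(5) by (auto simp: free_space_carrier)
  have "h u = (\<Oplus>\<^bsub>P\<^esub>x\<in>?A. u x \<odot>\<^bsub>P\<^esub> h (free_gen K x))" if h: "h \<in> module_hom K (free_space K X) P" for h
  proof -
    have "h u = h (\<Oplus>\<^bsub>free_space K X\<^esub>x\<in>?A. u x \<odot>\<^bsub>free_space K X\<^esub> free_gen K x)"
      using free_space_decomp[OF P.field_axioms assms(5)] by (simp add: free_lift_def)
    also have "\<dots> = (\<Oplus>\<^bsub>P\<^esub>x\<in>?A. h (u x \<odot>\<^bsub>free_space K X\<^esub> free_gen K x))"
      using A uK
      by (intro module_hom_finsum[OF F.vectorspace_axioms assms(1) h]) (auto intro!: F.smult_closed P.free_gen_in)
    also have "\<dots> = (\<Oplus>\<^bsub>P\<^esub>x\<in>?A. u x \<odot>\<^bsub>P\<^esub> h (free_gen K x))"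
      using A uK
      by (intro P.finsum_cong')
        (auto simp: module_hom_smult[OF h] module_hom_in[OF h] P.free_gen_in subset_iff
          intro!: P.smult_closed)
    finally show ?thesis .
  qed
  then have fs: "f u = (\<Oplus>\<^bsub>P\<^esub>x\<in>?A. u x \<odot>\<^bsub>P\<^esub> f (free_gen K x))"
    and gs: "g u = (\<Oplus>\<^bsub>P\<^esub>x\<in>?A. u x \<odot>\<^bsub>P\<^esub> g (free_gen K x))" using assms by auto
  show ?thesis unfolding fs gs
    using A uK assms(4)
    by (intro P.finsum_cong')
      (auto simp: subset_iff module_hom_in[OF assms(3)] P.free_gen_in intro!: P.smult_closed)
qed

section \<open>Tensor products\<close>

definition bilinear_map ::
  "('k, 'z) ring_scheme \<Rightarrow> ('k, 'm) module \<Rightarrow> ('k, 'n) module \<Rightarrow> ('k, 'p) module \<Rightarrow>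
    ('m \<Rightarrow> 'n \<Rightarrow> 'p) \<Rightarrow> bool" where
  "bilinear_map K M N P b \<longleftrightarrow>
    (\<forall>m\<in>carrier M. b m \<in> module_hom K N P) \<and>
    (\<forall>n\<in>carrier N. (\<lambda>m. b m n) \<in> module_hom K M P)"

lemma bilinear_mapD:
  assumes "bilinear_map K M N P b"
  shows "\<lbrakk>m \<in> carrier M; n \<in> carrier N\<rbrakk> \<Longrightarrow> b m n \<in> carrier P"
    and "\<lbrakk>m \<in> carrier M; m' \<in> carrier M; n \<in> carrier N\<rbrakk> \<Longrightarrow> b (m \<oplus>\<^bsub>M\<^esub> m') n = b m n \<oplus>\<^bsub>P\<^esub> b m' n"
    and "\<lbrakk>m \<in> carrier M; n \<in> carrier N; n' \<in> carrier N\<rbrakk> \<Longrightarrow> b m (n \<oplus>\<^bsub>N\<^esub> n') = b m n \<oplus>\<^bsub>P\<^esub> b m n'"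
    and "\<lbrakk>k \<in> carrier K; m \<in> carrier M; n \<in> carrier N\<rbrakk> \<Longrightarrow> b (k \<odot>\<^bsub>M\<^esub> m) n = k \<odot>\<^bsub>P\<^esub> b m n"
    and "\<lbrakk>k \<in> carrier K; m \<in> carrier M; n \<in> carrier N\<rbrakk> \<Longrightarrow> b m (k \<odot>\<^bsub>N\<^esub> n) = k \<odot>\<^bsub>P\<^esub> b m n"
proof -
  assume m: "m \<in> carrier M"
  then have l: "b m \<in> module_hom K N P" using assms by (auto simp: bilinear_map_def)
  show "n \<in> carrier N \<Longrightarrow> b m n \<in> carrier P"
    and "\<lbrakk>n \<in> carrier N; n' \<in> carrier N\<rbrakk> \<Longrightarrow> b m (n \<oplus>\<^bsub>N\<^esub> n') = b m n \<oplus>\<^bsub>P\<^esub> b m n'"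
    and "k \<in> carrier K \<Longrightarrow> n \<in> carrier N \<Longrightarrow> b m (k \<odot>\<^bsub>N\<^esub> n) = k \<odot>\<^bsub>P\<^esub> b m n"
    using module_hom_in[OF l] module_hom_add[OF l] module_hom_smult[OF l] by auto
  assume "n \<in> carrier N"
  then have r: "(\<lambda>m. b m n) \<in> module_hom K M P" using assms by (auto simp: bilinear_map_def)
  show "m' \<in> carrier M \<Longrightarrow> b (m \<oplus>\<^bsub>M\<^esub> m') n = b m n \<oplus>\<^bsub>P\<^esub> b m' n"
    and "k \<in> carrier K \<Longrightarrow> b (k \<odot>\<^bsub>M\<^esub> m) n = k \<odot>\<^bsub>P\<^esub> b m n"
    using m module_hom_add[OF r] module_hom_smult[OF r] by auto
qed

lemma bilinear_mapI:
  assumes "\<And>m n. \<lbrakk>m \<in> carrier M; n \<in> carrier N\<rbrakk> \<Longrightarrow> b m n \<in> carrier P"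
    and "\<And>m m' n. \<lbrakk>m \<in> carrier M; m' \<in> carrier M; n \<in> carrier N\<rbrakk> \<Longrightarrow> b (m \<oplus>\<^bsub>M\<^esub> m') n = b m n \<oplus>\<^bsub>P\<^esub> b m' n"
    and "\<And>m n n'. \<lbrakk>m \<in> carrier M; n \<in> carrier N; n' \<in> carrier N\<rbrakk> \<Longrightarrow> b m (n \<oplus>\<^bsub>N\<^esub> n') = b m n \<oplus>\<^bsub>P\<^esub> b m n'"
    and "\<And>k m n. \<lbrakk>k \<in> carrier K; m \<in> carrier M; n \<in> carrier N\<rbrakk> \<Longrightarrow> b (k \<odot>\<^bsub>M\<^esub> m) n = k \<odot>\<^bsub>P\<^esub> b m n"
    and "\<And>k m n. \<lbrakk>k \<in> carrier K; m \<in> carrier M; n \<in> carrier N\<rbrakk> \<Longrightarrow> b m (k \<odot>\<^bsub>N\<^esub> n) = k \<odot>\<^bsub>P\<^esub> b m n"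
  shows "bilinear_map K M N P b"
  unfolding bilinear_map_def by (auto intro!: module_homI assms)

lemma bilinear_map_flip: "bilinear_map K M N P b \<Longrightarrow> bilinear_map K N M P (\<lambda>n m. b m n)"
  by (simp add: bilinear_map_def)

lemma tensor_lift_conv:
  "tensor_lift K P b X = free_lift K P (\<lambda>p. b (fst p) (snd p)) (SOME f. f \<in> X)"
  by (simp add: tensor_lift_def free_lift_def Let_def)

locale tensor_spaces = M: vectorspace K M + N: vectorspace K N
  for K :: "('k, 'z) ring_scheme" and M :: "('k, 'm) module" and N :: "('k, 'n) module"
begin

abbreviation "F \<equiv> tensor_free K M N"
abbreviation "gen m n \<equiv> free_gen K (m, n)"

lemma free_vectorspace: "vectorspace K F"
  unfolding tensor_free_def by (rule M.free_space_vectorspace)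

sublocale F: vectorspace K F
  by (rule free_vectorspace)

lemma gen_in: "\<lbrakk>m \<in> carrier M; n \<in> carrier N\<rbrakk> \<Longrightarrow> gen m n \<in> carrier F"
  by (simp add: tensor_free_def M.free_gen_in)

lemma rels_subset: "tensor_rels K M N \<subseteq> carrier F"
  unfolding tensor_rels_def Let_def
  by (auto intro!: F.minus_closed F.smult_closed gen_in)

lemma null_submodule: "submodule K (tensor_null K M N) F"
  unfolding tensor_null_def by (rule F.span_is_submodule[OF rels_subset])

sublocale Q: subspace_quotient K F "tensor_null K M N"
  by (intro subspace_quotient.intro free_vectorspace null_submodule)

lemma rels_null: "r \<in> tensor_rels K M N \<Longrightarrow> r \<in> tensor_null K M N"
  unfolding tensor_null_def using F.in_own_span[OF rels_subset] by blast

lemma tensor_vectorspace: "vectorspace K (tensor K M N)"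
  unfolding tensor_def by (rule Q.quotient_vectorspace)

text \<open>Each of the four families in \<open>tensor_rels\<close> becomes one bilinearity law
  through \<open>coset_eq_iff\<close>.\<close>

lemma pure_bilinear: "bilinear_map K M N (tensor K M N) (pure K M N)"
proof (rule bilinear_mapI)
  show "pure K M N m n \<in> carrier (tensor K M N)" if "m \<in> carrier M" "n \<in> carrier N" for m n
    using gen_in[OF that] by (auto simp: tensor_def pure_def Q.quotient_carrier)
next
  fix m m' n assume *: "m \<in> carrier M" "m' \<in> carrier M" "n \<in> carrier N"
  then have "gen (m \<oplus>\<^bsub>M\<^esub> m') n \<ominus>\<^bsub>F\<^esub> (gen m n \<oplus>\<^bsub>F\<^esub> gen m' n) \<in> tensor_null K M N"
    by (intro rels_null[unfolded tensor_rels_def Let_def]) blast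
  with * show "pure K M N (m \<oplus>\<^bsub>M\<^esub> m') n = pure K M N m n \<oplus>\<^bsub>tensor K M N\<^esub> pure K M N m' n"
    by (simp add: tensor_def pure_def gen_in Q.quotient_add Q.coset_eq_iff)
next
  fix m n n' assume *: "m \<in> carrier M" "n \<in> carrier N" "n' \<in> carrier N"
  then have "gen m (n \<oplus>\<^bsub>N\<^esub> n') \<ominus>\<^bsub>F\<^esub> (gen m n \<oplus>\<^bsub>F\<^esub> gen m n') \<in> tensor_null K M N"
    by (intro rels_null[unfolded tensor_rels_def Let_def]) blast
  with * show "pure K M N m (n \<oplus>\<^bsub>N\<^esub> n') = pure K M N m n \<oplus>\<^bsub>tensor K M N\<^esub> pure K M N m n'"
    by (simp add: tensor_def pure_def gen_in Q.quotient_add Q.coset_eq_iff)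
next
  fix k m n assume *: "k \<in> carrier K" "m \<in> carrier M" "n \<in> carrier N"
  then have "gen (k \<odot>\<^bsub>M\<^esub> m) n \<ominus>\<^bsub>F\<^esub> k \<odot>\<^bsub>F\<^esub> gen m n \<in> tensor_null K M N"
    by (intro rels_null[unfolded tensor_rels_def Let_def]) blast
  with * show "pure K M N (k \<odot>\<^bsub>M\<^esub> m) n = k \<odot>\<^bsub>tensor K M N\<^esub> pure K M N m n"
    by (simp add: tensor_def pure_def gen_in Q.quotient_smult Q.coset_eq_iff)
  from * have "gen m (k \<odot>\<^bsub>N\<^esub> n) \<ominus>\<^bsub>F\<^esub> k \<odot>\<^bsub>F\<^esub> gen m n \<in> tensor_null K M N"
    by (intro rels_null[unfolded tensor_rels_def Let_def]) blast
  with * show "pure K M N m (k \<odot>\<^bsub>N\<^esub> n) = k \<odot>\<^bsub>tensor K M N\<^esub> pure K M N m n"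
    by (simp add: tensor_def pure_def gen_in Q.quotient_smult Q.coset_eq_iff)
qed

text \<open>Well-definedness of the universal map. Bilinearity puts the relations, hence their span
  \<open>tensor_null\<close>, into the kernel of the linear extension, so the representative picked
  by \<open>SOME\<close> gives the same value as \<open>f\<close>.\<close>

lemma tensor_lift_coset:
  assumes P: "vectorspace K P" and b: "bilinear_map K M N P b" and f: "f \<in> carrier F"
  shows "tensor_lift K P b (tensor_null K M N +>\<^bsub>F\<^esub> f) = free_lift K P (\<lambda>p. b (fst p) (snd p)) f"
proof -
  interpret P: vectorspace K P by fact
  let ?b = "\<lambda>p. b (fst p) (snd p)"
  let ?l = "free_lift K P ?b"
  have l: "?l \<in> module_hom K F P"
    unfolding tensor_free_def using bilinear_mapD(1)[OF b] by (intro P.free_lift_hom) auto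
  interpret L: mod_hom K F P ?l
    using l by (intro mod_hom.intro mod_hom_axioms.intro) unfold_locales
  have lgen: "?l (gen m n) = b m n" if "m \<in> carrier M" "n \<in> carrier N" for m n
    using bilinear_mapD(1)[OF b that] by (subst P.free_lift_gen) auto
  \<comment> \<open>Every relation is a difference, so to see that it is killed it suffices to
    evaluate both terms and compare them by bilinearity.\<close>
  have lF: "?l (x \<ominus>\<^bsub>F\<^esub> y) = \<zero>\<^bsub>P\<^esub>" if "x \<in> carrier F" "y \<in> carrier F" "?l x = ?l y" for x y
    using that by (simp add: P.r_neg a_minus_def)
  have "tensor_rels K M N \<subseteq> L.ker"
    using rels_subset unfolding L.ker_def
    by (auto simp: tensor_rels_def Let_def lgen gen_in bilinear_mapD[OF b] intro!: lF)
  then have null: "tensor_null K M N \<subseteq> L.ker"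
    unfolding tensor_null_def by (rule F.span_is_subset) (rule L.ker_is_submodule)
  define g where "g = (SOME g. g \<in> tensor_null K M N +>\<^bsub>F\<^esub> f)"
  have g: "g \<in> tensor_null K M N +>\<^bsub>F\<^esub> f"
    unfolding g_def
    by (rule someI[where P = "\<lambda>g. g \<in> tensor_null K M N +>\<^bsub>F\<^esub> f", OF Q.S.a_rcos_self[OF f]])
  then obtain n where n: "n \<in> tensor_null K M N" "g = n \<oplus>\<^bsub>F\<^esub> f"
    by (auto simp: a_r_coset_defs)
  with null have "n \<in> carrier F" "?l n = \<zero>\<^bsub>P\<^esub>" by (auto simp: L.ker_def)
  with n f have "?l g = ?l f" by simp
  then show ?thesis by (simp add: tensor_lift_conv g_def)
qed

lemma coset_hom: "(\<lambda>f. tensor_null K M N +>\<^bsub>F\<^esub> f) \<in> module_hom K F (tensor K M N)"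
  unfolding tensor_def
  by (rule module_homI) (auto simp: Q.quotient_carrier Q.quotient_add Q.quotient_smult)

lemma tensor_cases:
  assumes "x \<in> carrier (tensor K M N)"
  obtains f where "f \<in> carrier F" "x = tensor_null K M N +>\<^bsub>F\<^esub> f"
  using assms by (auto simp: tensor_def Q.quotient_carrier)

lemma tensor_lift_pure:
  assumes "vectorspace K P" "bilinear_map K M N P b" "m \<in> carrier M" "n \<in> carrier N"
  shows "tensor_lift K P b (pure K M N m n) = b m n"
proof -
  interpret P: vectorspace K P by fact
  show ?thesis
    unfolding pure_def using assms bilinear_mapD(1)[OF assms(2-4)]
    by (simp add: tensor_lift_coset gen_in P.free_lift_gen)
qed

lemma tensor_lift_hom:
  assumes "vectorspace K P" "bilinear_map K M N P b"
  shows "tensor_lift K P b \<in> module_hom K (tensor K M N) P"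
proof -
  interpret P: vectorspace K P by fact
  have l: "free_lift K P (\<lambda>p. b (fst p) (snd p)) \<in> module_hom K F P"
    unfolding tensor_free_def using bilinear_mapD(1)[OF assms(2)] by (intro P.free_lift_hom) auto
  note q = tensor_lift_coset[OF assms]
  show ?thesis
  proof (rule module_homI)
    fix x assume "x \<in> carrier (tensor K M N)"
    then obtain f where f: "f \<in> carrier F" "x = tensor_null K M N +>\<^bsub>F\<^esub> f" by (rule tensor_cases)
    then show "tensor_lift K P b x \<in> carrier P" using module_hom_in[OF l] by (simp add: q)
    show "tensor_lift K P b (k \<odot>\<^bsub>tensor K M N\<^esub> x) = k \<odot>\<^bsub>P\<^esub> tensor_lift K P b x"
      if "k \<in> carrier K" for k
      using that f module_hom_smult[OF l] by (simp add: q tensor_def Q.quotient_smult)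
    fix y assume "y \<in> carrier (tensor K M N)"
    then obtain g where g: "g \<in> carrier F" "y = tensor_null K M N +>\<^bsub>F\<^esub> g" by (rule tensor_cases)
    with f show "tensor_lift K P b (x \<oplus>\<^bsub>tensor K M N\<^esub> y) = tensor_lift K P b x \<oplus>\<^bsub>P\<^esub> tensor_lift K P b y"
      using module_hom_add[OF l] by (simp add: q tensor_def Q.quotient_add)
  qed
qed

text \<open>Precomposing with the quotient map moves the question to the free space, where values on
  generators decide. Most identities below are reduced to pure tensors by this rule or its
  iterates.\<close>

lemma tensor_eqI:
  assumes "vectorspace K P" "f \<in> module_hom K (tensor K M N) P" "g \<in> module_hom K (tensor K M N) P"
    and eq: "\<And>m n. \<lbrakk>m \<in> carrier M; n \<in> carrier N\<rbrakk> \<Longrightarrow> f (pure K M N m n) = g (pure K M N m n)"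
    and x: "x \<in> carrier (tensor K M N)"
  shows "f x = g x"
proof -
  obtain u where u: "u \<in> carrier F" "x = tensor_null K M N +>\<^bsub>F\<^esub> u" using x by (rule tensor_cases)
  have "f (tensor_null K M N +>\<^bsub>F\<^esub> u) = g (tensor_null K M N +>\<^bsub>F\<^esub> u)"
  proof (rule free_hom_eqI[where f = "\<lambda>u. f (tensor_null K M N +>\<^bsub>F\<^esub> u)" and
        g = "\<lambda>u. g (tensor_null K M N +>\<^bsub>F\<^esub> u)", OF assms(1)])
    show "(\<lambda>u. f (tensor_null K M N +>\<^bsub>F\<^esub> u)) \<in> module_hom K (free_space K (carrier M \<times> carrier N)) P"
      using module_hom_compose[OF coset_hom assms(2)] by (simp only: tensor_free_def)
    show "(\<lambda>u. g (tensor_null K M N +>\<^bsub>F\<^esub> u)) \<in> module_hom K (free_space K (carrier M \<times> carrier N)) P"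
      using module_hom_compose[OF coset_hom assms(3)] by (simp only: tensor_free_def)
    show "u \<in> carrier (free_space K (carrier M \<times> carrier N))"
      using u(1) by (simp only: tensor_free_def)
    fix x assume "x \<in> carrier M \<times> carrier N"
    then obtain m n where "x = (m, n)" "m \<in> carrier M" "n \<in> carrier N" by blast
    then show "f (tensor_null K M N +>\<^bsub>F\<^esub> free_gen K x) = g (tensor_null K M N +>\<^bsub>F\<^esub> free_gen K x)"
      using eq[of m n] by (simp only: pure_def)
  qed
  with u show ?thesis by simp
qed

end

text \<open>Versions outside the locale: several nested tensor products occur in one argument, and
  their vector space facts are passed explicitly.\<close>

lemmas tensor_vectorspace = tensor_spaces.tensor_vectorspace[OF tensor_spaces.intro]
lemmas pure_bilinear = tensor_spaces.pure_bilinear[OF tensor_spaces.intro]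
lemmas pure_in = bilinear_mapD(1)[OF pure_bilinear]
lemmas tensor_lift_pure = tensor_spaces.tensor_lift_pure[OF tensor_spaces.intro]
lemmas tensor_lift_hom = tensor_spaces.tensor_lift_hom[OF tensor_spaces.intro]
lemmas tensor_eqI = tensor_spaces.tensor_eqI[OF tensor_spaces.intro]

lemma bilinear_map_compose:
  assumes "f \<in> module_hom K M P" "g \<in> module_hom K N Q" "bilinear_map K P Q R b"
  shows "bilinear_map K M N R (\<lambda>m n. b (f m) (g n))"
  using bilinear_mapD[OF assms(3)] assms(1,2)
  by (intro bilinear_mapI) (simp_all add: module_hom_in module_hom_add module_hom_smult)

lemma module_hom_add_fun:
  assumes "vectorspace K N" "f \<in> module_hom K M N" "g \<in> module_hom K M N"
  shows "(\<lambda>x. f x \<oplus>\<^bsub>N\<^esub> g x) \<in> module_hom K M N"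
proof -
  interpret N: vectorspace K N by fact
  show ?thesis using assms(2,3)
    by (intro module_homI)
      (simp_all add: module_hom_in module_hom_add module_hom_smult N.a_ac N.smult_r_distr)
qed

lemma module_hom_smult_fun:
  assumes "vectorspace K N" "f \<in> module_hom K M N" "k \<in> carrier K"
  shows "(\<lambda>x. k \<odot>\<^bsub>N\<^esub> f x) \<in> module_hom K M N"
proof -
  interpret N: vectorspace K N by fact
  have "k \<odot>\<^bsub>N\<^esub> (l \<odot>\<^bsub>N\<^esub> y) = l \<odot>\<^bsub>N\<^esub> (k \<odot>\<^bsub>N\<^esub> y)" if "l \<in> carrier K" "y \<in> carrier N" for l y
    using that assms(3) by (metis N.m_comm N.smult_assoc1)
  then show ?thesis using assms(2,3)
    by (intro module_homI) (simp_all add: module_hom_in module_hom_add module_hom_smult N.smult_r_distr)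
qed

text \<open>A universal map depending linearly on a parameter \<open>c\<close>, as needed for the
  nested lifts of the associator. For linearity in \<open>c\<close>, both sides are linear in
  \<open>t\<close>, so pure tensors suffice.\<close>

lemma tensor_lift_bilinear:
  assumes vs: "vectorspace K A" "vectorspace K B" "vectorspace K T"
    and ab: "\<And>c. c \<in> carrier C \<Longrightarrow> bilinear_map K A B T (b c)"
    and c: "\<And>x y. \<lbrakk>x \<in> carrier A; y \<in> carrier B\<rbrakk> \<Longrightarrow> (\<lambda>c. b c x y) \<in> module_hom K C T"
    and C: "vectorspace K C"
  shows "bilinear_map K (tensor K A B) C T (\<lambda>t c. tensor_lift K T (b c) t)"
proof -
  interpret C: vectorspace K C by fact
  note hom = tensor_lift_hom[OF vs(1-3) ab] and val = tensor_lift_pure[OF vs(1-3) ab]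
  show ?thesis
  proof (rule bilinear_mapI)
    fix t c c' assume t: "t \<in> carrier (tensor K A B)" and cc: "c \<in> carrier C" "c' \<in> carrier C"
    then have c': "c \<oplus>\<^bsub>C\<^esub> c' \<in> carrier C" by simp
    show "tensor_lift K T (b (c \<oplus>\<^bsub>C\<^esub> c')) t = tensor_lift K T (b c) t \<oplus>\<^bsub>T\<^esub> tensor_lift K T (b c') t"
      by (rule tensor_eqI[OF vs hom[OF c'] module_hom_add_fun[OF vs(3) hom[OF cc(1)] hom[OF cc(2)]] _ t])
        (simp add: val c' cc module_hom_add[OF c])
  next
    fix t c k assume t: "t \<in> carrier (tensor K A B)" and cc: "c \<in> carrier C" and k: "k \<in> carrier K"
    then have c': "k \<odot>\<^bsub>C\<^esub> c \<in> carrier C" by simp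
    show "tensor_lift K T (b (k \<odot>\<^bsub>C\<^esub> c)) t = k \<odot>\<^bsub>T\<^esub> tensor_lift K T (b c) t"
      by (rule tensor_eqI[OF vs hom[OF c'] module_hom_smult_fun[OF vs(3) hom[OF cc] k] _ t])
        (simp add: val c' cc k module_hom_smult[OF c])
  qed (simp_all add: module_hom_in[OF hom] module_hom_add[OF hom] module_hom_smult[OF hom])
qed

section \<open>Maps of tensor products and the associativity isomorphism\<close>

context
  fixes K :: "('k, 'z) ring_scheme"
begin

lemma tensor_map_bilinear:
  assumes "vectorspace K P" "vectorspace K Q" "f \<in> module_hom K M P" "g \<in> module_hom K N Q"
  shows "bilinear_map K M N (tensor K P Q) (\<lambda>m n. pure K P Q (f m) (g n))"
  by (rule bilinear_map_compose[OF assms(3,4) pure_bilinear[OF assms(1,2)]])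

lemma tensor_map_hom:
  assumes "vectorspace K M" "vectorspace K N" "vectorspace K P" "vectorspace K Q"
    "f \<in> module_hom K M P" "g \<in> module_hom K N Q"
  shows "tensor_map K P Q f g \<in> module_hom K (tensor K M N) (tensor K P Q)"
  unfolding tensor_map_def using assms
  by (intro tensor_lift_hom tensor_map_bilinear tensor_vectorspace)

lemma tensor_map_pure:
  assumes "vectorspace K M" "vectorspace K N" "vectorspace K P" "vectorspace K Q"
    "f \<in> module_hom K M P" "g \<in> module_hom K N Q" "m \<in> carrier M" "n \<in> carrier N"
  shows "tensor_map K P Q f g (pure K M N m n) = pure K P Q (f m) (g n)"
  unfolding tensor_map_def using assms
  by (subst tensor_lift_pure[where M = M and N = N and P = "tensor K P Q"])
    (auto intro!: tensor_map_bilinear tensor_vectorspace)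

text \<open>Functoriality of the tensor product. Composites are written pointwise, so chained uses
  leave terms such as \<open>id (id m)\<close>; they are absorbed by \<open>tensor_map_cong\<close>
  or by unfolding \<open>id_def\<close>.\<close>

lemma tensor_map_comp:
  assumes vs: "vectorspace K M" "vectorspace K N" "vectorspace K P" "vectorspace K Q"
    "vectorspace K P'" "vectorspace K Q'"
    and h: "f \<in> module_hom K M P" "g \<in> module_hom K N Q" "f' \<in> module_hom K P P'" "g' \<in> module_hom K Q Q'"
    and x: "x \<in> carrier (tensor K M N)"
  shows "tensor_map K P' Q' f' g' (tensor_map K P Q f g x) =
    tensor_map K P' Q' (\<lambda>m. f' (f m)) (\<lambda>n. g' (g n)) x"
  by (rule tensor_eqI[OF vs(1,2) tensor_vectorspace[OF vs(5,6)] _ _ _ x])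
    (simp_all add: module_hom_compose[OF tensor_map_hom tensor_map_hom] vs h
      tensor_map_hom tensor_map_pure[where M = M and N = N] tensor_map_pure[where M = P and N = Q]
      module_hom_compose[OF h(1,3)] module_hom_compose[OF h(2,4)] module_hom_in[OF h(1)] module_hom_in[OF h(2)])

text \<open>Coassociativity and similar laws hold on carriers only and cannot be rewritten under a
  lambda. This rule applies them inside a tensor map.\<close>

lemma tensor_map_cong:
  assumes vs: "vectorspace K M" "vectorspace K N" "vectorspace K P" "vectorspace K Q"
    and h: "f \<in> module_hom K M P" "g \<in> module_hom K N Q" "f' \<in> module_hom K M P" "g' \<in> module_hom K N Q"
    and eq: "\<And>m. m \<in> carrier M \<Longrightarrow> f m = f' m" "\<And>n. n \<in> carrier N \<Longrightarrow> g n = g' n"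
    and x: "x \<in> carrier (tensor K M N)"
  shows "tensor_map K P Q f g x = tensor_map K P Q f' g' x"
  by (rule tensor_eqI[OF vs(1,2) tensor_vectorspace[OF vs(3,4)] _ _ _ x])
    (simp_all add: tensor_map_hom vs h tensor_map_pure[where M = M and N = N] eq)

lemma tensor_map_id:
  assumes vs: "vectorspace K M" "vectorspace K N" and x: "x \<in> carrier (tensor K M N)"
  shows "tensor_map K M N id id x = x"
  using tensor_eqI[OF vs tensor_vectorspace[OF vs] tensor_map_hom[OF vs vs] module_hom_id _ x]
  by (simp add: vs tensor_map_pure[where M = M and N = N] module_hom_id)

lemma pure_hom_left:
  "\<lbrakk>vectorspace K M; vectorspace K N; n \<in> carrier N\<rbrakk> \<Longrightarrow> (\<lambda>m. pure K M N m n) \<in> module_hom K M (tensor K M N)"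
  using pure_bilinear[of K M N] by (auto simp: bilinear_map_def)

lemma pure_hom_right:
  "\<lbrakk>vectorspace K M; vectorspace K N; m \<in> carrier M\<rbrakk> \<Longrightarrow> pure K M N m \<in> module_hom K N (tensor K M N)"
  using pure_bilinear[of K M N] by (auto simp: bilinear_map_def)

text \<open>With \<open>c\<close> fixed, \<open>pure t c\<close> is linear in \<open>t\<close>, so
  \<open>tensor_eqI\<close> applies a second time, to the inner tensor product.\<close>

lemma tensor3_eqI:
  assumes vs: "vectorspace K A" "vectorspace K B" "vectorspace K C" "vectorspace K P"
    and h: "f \<in> module_hom K (tensor K (tensor K A B) C) P" "g \<in> module_hom K (tensor K (tensor K A B) C) P"
    and eq: "\<And>a b c. \<lbrakk>a \<in> carrier A; b \<in> carrier B; c \<in> carrier C\<rbrakk> \<Longrightarrow>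
      f (pure K (tensor K A B) C (pure K A B a b) c) = g (pure K (tensor K A B) C (pure K A B a b) c)"
    and x: "x \<in> carrier (tensor K (tensor K A B) C)"
  shows "f x = g x"
proof (rule tensor_eqI[OF tensor_vectorspace[OF vs(1,2)] vs(3,4) h _ x])
  fix t c assume t: "t \<in> carrier (tensor K A B)" and c: "c \<in> carrier C"
  note l = pure_hom_left[OF tensor_vectorspace[OF vs(1,2)] vs(3) c]
  show "f (pure K (tensor K A B) C t c) = g (pure K (tensor K A B) C t c)"
    by (rule tensor_eqI[OF vs(1,2,4) module_hom_compose[OF l h(1)] module_hom_compose[OF l h(2)] eq t])
      (use c in auto)
qed

lemma tensor3_eqI':
  assumes vs: "vectorspace K A" "vectorspace K B" "vectorspace K C" "vectorspace K P"
    and h: "f \<in> module_hom K (tensor K A (tensor K B C)) P" "g \<in> module_hom K (tensor K A (tensor K B C)) P"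
    and eq: "\<And>a b c. \<lbrakk>a \<in> carrier A; b \<in> carrier B; c \<in> carrier C\<rbrakk> \<Longrightarrow>
      f (pure K A (tensor K B C) a (pure K B C b c)) = g (pure K A (tensor K B C) a (pure K B C b c))"
    and x: "x \<in> carrier (tensor K A (tensor K B C))"
  shows "f x = g x"
proof (rule tensor_eqI[OF vs(1) tensor_vectorspace[OF vs(2,3)] vs(4) h _ x])
  fix a t assume a: "a \<in> carrier A" and t: "t \<in> carrier (tensor K B C)"
  note l = pure_hom_right[OF vs(1) tensor_vectorspace[OF vs(2,3)] a]
  show "f (pure K A (tensor K B C) a t) = g (pure K A (tensor K B C) a t)"
    by (rule tensor_eqI[OF vs(2,3,4) module_hom_compose[OF l h(1)] module_hom_compose[OF l h(2)] eq t])
      (use a in auto)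
qed

lemma tensor4_eqI:
  assumes vs: "vectorspace K A" "vectorspace K B" "vectorspace K C" "vectorspace K D" "vectorspace K P"
    and h: "f \<in> module_hom K (tensor K (tensor K (tensor K A B) C) D) P"
      "g \<in> module_hom K (tensor K (tensor K (tensor K A B) C) D) P"
    and eq: "\<And>a b c d. \<lbrakk>a \<in> carrier A; b \<in> carrier B; c \<in> carrier C; d \<in> carrier D\<rbrakk> \<Longrightarrow>
      f (pure K (tensor K (tensor K A B) C) D (pure K (tensor K A B) C (pure K A B a b) c) d) =
      g (pure K (tensor K (tensor K A B) C) D (pure K (tensor K A B) C (pure K A B a b) c) d)"
    and x: "x \<in> carrier (tensor K (tensor K (tensor K A B) C) D)"
  shows "f x = g x"
proof (rule tensor_eqI[OF tensor_vectorspace[OF tensor_vectorspace[OF vs(1,2)] vs(3)] vs(4,5) h _ x])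
  let ?T = "tensor K (tensor K A B) C"
  fix t d assume t: "t \<in> carrier ?T" and d: "d \<in> carrier D"
  note l = pure_hom_left[OF tensor_vectorspace[OF tensor_vectorspace[OF vs(1,2)] vs(3)] vs(4) d]
  show "f (pure K ?T D t d) = g (pure K ?T D t d)"
    by (rule tensor3_eqI[OF vs(1,2,3,5) module_hom_compose[OF l h(1)] module_hom_compose[OF l h(2)] eq t])
      (use d in auto)
qed

end

text \<open>Built by the universal property rather than as an inverse function, so that linearity
  and the values on pure tensors come from the same lemmas as for
  \<open>tensor_assoc\<close>.\<close>

definition tensor_assoc_inv ::
  "('k, 'z) ring_scheme \<Rightarrow> ('k, 'a) module \<Rightarrow> ('k, 'b) module \<Rightarrow> ('k, 'c) module \<Rightarrow>
    ('a \<times> ('b \<times> 'c \<Rightarrow> 'k) set \<Rightarrow> 'k) set \<Rightarrow> (('a \<times> 'b \<Rightarrow> 'k) set \<times> 'c \<Rightarrow> 'k) set" where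
  "tensor_assoc_inv K A B C =
    (let T = tensor K (tensor K A B) C in
      tensor_lift K T
        (\<lambda>a t. tensor_lift K T (\<lambda>b c. pure K (tensor K A B) C (pure K A B a b) c) t))"

context
  fixes K :: "('k, 'z) ring_scheme" and A :: "('k, 'a) module" and B :: "('k, 'b) module"
    and C :: "('k, 'c) module"
  assumes vs: "vectorspace K A" "vectorspace K B" "vectorspace K C"
begin

lemma assoc_inner_bilinear:
  "c \<in> carrier C \<Longrightarrow>
    bilinear_map K A B (tensor K A (tensor K B C)) (\<lambda>a b. pure K A (tensor K B C) a (pure K B C b c))"
  by (rule bilinear_map_compose[OF module_hom_id[unfolded id_def] pure_hom_left[OF vs(2,3)]
      pure_bilinear[OF vs(1) tensor_vectorspace[OF vs(2,3)]]])

lemma assoc_inv_inner_bilinear: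
  "a \<in> carrier A \<Longrightarrow>
    bilinear_map K B C (tensor K (tensor K A B) C) (\<lambda>b c. pure K (tensor K A B) C (pure K A B a b) c)"
  by (rule bilinear_map_compose[OF pure_hom_right[OF vs(1,2)] module_hom_id[unfolded id_def]
      pure_bilinear[OF tensor_vectorspace[OF vs(1,2)] vs(3)]])

lemma assoc_outer_bilinear:
  "bilinear_map K (tensor K A B) C (tensor K A (tensor K B C))
    (\<lambda>t c. tensor_lift K (tensor K A (tensor K B C)) (\<lambda>a b. pure K A (tensor K B C) a (pure K B C b c)) t)"
  by (rule tensor_lift_bilinear[OF vs(1,2) tensor_vectorspace[OF vs(1) tensor_vectorspace[OF vs(2,3)]]
      assoc_inner_bilinear module_hom_compose[OF pure_hom_right[OF vs(2,3)]
        pure_hom_right[OF vs(1) tensor_vectorspace[OF vs(2,3)]]] vs(3)])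

text \<open>Here the parameter of the inner lift is the left factor \<open>a\<close>, whereas
  \<open>tensor_lift_bilinear\<close> has it on the right; hence the flip.\<close>

lemma assoc_inv_outer_bilinear:
  "bilinear_map K A (tensor K B C) (tensor K (tensor K A B) C)
    (\<lambda>a t. tensor_lift K (tensor K (tensor K A B) C) (\<lambda>b c. pure K (tensor K A B) C (pure K A B a b) c) t)"
  by (rule bilinear_map_flip[OF tensor_lift_bilinear[OF vs(2,3)
      tensor_vectorspace[OF tensor_vectorspace[OF vs(1,2)] vs(3)] assoc_inv_inner_bilinear
      module_hom_compose[OF pure_hom_left[OF vs(1,2)] pure_hom_left[OF tensor_vectorspace[OF vs(1,2)] vs(3)]]
      vs(1)]])

lemma tensor_assoc_hom:
  "tensor_assoc K A B C \<in> module_hom K (tensor K (tensor K A B) C) (tensor K A (tensor K B C))"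
  unfolding tensor_assoc_def Let_def
  by (intro tensor_lift_hom assoc_outer_bilinear tensor_vectorspace vs)

lemma tensor_assoc_inv_hom:
  "tensor_assoc_inv K A B C \<in> module_hom K (tensor K A (tensor K B C)) (tensor K (tensor K A B) C)"
  unfolding tensor_assoc_inv_def Let_def
  by (intro tensor_lift_hom assoc_inv_outer_bilinear tensor_vectorspace vs)

lemma tensor_assoc_pure:
  assumes "a \<in> carrier A" "b \<in> carrier B" "c \<in> carrier C"
  shows "tensor_assoc K A B C (pure K (tensor K A B) C (pure K A B a b) c) =
    pure K A (tensor K B C) a (pure K B C b c)"
  unfolding tensor_assoc_def Let_def
  using assms vs
  by (simp add: tensor_lift_pure[OF _ _ _ assoc_outer_bilinear] pure_in tensor_vectorspace
      tensor_lift_pure[OF _ _ _ assoc_inner_bilinear])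

lemma tensor_assoc_inv_pure:
  assumes "a \<in> carrier A" "b \<in> carrier B" "c \<in> carrier C"
  shows "tensor_assoc_inv K A B C (pure K A (tensor K B C) a (pure K B C b c)) =
    pure K (tensor K A B) C (pure K A B a b) c"
  unfolding tensor_assoc_inv_def Let_def
  using assms vs
  by (simp add: tensor_lift_pure[OF _ _ _ assoc_inv_outer_bilinear] pure_in tensor_vectorspace
      tensor_lift_pure[OF _ _ _ assoc_inv_inner_bilinear])

lemma tensor_assoc_assoc_inv:
  assumes "x \<in> carrier (tensor K A (tensor K B C))"
  shows "tensor_assoc K A B C (tensor_assoc_inv K A B C x) = x"
  using tensor3_eqI'[OF vs _ module_hom_compose[OF tensor_assoc_inv_hom tensor_assoc_hom] module_hom_id _ assms]
  by (simp add: tensor_assoc_inv_pure tensor_assoc_pure tensor_vectorspace vs)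

lemma tensor_assoc_inv_assoc:
  assumes "x \<in> carrier (tensor K (tensor K A B) C)"
  shows "tensor_assoc_inv K A B C (tensor_assoc K A B C x) = x"
  using tensor3_eqI[OF vs _ module_hom_compose[OF tensor_assoc_hom tensor_assoc_inv_hom] module_hom_id _ assms]
  by (simp add: tensor_assoc_inv_pure tensor_assoc_pure tensor_vectorspace vs)

lemma inj_on_tensor_assoc: "inj_on (tensor_assoc K A B C) (carrier (tensor K (tensor K A B) C))"
  by (rule inj_on_inverseI) (rule tensor_assoc_inv_assoc)

end

text \<open>On pure tensors both sides give
  \<open>f a \<otimes> (g b \<otimes> h c)\<close>.\<close>

lemma tensor_assoc_natural:
  assumes vs: "vectorspace K A" "vectorspace K B" "vectorspace K C"
    "vectorspace K A'" "vectorspace K B'" "vectorspace K C'"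
    and h: "f \<in> module_hom K A A'" "g \<in> module_hom K B B'" "h \<in> module_hom K C C'"
    and x: "x \<in> carrier (tensor K (tensor K A B) C)"
  shows "tensor_assoc K A' B' C' (tensor_map K (tensor K A' B') C' (tensor_map K A' B' f g) h x) =
    tensor_map K A' (tensor K B' C') f (tensor_map K B' C' g h) (tensor_assoc K A B C x)"
proof (rule tensor3_eqI[OF vs(1-3) _ _ _ _ x])
  show "(\<lambda>x. tensor_assoc K A' B' C' (tensor_map K (tensor K A' B') C' (tensor_map K A' B' f g) h x)) \<in>
    module_hom K (tensor K (tensor K A B) C) (tensor K A' (tensor K B' C'))"
    by (intro module_hom_compose[OF tensor_map_hom tensor_assoc_hom] tensor_map_hom tensor_vectorspace vs h)
  show "(\<lambda>x. tensor_map K A' (tensor K B' C') f (tensor_map K B' C' g h) (tensor_assoc K A B C x)) \<in>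
    module_hom K (tensor K (tensor K A B) C) (tensor K A' (tensor K B' C'))"
    by (intro module_hom_compose[OF tensor_assoc_hom tensor_map_hom] tensor_map_hom tensor_vectorspace vs h)
qed (simp_all add: vs h tensor_vectorspace tensor_map_hom pure_in module_hom_in[OF h(1)]
    module_hom_in[OF h(2)] module_hom_in[OF h(3)] tensor_assoc_pure
    tensor_map_pure[where M = A and N = B] tensor_map_pure[where M = "tensor K A B" and N = C]
    tensor_map_pure[where M = B and N = C] tensor_map_pure[where M = A and N = "tensor K B C"])

text \<open>Both sides send \<open>((a \<otimes> b) \<otimes> c) \<otimes> d\<close> to
  \<open>a \<otimes> (b \<otimes> (c \<otimes> d))\<close>. This reconciles the two ways of reaching
  the right-nested bracketing of four factors.\<close>

lemma tensor_pentagon: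
  assumes vs: "vectorspace K A" "vectorspace K B" "vectorspace K C" "vectorspace K D"
    and x: "x \<in> carrier (tensor K (tensor K (tensor K A B) C) D)"
  shows "tensor_assoc K A B (tensor K C D) (tensor_assoc K (tensor K A B) C D x) =
    tensor_map K A (tensor K B (tensor K C D)) id (tensor_assoc K B C D)
      (tensor_assoc K A (tensor K B C) D
        (tensor_map K (tensor K A (tensor K B C)) D (tensor_assoc K A B C) id x))"
proof (rule tensor4_eqI[OF vs _ _ _ _ x])
  let ?S = "tensor K (tensor K (tensor K A B) C) D" and ?T = "tensor K A (tensor K B (tensor K C D))"
  show "(\<lambda>x. tensor_assoc K A B (tensor K C D) (tensor_assoc K (tensor K A B) C D x)) \<in> module_hom K ?S ?T"
    by (intro module_hom_compose[OF tensor_assoc_hom tensor_assoc_hom] tensor_vectorspace vs)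
  show "(\<lambda>x. tensor_map K A (tensor K B (tensor K C D)) id (tensor_assoc K B C D)
      (tensor_assoc K A (tensor K B C) D
        (tensor_map K (tensor K A (tensor K B C)) D (tensor_assoc K A B C) id x))) \<in> module_hom K ?S ?T"
    by (intro module_hom_compose[OF module_hom_compose[OF tensor_map_hom tensor_assoc_hom] tensor_map_hom]
        tensor_assoc_hom module_hom_id tensor_vectorspace vs)
qed (simp_all add: vs tensor_vectorspace tensor_assoc_hom module_hom_id module_hom_id[unfolded id_def]
    pure_in tensor_assoc_pure tensor_map_pure[where M = "tensor K (tensor K A B) C" and N = D]
    tensor_map_pure[where M = A and N = "tensor K (tensor K B C) D"])

section \<open>Unitors\<close>

lemma carrier_ground: "carrier (ground K) = carrier K"
  by (simp add: ground_def)

lemma ground_vectorspace: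
  assumes "vectorspace K M"
  shows "vectorspace K (ground K)"
proof -
  interpret K: vectorspace K M by fact
  show ?thesis
    by (rule vs_criteria)
      (auto simp: ground_def K.R.a_ac K.R.m_assoc K.R.l_distr K.R.r_distr K.field_axioms intro: K.R.r_neg K.R.a_inv_closed)
qed

lemma right_unitor_bilinear:
  assumes "vectorspace K M"
  shows "bilinear_map K M (ground K) M (\<lambda>m k. k \<odot>\<^bsub>M\<^esub> m)"
proof -
  interpret M: vectorspace K M by fact
  show ?thesis
    by (rule bilinear_mapI)
      (auto simp: ground_def M.smult_l_distr M.smult_r_distr M.smult_assoc1[symmetric] M.m_comm)
qed

lemma right_unitor_hom:
  "vectorspace K M \<Longrightarrow> right_unitor K M \<in> module_hom K (tensor K M (ground K)) M"
  unfolding right_unitor_def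
  by (intro tensor_lift_hom right_unitor_bilinear) (simp_all add: ground_vectorspace)

lemma right_unitor_pure:
  "\<lbrakk>vectorspace K M; m \<in> carrier M; k \<in> carrier K\<rbrakk> \<Longrightarrow>
    right_unitor K M (pure K M (ground K) m k) = k \<odot>\<^bsub>M\<^esub> m"
  unfolding right_unitor_def
  by (subst tensor_lift_pure[OF _ _ _ right_unitor_bilinear])
    (simp_all add: ground_vectorspace carrier_ground)

lemma right_unitor_natural:
  assumes vs: "vectorspace K M" "vectorspace K N" and f: "f \<in> module_hom K M N"
    and x: "x \<in> carrier (tensor K M (ground K))"
  shows "right_unitor K N (tensor_map K N (ground K) f id x) = f (right_unitor K M x)"
proof -
  note G = ground_vectorspace[OF vs(1)]
  show ?thesis
    by (rule tensor_eqI[OF vs(1) G vs(2) _ _ _ x])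
      (simp_all add: module_hom_compose[OF tensor_map_hom right_unitor_hom] vs f G module_hom_id module_hom_id[unfolded id_def]
        module_hom_compose[OF right_unitor_hom f] carrier_ground right_unitor_pure module_hom_in[OF f]
        module_hom_smult[OF f] tensor_map_pure[where M = M and N = "ground K"])
qed

text \<open>The scalar may be absorbed by the right factor:
  \<open>k (m \<otimes> n) = m \<otimes> k n\<close>. The counit axiom for \<open>Ind\<close> is
  thereby moved into \<open>H\<^sub>\<alpha>\<close>.\<close>

lemma right_unitor_tensor:
  assumes vs: "vectorspace K M" "vectorspace K N" and x: "x \<in> carrier (tensor K (tensor K M N) (ground K))"
  shows "right_unitor K (tensor K M N) x = tensor_map K M N id (right_unitor K N) (tensor_assoc K M N (ground K) x)"
proof -
  note G = ground_vectorspace[OF vs(1)]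
  show ?thesis
    by (rule tensor3_eqI[OF vs G tensor_vectorspace[OF vs] _ _ _ x])
      (simp_all add: right_unitor_hom tensor_vectorspace vs G carrier_ground module_hom_id module_hom_id[unfolded id_def]
        module_hom_compose[OF tensor_assoc_hom tensor_map_hom] tensor_assoc_pure right_unitor_pure
        tensor_map_pure[where M = M and N = "tensor K N (ground K)"] pure_in
        bilinear_mapD(5)[OF pure_bilinear, symmetric])
qed

text \<open>Every tensor is a finite sum of pure tensors: coefficients move into the left factor, so
  no case for scalar multiples arises.\<close>

lemma (in tensor_spaces) tensor_induct:
  assumes x: "x \<in> carrier (tensor K M N)"
    and zero: "P \<zero>\<^bsub>tensor K M N\<^esub>"
    and pure: "\<And>m n. \<lbrakk>m \<in> carrier M; n \<in> carrier N\<rbrakk> \<Longrightarrow> P (pure K M N m n)"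
    and add: "\<And>x y. \<lbrakk>x \<in> carrier (tensor K M N); y \<in> carrier (tensor K M N); P x; P y\<rbrakk> \<Longrightarrow>
      P (x \<oplus>\<^bsub>tensor K M N\<^esub> y)"
  shows "P x"
proof -
  interpret T: vectorspace K "tensor K M N" by (rule tensor_vectorspace)
  obtain f where f: "f \<in> carrier F" "x = tensor_null K M N +>\<^bsub>F\<^esub> f" using x by (rule tensor_cases)
  let ?A = "{p. f p \<noteq> \<zero>\<^bsub>K\<^esub>}"
  \<comment> \<open>The summands of \<open>x\<close>, each with its coefficient absorbed on the
    left.\<close>
  let ?p = "\<lambda>p. pure K M N (f p \<odot>\<^bsub>M\<^esub> fst p) (snd p)"
  have A: "finite ?A" "?A \<subseteq> carrier M \<times> carrier N" and fK: "\<And>p. f p \<in> carrier K"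
    using f(1) by (auto simp: tensor_free_def free_space_carrier)
  have Ap: "fst p \<in> carrier M" "snd p \<in> carrier N" if "p \<in> ?A" for p
    using A(2) that by auto
  have gen: "free_gen K p \<in> carrier F" if "p \<in> ?A" for p
    using gen_in[OF Ap[OF that]] by simp
  have "f = (\<Oplus>\<^bsub>F\<^esub>p\<in>?A. f p \<odot>\<^bsub>F\<^esub> free_gen K p)"
    using free_space_decomp[OF M.field_axioms f(1)[unfolded tensor_free_def]]
    by (simp add: free_lift_def tensor_free_def)
  then have "x = tensor_null K M N +>\<^bsub>F\<^esub> (\<Oplus>\<^bsub>F\<^esub>p\<in>?A. f p \<odot>\<^bsub>F\<^esub> free_gen K p)"
    using f(2) by simp
  also have "\<dots> = (\<Oplus>\<^bsub>tensor K M N\<^esub>p\<in>?A. tensor_null K M N +>\<^bsub>F\<^esub> (f p \<odot>\<^bsub>F\<^esub> free_gen K p))"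
    using gen fK A(1)
    by (intro module_hom_finsum[OF free_vectorspace tensor_vectorspace coset_hom]) auto
  also have "\<dots> = (\<Oplus>\<^bsub>tensor K M N\<^esub>p\<in>?A. ?p p)"
  proof (rule T.finsum_cong'[OF refl])
    show "?p \<in> ?A \<rightarrow> carrier (tensor K M N)"
      using Ap M.smult_closed[OF fK] by (auto intro!: bilinear_mapD(1)[OF pure_bilinear])
    fix p assume p: "p \<in> ?A"
    then have "tensor_null K M N +>\<^bsub>F\<^esub> (f p \<odot>\<^bsub>F\<^esub> free_gen K p) = f p \<odot>\<^bsub>tensor K M N\<^esub> pure K M N (fst p) (snd p)"
      using module_hom_smult[OF coset_hom fK gen[OF p]] by (simp add: pure_def)
    then show "tensor_null K M N +>\<^bsub>F\<^esub> (f p \<odot>\<^bsub>F\<^esub> free_gen K p) = ?p p"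
      using bilinear_mapD(4)[OF pure_bilinear fK Ap[OF p]] by simp
  qed
  finally have x: "x = (\<Oplus>\<^bsub>tensor K M N\<^esub>p\<in>?A. ?p p)" .
  \<comment> \<open>Membership in the carrier is proved alongside, because the additive case of the
    induction requires it of both summands.\<close>
  have "P (\<Oplus>\<^bsub>tensor K M N\<^esub>p\<in>B. ?p p) \<and> (\<Oplus>\<^bsub>tensor K M N\<^esub>p\<in>B. ?p p) \<in> carrier (tensor K M N)"
    if "finite B" "B \<subseteq> ?A" for B
    using that
  proof (induction B rule: finite_induct)
    case empty
    then show ?case using zero by simp
  next
    case (insert p B)
    have p: "?p q \<in> carrier (tensor K M N)" "P (?p q)" if "q \<in> insert p B" for q
    proof -
      have q: "q \<in> ?A" using that insert.prems by blast
      then have "f q \<odot>\<^bsub>M\<^esub> fst q \<in> carrier M" "snd q \<in> carrier N"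
        using Ap M.smult_closed[OF fK] by blast+
      then show "?p q \<in> carrier (tensor K M N)" "P (?p q)"
        by (auto intro: bilinear_mapD(1)[OF pure_bilinear] pure)
    qed
    then have "(\<Oplus>\<^bsub>tensor K M N\<^esub>p\<in>insert p B. ?p p) = ?p p \<oplus>\<^bsub>tensor K M N\<^esub> (\<Oplus>\<^bsub>tensor K M N\<^esub>p\<in>B. ?p p)"
      using insert.hyps by (intro T.finsum_insert) auto
    moreover have "(\<Oplus>\<^bsub>tensor K M N\<^esub>p\<in>B. ?p p) \<in> carrier (tensor K M N)" "P (\<Oplus>\<^bsub>tensor K M N\<^esub>p\<in>B. ?p p)"
      using insert by blast+
    ultimately show ?case using p[OF insertI1] add by simp
  qed
  from this[OF A(1) order_refl] show ?thesis using x by simp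
qed

lemmas tensor_induct = tensor_spaces.tensor_induct[OF tensor_spaces.intro]

section \<open>Coordinates and exactness\<close>

text \<open>Zorn on independent sets. A linear dependence in the union of a chain involves finitely
  many vectors, so it already lives in one member of the chain.\<close>

lemma (in vectorspace) basis_exists: "\<exists>B. basis B"
proof -
  let ?I = "{S. S \<subseteq> carrier V \<and> lin_indpt S}"
  have "\<exists>B\<in>?I. \<forall>X\<in>?I. B \<subseteq> X \<longrightarrow> X = B"
  proof (rule subset_Zorn_nonempty)
    have "lin_indpt {}" by (auto simp: lin_dep_def)
    then show "?I \<noteq> {}" by blast
    fix \<C> assume ne: "\<C> \<noteq> {}" and chain: "subset.chain ?I \<C>"
    have "lin_indpt (\<Union>\<C>)"
    proof
      assume "lin_dep (\<Union>\<C>)"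
      then obtain A a v where A: "finite A" "A \<subseteq> \<Union>\<C>" and
        a: "a \<in> A \<rightarrow> carrier K" "lincomb a A = \<zero>\<^bsub>V\<^esub>" "v \<in> A" "a v \<noteq> \<zero>\<^bsub>K\<^esub>"
        unfolding lin_dep_def by blast
      obtain S where "S \<in> \<C>" "A \<subseteq> S" using finite_subset_Union_chain[OF A ne chain] by blast
      moreover have "lin_indpt S" using \<open>S \<in> \<C>\<close> chain by (auto simp: subset.chain_def)
      ultimately show False using A(1) a unfolding lin_dep_def by blast
    qed
    moreover have "\<Union>\<C> \<subseteq> carrier V" using chain by (auto simp: subset.chain_def)
    ultimately show "\<Union>\<C> \<in> ?I" by blast
  qed
  then obtain B where B: "B \<in> ?I" "\<forall>X\<in>?I. B \<subseteq> X \<longrightarrow> X = B" by (rule bexE)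
  then have "maximal B (\<lambda>S. S \<subseteq> carrier V \<and> lin_indpt S)" by (auto simp only: maximal_def mem_Collect_eq Ball_def)
  then show ?thesis using max_li_is_basis by blast
qed

text \<open>The conditions of the dual basis lemma: linear functionals indexed by \<open>B\<close>,
  only finitely many nonzero at each vector, which recover the vector. Expanding tensors into slices
  takes nothing more from a basis.\<close>

locale coordinates = vectorspace K N
  for K :: "('k, 'z) ring_scheme" and N :: "('k, 'n) module" +
  fixes B :: "'n set" and c :: "'n \<Rightarrow> 'n \<Rightarrow> 'k"
  assumes B_subset: "B \<subseteq> carrier N"
    and coord_hom: "b \<in> B \<Longrightarrow> (\<lambda>n. c n b) \<in> module_hom K N (ground K)"
    and coord_finite: "n \<in> carrier N \<Longrightarrow> finite {b \<in> B. c n b \<noteq> \<zero>\<^bsub>K\<^esub>}"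
    and coord_sum: "n \<in> carrier N \<Longrightarrow> n = (\<Oplus>\<^bsub>N\<^esub>b\<in>{b \<in> B. c n b \<noteq> \<zero>\<^bsub>K\<^esub>}. c n b \<odot>\<^bsub>N\<^esub> b)"

lemma inv_into_hom:
  assumes "vectorspace K M" "f \<in> module_hom K M N" "bij_betw f (carrier M) (carrier N)"
  shows "inv_into (carrier M) f \<in> module_hom K N M"
proof -
  interpret M: vectorspace K M by fact
  let ?g = "inv_into (carrier M) f"
  have fg: "f (?g y) = y" "?g y \<in> carrier M" if "y \<in> carrier N" for y
    using assms(3) that by (auto simp: bij_betw_def f_inv_into_f inv_into_into)
  have gf: "?g (f x) = x" if "x \<in> carrier M" for x
    using assms(3) that by (auto simp: bij_betw_def)
  show ?thesis
  proof (rule module_homI)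
    fix x y assume "x \<in> carrier N" "y \<in> carrier N"
    then show "?g (x \<oplus>\<^bsub>N\<^esub> y) = ?g x \<oplus>\<^bsub>M\<^esub> ?g y"
      using fg[of x] fg[of y] gf[of "?g x \<oplus>\<^bsub>M\<^esub> ?g y"] module_hom_add[OF assms(2), of "?g x" "?g y"] by simp
  next
    fix k x assume "k \<in> carrier K" "x \<in> carrier N"
    then show "?g (k \<odot>\<^bsub>N\<^esub> x) = k \<odot>\<^bsub>M\<^esub> ?g x"
      using fg[of x] gf[of "k \<odot>\<^bsub>M\<^esub> ?g x"] module_hom_smult[OF assms(2), of k "?g x"] by simp
  qed (rule fg)
qed

text \<open>A basis makes the linear extension of its inclusion an isomorphism from the free space
  on \<open>B\<close> to \<open>N\<close>. Its inverse sends a vector to its coordinate function,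
  which is finitely supported by construction.\<close>

lemma coordinates_exist:
  assumes "vectorspace K N"
  shows "\<exists>B c. coordinates K N B c"
proof -
  interpret N: vectorspace K N by fact
  obtain B where B: "N.lin_indpt B" "N.gen_set B" "B \<subseteq> carrier N"
    using N.basis_exists by (auto simp: N.basis_def)
  let ?F = "free_space K B"
  interpret F: vectorspace K ?F by (rule N.free_space_vectorspace)
  define f where "f = free_lift K N (\<lambda>b. b)"
  have f: "f \<in> module_hom K ?F N" unfolding f_def using B(3) by (intro N.free_lift_hom) auto
  \<comment> \<open>A nonzero \<open>u\<close> in the kernel would be a linear dependence supported
    on its own nonzero entries.\<close>
  have zero: "u = \<zero>\<^bsub>?F\<^esub>" if u: "u \<in> carrier ?F" "f u = \<zero>\<^bsub>N\<^esub>" for u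
  proof (rule ccontr)
    assume "u \<noteq> \<zero>\<^bsub>?F\<^esub>"
    then obtain b where "u b \<noteq> \<zero>\<^bsub>K\<^esub>" by (auto simp: free_space_simps)
    then have "N.lin_dep B"
      unfolding N.lin_dep_def using u
      by (intro exI[of _ "{x. u x \<noteq> \<zero>\<^bsub>K\<^esub>}"] exI[of _ u] exI[of _ b])
        (auto simp: free_space_carrier f_def free_lift_def N.lincomb_def)
    with B(1) show False by simp
  qed
  have "inj_on f (carrier ?F)"
  proof (rule inj_onI)
    fix u v assume uv: "u \<in> carrier ?F" "v \<in> carrier ?F" "f u = f v"
    have "f (u \<ominus>\<^bsub>?F\<^esub> v) = f u \<ominus>\<^bsub>N\<^esub> f v"
      by (rule module_hom_minus[OF F.vectorspace_axioms assms f uv(1,2)])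
    also have "\<dots> = \<zero>\<^bsub>N\<^esub>"
      using uv module_hom_in[OF f] by (simp add: N.r_neg a_minus_def)
    finally have "f (u \<ominus>\<^bsub>?F\<^esub> v) = \<zero>\<^bsub>N\<^esub>" .
    then have "u \<ominus>\<^bsub>?F\<^esub> v = \<zero>\<^bsub>?F\<^esub>" using uv by (intro zero) auto
    then show "u = v" using uv by simp
  qed
  moreover have "f ` carrier ?F = carrier N"
  proof
    show "f ` carrier ?F \<subseteq> carrier N" using module_hom_in[OF f] by blast
    show "carrier N \<subseteq> f ` carrier ?F"
    proof
      fix n assume "n \<in> carrier N"
      then have "n \<in> N.span B" using B(2) by simp
      then obtain A a where A: "finite A" "A \<subseteq> B" "a \<in> A \<rightarrow> carrier K" "n = N.lincomb a A"
        by (auto simp: N.span_def)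
      \<comment> \<open>The coefficients given by the span are controlled on \<open>A\<close> only;
        extending them by zero gives an element of the free space.\<close>
      define u where "u = (\<lambda>b. if b \<in> A then a b else \<zero>\<^bsub>K\<^esub>)"
      have u: "u \<in> carrier ?F"
        unfolding free_space_carrier u_def using A by (auto intro: finite_subset[of _ A])
      have "f u = (\<Oplus>\<^bsub>N\<^esub>b\<in>A. u b \<odot>\<^bsub>N\<^esub> b)"
        unfolding f_def using A B(3) u
        by (intro N.free_lift_superset[where X = B]) (auto simp: u_def free_space_carrier)
      also have "\<dots> = n"
        using A(2,3) B(3) unfolding A(4) N.lincomb_def u_def
        by (intro N.finsum_cong') auto
      finally show "n \<in> f ` carrier ?F" using u by blast
    qed
  qed
  ultimately have bij: "bij_betw f (carrier ?F) (carrier N)" by (simp add: bij_betw_def)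
  define c where "c = inv_into (carrier ?F) f"
  have c: "c \<in> module_hom K N ?F"
    unfolding c_def by (rule inv_into_hom[OF F.vectorspace_axioms f bij])
  have fc: "f (c n) = n" if "n \<in> carrier N" for n
    using bij that by (auto simp: c_def bij_betw_def f_inv_into_f)
  have supp: "{b \<in> B. c n b \<noteq> \<zero>\<^bsub>K\<^esub>} = {b. c n b \<noteq> \<zero>\<^bsub>K\<^esub>}" if "n \<in> carrier N" for n
    using module_hom_in[OF c that] by (auto simp: free_space_carrier)
  have "coordinates K N B c"
  proof unfold_locales
    show "(\<lambda>n. c n b) \<in> module_hom K N (ground K)" for b
      using module_hom_in[OF c] module_hom_add[OF c] module_hom_smult[OF c]
      by (intro module_homI) (auto simp: free_space_simps free_space_carrier ground_def)
    fix n assume n: "n \<in> carrier N"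
    show "finite {b \<in> B. c n b \<noteq> \<zero>\<^bsub>K\<^esub>}"
      using module_hom_in[OF c n] by (simp add: supp[OF n] free_space_carrier)
    show "n = (\<Oplus>\<^bsub>N\<^esub>b\<in>{b \<in> B. c n b \<noteq> \<zero>\<^bsub>K\<^esub>}. c n b \<odot>\<^bsub>N\<^esub> b)"
      using fc[OF n] by (simp add: supp[OF n] f_def free_lift_def)
  qed (rule B(3))
  then show ?thesis by blast
qed

section \<open>Slices of a tensor along coordinates of its right factor\<close>

context coordinates
begin

definition slice :: "('k, 'm) module \<Rightarrow> 'n \<Rightarrow> ('m \<times> 'n \<Rightarrow> 'k) set \<Rightarrow> 'm" where
  "slice M b = tensor_lift K M (\<lambda>m n. c n b \<odot>\<^bsub>M\<^esub> m)"

lemma coord_in: "\<lbrakk>b \<in> B; n \<in> carrier N\<rbrakk> \<Longrightarrow> c n b \<in> carrier K"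
  using module_hom_in[OF coord_hom] by (simp add: carrier_ground)

lemma slice_bilinear:
  assumes "vectorspace K M" "b \<in> B"
  shows "bilinear_map K M N M (\<lambda>m n. c n b \<odot>\<^bsub>M\<^esub> m)"
  using bilinear_map_compose[OF module_hom_id coord_hom[OF assms(2)] right_unitor_bilinear[OF assms(1)]]
  by simp

lemma slice_hom:
  "\<lbrakk>vectorspace K M; b \<in> B\<rbrakk> \<Longrightarrow> slice M b \<in> module_hom K (tensor K M N) M"
  unfolding slice_def by (intro tensor_lift_hom slice_bilinear vectorspace_axioms)

lemma slice_pure:
  "\<lbrakk>vectorspace K M; b \<in> B; m \<in> carrier M; n \<in> carrier N\<rbrakk> \<Longrightarrow>
    slice M b (pure K M N m n) = c n b \<odot>\<^bsub>M\<^esub> m"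
  unfolding slice_def
  by (rule tensor_lift_pure[OF _ vectorspace_axioms _ slice_bilinear]) auto

lemma slice_tensor_map:
  assumes vs: "vectorspace K M" "vectorspace K P" and f: "f \<in> module_hom K M P"
    and b: "b \<in> B" and x: "x \<in> carrier (tensor K M N)"
  shows "slice P b (tensor_map K P N f id x) = f (slice M b x)"
proof (rule tensor_eqI[OF vs(1) vectorspace_axioms vs(2) _ _ _ x])
  note t = tensor_map_hom[OF vs(1) vectorspace_axioms vs(2) vectorspace_axioms f module_hom_id]
  show "(\<lambda>x. slice P b (tensor_map K P N f id x)) \<in> module_hom K (tensor K M N) P"
    by (rule module_hom_compose[OF t slice_hom[OF vs(2) b]])
  show "(\<lambda>x. f (slice M b x)) \<in> module_hom K (tensor K M N) P"
    by (rule module_hom_compose[OF slice_hom[OF vs(1) b] f])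
  fix m n assume mn: "m \<in> carrier M" "n \<in> carrier N"
  then show "slice P b (tensor_map K P N f id (pure K M N m n)) = f (slice M b (pure K M N m n))"
    using tensor_map_pure[OF vs(1) vectorspace_axioms vs(2) vectorspace_axioms f module_hom_id mn]
    by (simp add: slice_pure vs b module_hom_in[OF f] module_hom_smult[OF f] coord_in)
qed

text \<open>The expansion is claimed for all finite index sets above some \<open>S\<close>. This
  monotone form lets two tensors be expanded over a common set, both in the additive step here and
  in \<open>inj_on_tensor_map_left\<close>.\<close>

lemma slice_sum:
  assumes M: "vectorspace K M" and x: "x \<in> carrier (tensor K M N)"
  shows "\<exists>S. finite S \<and> S \<subseteq> B \<and> (\<forall>S'. finite S' \<and> S \<subseteq> S' \<and> S' \<subseteq> B \<longrightarrow>
    x = (\<Oplus>\<^bsub>tensor K M N\<^esub>b\<in>S'. pure K M N (slice M b x) b))"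
    (is "?R x")
proof (rule tensor_induct[where P = ?R, OF M vectorspace_axioms x], goal_cases)
  interpret M: vectorspace K M by fact
  interpret T: vectorspace K "tensor K M N" by (rule tensor_vectorspace[OF M vectorspace_axioms])
  note bil = pure_bilinear[OF M vectorspace_axioms]
  let ?Q = "\<lambda>x S. x = (\<Oplus>\<^bsub>tensor K M N\<^esub>b\<in>S. pure K M N (slice M b x) b)"
  have pin: "pure K M N m b \<in> carrier (tensor K M N)" if "m \<in> carrier M" "b \<in> B" for m b
    using that B_subset by (auto intro: pure_in M vectorspace_axioms)
  {
    case 1
    have "pure K M N (slice M b \<zero>\<^bsub>tensor K M N\<^esub>) b = \<zero>\<^bsub>tensor K M N\<^esub>" if "b \<in> B" for b
      using that B_subset module_hom_zero[OF T.vectorspace_axioms M slice_hom[OF M that]]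
        module_hom_zero[OF M T.vectorspace_axioms pure_hom_left[OF M vectorspace_axioms]] by auto
    then have "?Q \<zero>\<^bsub>tensor K M N\<^esub> S" if "finite S" "S \<subseteq> B" for S
      using that by (subst T.finsum_cong'[where g = "\<lambda>_. \<zero>\<^bsub>tensor K M N\<^esub>"]) auto
    then show ?case by (intro exI[of _ "{}"]) simp
  next
    case (2 m n)
    \<comment> \<open>The slice of \<open>m \<otimes> n\<close> at \<open>b\<close> is
      \<open>c n b\<close> times \<open>m\<close>, so indices outside the support of the coordinates
      of \<open>n\<close> contribute zero.\<close>
    let ?S = "{b \<in> B. c n b \<noteq> \<zero>\<^bsub>K\<^esub>}"
    have "?Q (pure K M N m n) S'" if S': "finite S'" "?S \<subseteq> S'" "S' \<subseteq> B" for S'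
    proof -
      have "pure K M N m n = pure K M N m (\<Oplus>\<^bsub>N\<^esub>b\<in>?S. c n b \<odot>\<^bsub>N\<^esub> b)"
        using coord_sum[OF 2(2)] by simp
      also have "\<dots> = (\<Oplus>\<^bsub>tensor K M N\<^esub>b\<in>?S. pure K M N m (c n b \<odot>\<^bsub>N\<^esub> b))"
        using 2 B_subset coord_in coord_finite
        by (intro module_hom_finsum[OF vectorspace_axioms T.vectorspace_axioms pure_hom_right[OF M vectorspace_axioms]]) auto
      also have "\<dots> = (\<Oplus>\<^bsub>tensor K M N\<^esub>b\<in>S'. pure K M N (slice M b (pure K M N m n)) b)"
      proof (rule T.add.finprod_mono_neutral_cong_left[OF S'(1,2)])
        have b: "b \<in> B" "b \<in> carrier N" "c n b \<in> carrier K" if "b \<in> S'" for b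
          using that S'(3) B_subset coord_in[OF _ 2(2)] by auto
        have *: "pure K M N (slice M b (pure K M N m n)) b = c n b \<odot>\<^bsub>tensor K M N\<^esub> pure K M N m b"
          if "b \<in> S'" for b
          using bilinear_mapD(4)[OF bil] b[OF that] 2 by (simp add: slice_pure M)
        show "pure K M N (slice M b (pure K M N m n)) b = \<zero>\<^bsub>tensor K M N\<^esub>"
          if "b \<in> S' - ?S" for b
          using that 2 b[of b] pin by (simp add: *)
        show "pure K M N m (c n b \<odot>\<^bsub>N\<^esub> b) = pure K M N (slice M b (pure K M N m n)) b" if "b \<in> ?S" for b
        proof -
          have b': "b \<in> S'" using that S'(2) by blast
          then show ?thesis using b[OF b'] 2 bilinear_mapD(5)[OF bil] by (simp add: *)
        qed
        show "(\<lambda>b. pure K M N (slice M b (pure K M N m n)) b) \<in> S' \<rightarrow> carrier (tensor K M N)"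
          using 2 b pin T.smult_closed by (simp add: * Pi_def)
      qed
      finally show ?thesis .
    qed
    then show ?case using coord_finite[OF 2(2)] by (intro exI[of _ ?S]) auto
  next
    case (3 x y)
    obtain S where S: "finite S" "S \<subseteq> B"
      and Sx: "\<forall>A. finite A \<and> S \<subseteq> A \<and> A \<subseteq> B \<longrightarrow> ?Q x A"
      using 3(3) by (elim exE conjE) (rule that)
    obtain S' where S': "finite S'" "S' \<subseteq> B"
      and Sy: "\<forall>A. finite A \<and> S' \<subseteq> A \<and> A \<subseteq> B \<longrightarrow> ?Q y A"
      using 3(4) by (elim exE conjE) (rule that)
    \<comment> \<open>Over a set containing both supports the two expansions add termwise, as slices
      are additive.\<close>
    have "?Q (x \<oplus>\<^bsub>tensor K M N\<^esub> y) A" if A: "finite A" "S \<union> S' \<subseteq> A" "A \<subseteq> B" for A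
    proof -
      have sl: "slice M b z \<in> carrier M" if "b \<in> A" "z \<in> carrier (tensor K M N)" for b z
        using that A(3) by (auto intro: module_hom_in[OF slice_hom[OF M]])
      have pz: "(\<lambda>b. pure K M N (slice M b z) b) \<in> A \<rightarrow> carrier (tensor K M N)"
        if "z \<in> carrier (tensor K M N)" for z
        using that A(3) by (intro Pi_I pin sl) (simp_all add: subset_iff)
      have xA: "?Q x A" and yA: "?Q y A" using Sx Sy A by simp_all
      have "x \<oplus>\<^bsub>tensor K M N\<^esub> y = (\<Oplus>\<^bsub>tensor K M N\<^esub>b\<in>A. pure K M N (slice M b x) b)
          \<oplus>\<^bsub>tensor K M N\<^esub> (\<Oplus>\<^bsub>tensor K M N\<^esub>b\<in>A. pure K M N (slice M b y) b)"
        using arg_cong2[OF xA yA, where f = "add (tensor K M N)"] .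
      also have "\<dots> = (\<Oplus>\<^bsub>tensor K M N\<^esub>b\<in>A. pure K M N (slice M b x) b \<oplus>\<^bsub>tensor K M N\<^esub> pure K M N (slice M b y) b)"
        using pz[OF 3(1)] pz[OF 3(2)] by (rule T.finsum_addf[symmetric])
      also have "\<dots> = (\<Oplus>\<^bsub>tensor K M N\<^esub>b\<in>A. pure K M N (slice M b (x \<oplus>\<^bsub>tensor K M N\<^esub> y)) b)"
      proof (rule T.finsum_cong'[OF refl])
        show "(\<lambda>b. pure K M N (slice M b (x \<oplus>\<^bsub>tensor K M N\<^esub> y)) b) \<in> A \<rightarrow> carrier (tensor K M N)"
          using 3 by (intro pz T.add.m_closed)
        fix b assume b: "b \<in> A"
        then have "slice M b (x \<oplus>\<^bsub>tensor K M N\<^esub> y) = slice M b x \<oplus>\<^bsub>M\<^esub> slice M b y"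
          using module_hom_add[OF slice_hom[OF M]] 3 A(3) by (simp add: subset_iff)
        then show "pure K M N (slice M b x) b \<oplus>\<^bsub>tensor K M N\<^esub> pure K M N (slice M b y) b =
            pure K M N (slice M b (x \<oplus>\<^bsub>tensor K M N\<^esub> y)) b"
          using b sl 3 A(3) B_subset by (simp add: bilinear_mapD(2)[OF bil] subset_iff)
      qed
      finally show ?thesis .
    qed
    then show ?case using S(1,2) S'(1,2) by (intro exI[of _ "S \<union> S'"]) auto
  }
qed

end

text \<open>Slicing turns equality after \<open>f \<otimes> I\<close> into equality of
  \<open>f\<close> on each slice, where injectivity applies. Equal slices over the common index set
  \<open>S \<union> T\<close> then give equal tensors.\<close>

lemma inj_on_tensor_map_left:
  assumes vs: "vectorspace K M" "vectorspace K P" "vectorspace K N" and f: "f \<in> module_hom K M P"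
    and inj: "inj_on f (carrier M)"
  shows "inj_on (tensor_map K P N f id) (carrier (tensor K M N))"
proof (rule inj_onI)
  obtain B c where "coordinates K N B c" using coordinates_exist[OF vs(3)] by blast
  then interpret coordinates K N B c .
  fix x y assume xy: "x \<in> carrier (tensor K M N)" "y \<in> carrier (tensor K M N)"
    and eq: "tensor_map K P N f id x = tensor_map K P N f id y"
  have sl: "slice M b x = slice M b y" if b: "b \<in> B" for b
  proof (rule inj_onD[OF inj])
    show "f (slice M b x) = f (slice M b y)"
      using slice_tensor_map[OF vs(1,2) f b] xy eq by metis
  qed (use xy module_hom_in[OF slice_hom[OF vs(1) b]] in auto)
  obtain S where S: "finite S" "S \<subseteq> B" "\<forall>S'. finite S' \<and> S \<subseteq> S' \<and> S' \<subseteq> B \<longrightarrow>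
      x = (\<Oplus>\<^bsub>tensor K M N\<^esub>b\<in>S'. pure K M N (slice M b x) b)"
    using slice_sum[OF vs(1) xy(1)] by (elim exE conjE) (rule that)
  obtain T where T: "finite T" "T \<subseteq> B" "\<forall>S'. finite S' \<and> T \<subseteq> S' \<and> S' \<subseteq> B \<longrightarrow>
      y = (\<Oplus>\<^bsub>tensor K M N\<^esub>b\<in>S'. pure K M N (slice M b y) b)"
    using slice_sum[OF vs(1) xy(2)] by (elim exE conjE) (rule that)
  interpret T: vectorspace K "tensor K M N" by (rule tensor_vectorspace[OF vs(1,3)])
  have "x = (\<Oplus>\<^bsub>tensor K M N\<^esub>b\<in>S \<union> T. pure K M N (slice M b x) b)"
    using S(1,2) T(1,2) by (intro S(3)[rule_format]) simp
  also have "\<dots> = (\<Oplus>\<^bsub>tensor K M N\<^esub>b\<in>S \<union> T. pure K M N (slice M b y) b)"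
    using S(2) T(2) sl xy B_subset
    by (intro T.finsum_cong')
      (auto intro!: pure_in vs module_hom_in[OF slice_hom[OF vs(1)]])
  also have "\<dots> = y"
    using T(1,2) S(1,2) by (intro T(3)[rule_format, symmetric]) simp
  finally show "x = y" .
qed

section \<open>Equalizers under tensoring\<close>

lemma equalizer_vectorspace:
  assumes vs: "vectorspace K M" "vectorspace K W" and f: "f \<in> module_hom K M W" "g \<in> module_hom K M W"
  shows "vectorspace K (M\<lparr>carrier := {x \<in> carrier M. f x = g x}\<rparr>)"
proof -
  interpret M: vectorspace K M by fact
  have "subspace K {x \<in> carrier M. f x = g x} M"
  proof (intro subspace.intro submodule.intro)
    show "vectorspace K M" "module K M" by unfold_locales
  qed (auto simp: module_hom_add[OF f(1)] module_hom_add[OF f(2)] module_hom_smult[OF f(1)]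
      module_hom_smult[OF f(2)] module_hom_zero[OF vs f(1)] module_hom_zero[OF vs f(2)])
  then show ?thesis by (rule M.subspace_is_vs)
qed

lemma subspace_incl_hom: "A \<subseteq> carrier M \<Longrightarrow> id \<in> module_hom K (M\<lparr>carrier := A\<rparr>) M"
  by (rule module_homI) auto

text \<open>Since \<open>f\<close> and \<open>g\<close> commute with slicing, each slice of
  \<open>x\<close> lies in the equalizer. Reassembling the slices there produces a preimage of
  \<open>x\<close>.\<close>

lemma tensor_equalizer:
  assumes vs: "vectorspace K M" "vectorspace K W" "vectorspace K N"
    and f: "f \<in> module_hom K M W" "g \<in> module_hom K M W"
    and x: "x \<in> carrier (tensor K M N)" and eq: "tensor_map K W N f id x = tensor_map K W N g id x"
  shows "x \<in> tensor_map K M N id id ` carrier (tensor K (M\<lparr>carrier := {x \<in> carrier M. f x = g x}\<rparr>) N)"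
proof -
  let ?E = "M\<lparr>carrier := {x \<in> carrier M. f x = g x}\<rparr>"
  note E = equalizer_vectorspace[OF vs(1,2) f]
  note i = subspace_incl_hom[of "{x \<in> carrier M. f x = g x}" M K, OF Collect_restrict]
  obtain B c where "coordinates K N B c" using coordinates_exist[OF vs(3)] by blast
  then interpret coordinates K N B c .
  obtain S where S: "finite S" "S \<subseteq> B" "x = (\<Oplus>\<^bsub>tensor K M N\<^esub>b\<in>S. pure K M N (slice M b x) b)"
    using slice_sum[OF vs(1) x] by (elim exE conjE, intro that[rotated 2]) simp_all
  have sl: "slice M b x \<in> carrier ?E" if "b \<in> S" for b
    using that S(2) slice_tensor_map[OF vs(1,2) f(1) _ x] slice_tensor_map[OF vs(1,2) f(2) _ x] eq
      module_hom_in[OF slice_hom[OF vs(1)] x] by auto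
  interpret E: vectorspace K "tensor K ?E N" by (rule tensor_vectorspace[OF E vs(3)])
  interpret T: vectorspace K "tensor K M N" by (rule tensor_vectorspace[OF vs(1,3)])
  \<comment> \<open>The same sum as for \<open>x\<close>, but formed in the tensor product of the
    equalizer, whose pure tensors are different cosets.\<close>
  define y where "y = (\<Oplus>\<^bsub>tensor K ?E N\<^esub>b\<in>S. pure K ?E N (slice M b x) b)"
  have p: "pure K ?E N (slice M b x) b \<in> carrier (tensor K ?E N)" if "b \<in> S" for b
    using that sl S(2) B_subset by (intro pure_in E vs) auto
  have y: "y \<in> carrier (tensor K ?E N)" unfolding y_def using p by (intro E.finsum_closed) auto
  have "tensor_map K M N id id y =
      (\<Oplus>\<^bsub>tensor K M N\<^esub>b\<in>S. tensor_map K M N id id (pure K ?E N (slice M b x) b))"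
    unfolding y_def using p S(1)
    by (intro module_hom_finsum[OF E.vectorspace_axioms T.vectorspace_axioms
          tensor_map_hom[OF E vs(3,1,3) i module_hom_id]]) auto
  also have "\<dots> = (\<Oplus>\<^bsub>tensor K M N\<^esub>b\<in>S. pure K M N (slice M b x) b)"
  proof (rule T.finsum_cong'[OF refl])
    show "(\<lambda>b. pure K M N (slice M b x) b) \<in> S \<rightarrow> carrier (tensor K M N)"
      using sl S(2) B_subset by (auto intro!: pure_in vs)
    fix b assume "b \<in> S"
    then show "tensor_map K M N id id (pure K ?E N (slice M b x) b) = pure K M N (slice M b x) b"
      using sl S(2) B_subset by (subst tensor_map_pure[OF E vs(3,1,3) i module_hom_id]) auto
  qed
  also have "\<dots> = x" using S(3) by simp
  finally have "x = tensor_map K M N id id y" by (rule sym)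
  then show ?thesis by (rule image_eqI[OF _ y])
qed

section \<open>The induced comodule\<close>

text \<open>Serves to cancel an associator acting inside the second factor, in the proof of
  \<open>id_comult_Ind\<close>.\<close>

lemma tensor_map_left_inverse:
  assumes vs: "vectorspace K M" "vectorspace K P" "vectorspace K Q"
    and h: "f \<in> module_hom K P Q" "g \<in> module_hom K Q P" and gf: "\<And>x. x \<in> carrier P \<Longrightarrow> g (f x) = x"
    and x: "x \<in> carrier (tensor K M P)"
  shows "tensor_map K M P id g (tensor_map K M Q id f x) = x"
proof -
  have "tensor_map K M P id g (tensor_map K M Q id f x) = tensor_map K M P (\<lambda>m. id (id m)) (\<lambda>n. g (f n)) x"
    by (rule tensor_map_comp[OF vs(1,2,1,3,1,2) module_hom_id h(1) module_hom_id h(2) x])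
  also have "\<dots> = tensor_map K M P id id x"
    by (rule tensor_map_cong[OF vs(1,2,1,2) module_hom_compose[OF module_hom_id module_hom_id]
          module_hom_compose[OF h] module_hom_id module_hom_id _ _ x])
      (simp_all add: gf)
  also have "\<dots> = x" by (rule tensor_map_id[OF vs(1,2) x])
  finally show ?thesis .
qed

section \<open>The setting of the theorem and the two maps equalized by \<open>Ind\<close>\<close>

locale coisotropic_comodule =
  left_coisotropic_subgroup K G H \<Delta>H \<epsilon>H S C \<Delta>C \<epsilon>C act \<sigma> +
  V: right_pi_comodule K G C \<Delta>C \<epsilon>C V \<rho>
  for K :: "('k, 'z) ring_scheme" and G :: "('g, 'y) monoid_scheme"
    and H :: "'g \<Rightarrow> ('k, 'h) module" and \<Delta>H \<epsilon>H S
    and C :: "'g \<Rightarrow> ('k, 'c) module" and \<Delta>C \<epsilon>C act \<sigma>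
    and V :: "'g \<Rightarrow> ('k, 'v) module" and \<rho>
begin

abbreviation "V1 \<equiv> V \<one>\<^bsub>G\<^esub>"
abbreviation "C1 \<equiv> C \<one>\<^bsub>G\<^esub>"
abbreviation "L \<equiv> coisotropic_coaction K G H \<Delta>H C \<sigma>"
abbreviation "I \<equiv> Ind K G H \<Delta>H C \<sigma> V \<rho>"

abbreviation "coactH \<alpha> \<equiv> tensor_map K V1 (tensor K C1 (H \<alpha>)) id (L \<alpha>)"
abbreviation "coactV \<alpha> \<equiv> \<lambda>x. tensor_assoc K V1 C1 (H \<alpha>)
  (tensor_map K (tensor K V1 C1) (H \<alpha>) (\<rho> \<one>\<^bsub>G\<^esub> \<one>\<^bsub>G\<^esub>) id x)"

lemmas spaces = H.space C.space V.comodule_space tensor_vectorspace H.G.one_closed H.G.m_closed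

lemma proj_one_hom: "\<sigma> \<one>\<^bsub>G\<^esub> \<in> module_hom K (H \<one>\<^bsub>G\<^esub>) C1"
  by (rule proj_linear) simp

lemma coaction_one_hom: "\<rho> \<one>\<^bsub>G\<^esub> \<one>\<^bsub>G\<^esub> \<in> module_hom K V1 (tensor K V1 C1)"
  using V.coaction_linear[of "\<one>\<^bsub>G\<^esub>" "\<one>\<^bsub>G\<^esub>"] by simp

lemma comult_one_hom:
  "\<alpha> \<in> carrier G \<Longrightarrow> \<Delta>H \<one>\<^bsub>G\<^esub> \<alpha> \<in> module_hom K (H \<alpha>) (tensor K (H \<one>\<^bsub>G\<^esub>) (H \<alpha>))"
  using H.comult_linear[of "\<one>\<^bsub>G\<^esub>" \<alpha>] by simp

lemma coisotropic_coaction_eq: "L \<alpha> = (\<lambda>x. tensor_map K C1 (H \<alpha>) (\<sigma> \<one>\<^bsub>G\<^esub>) id (\<Delta>H \<one>\<^bsub>G\<^esub> \<alpha> x))"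
  by (simp add: coisotropic_coaction_def fun_eq_iff)

lemma coisotropic_coaction_hom: "\<alpha> \<in> carrier G \<Longrightarrow> L \<alpha> \<in> module_hom K (H \<alpha>) (tensor K C1 (H \<alpha>))"
  unfolding coisotropic_coaction_eq
  by (rule module_hom_compose[OF comult_one_hom tensor_map_hom[OF _ _ _ _ proj_one_hom module_hom_id]])
    (simp_all add: spaces)

text \<open>This is coassociativity of \<open>H\<close> at the indices
  \<open>1, \<alpha>, \<beta>\<close> followed by \<sigma> on the first factor. Naturality of the
  associator moves \<sigma> outside, and afterwards it is commuted past \<Delta>.\<close>

lemma coisotropic_coaction_coassoc:
  assumes ab: "\<alpha> \<in> carrier G" "\<beta> \<in> carrier G" and h: "h \<in> carrier (H (\<alpha> \<otimes>\<^bsub>G\<^esub> \<beta>))"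
  shows "tensor_assoc K C1 (H \<alpha>) (H \<beta>) (tensor_map K (tensor K C1 (H \<alpha>)) (H \<beta>) (L \<alpha>) id (\<Delta>H \<alpha> \<beta> h)) =
    tensor_map K C1 (tensor K (H \<alpha>) (H \<beta>)) id (\<Delta>H \<alpha> \<beta>) (L (\<alpha> \<otimes>\<^bsub>G\<^esub> \<beta>) h)"
proof -
  let ?H1 = "H \<one>\<^bsub>G\<^esub>" and ?a = "H \<alpha>" and ?b = "H \<beta>" and ?D = "tensor K (H \<alpha>) (H \<beta>)"
  have v: "vectorspace K ?H1" "vectorspace K ?a" "vectorspace K ?b" "vectorspace K C1" "vectorspace K ?D"
    "vectorspace K (tensor K ?H1 ?a)" "vectorspace K (tensor K C1 ?a)" "vectorspace K (H (\<alpha> \<otimes>\<^bsub>G\<^esub> \<beta>))"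
    using ab by (simp_all add: spaces)
  have ab': "\<alpha> \<otimes>\<^bsub>G\<^esub> \<beta> \<in> carrier G" using ab by simp
  note D = H.comult_linear[OF ab]
  note s = tensor_map_hom[OF v(1,2,4,2) proj_one_hom module_hom_id]
  have d: "\<Delta>H \<alpha> \<beta> h \<in> carrier ?D" by (rule module_hom_in[OF D h])
  have d1: "\<Delta>H \<one>\<^bsub>G\<^esub> (\<alpha> \<otimes>\<^bsub>G\<^esub> \<beta>) h \<in> carrier (tensor K ?H1 (H (\<alpha> \<otimes>\<^bsub>G\<^esub> \<beta>)))"
    by (rule module_hom_in[OF comult_one_hom[OF ab'] h])
  have m: "tensor_map K (tensor K ?H1 ?a) ?b (\<Delta>H \<one>\<^bsub>G\<^esub> \<alpha>) id (\<Delta>H \<alpha> \<beta> h) \<in> carrier (tensor K (tensor K ?H1 ?a) ?b)"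
    by (rule module_hom_in[OF tensor_map_hom[OF v(2,3,6,3) comult_one_hom[OF ab(1)] module_hom_id] d])
  have "tensor_map K (tensor K C1 ?a) ?b (L \<alpha>) id (\<Delta>H \<alpha> \<beta> h) =
      tensor_map K (tensor K C1 ?a) ?b (tensor_map K C1 ?a (\<sigma> \<one>\<^bsub>G\<^esub>) id) id
        (tensor_map K (tensor K ?H1 ?a) ?b (\<Delta>H \<one>\<^bsub>G\<^esub> \<alpha>) id (\<Delta>H \<alpha> \<beta> h))"
    using tensor_map_comp[OF v(2,3,6,3,7,3) comult_one_hom[OF ab(1)] module_hom_id s module_hom_id d]
    by (simp add: coisotropic_coaction_eq id_def)
  also have "tensor_assoc K C1 ?a ?b \<dots> = tensor_map K C1 ?D (\<sigma> \<one>\<^bsub>G\<^esub>) (tensor_map K ?a ?b id id)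
      (tensor_assoc K ?H1 ?a ?b (tensor_map K (tensor K ?H1 ?a) ?b (\<Delta>H \<one>\<^bsub>G\<^esub> \<alpha>) id (\<Delta>H \<alpha> \<beta> h)))"
    by (rule tensor_assoc_natural[OF v(1,2,3,4,2,3) proj_one_hom module_hom_id module_hom_id m])
  also have "tensor_assoc K ?H1 ?a ?b (tensor_map K (tensor K ?H1 ?a) ?b (\<Delta>H \<one>\<^bsub>G\<^esub> \<alpha>) id (\<Delta>H \<alpha> \<beta> h)) =
      tensor_map K ?H1 ?D id (\<Delta>H \<alpha> \<beta>) (\<Delta>H \<one>\<^bsub>G\<^esub> (\<alpha> \<otimes>\<^bsub>G\<^esub> \<beta>) h)"
    using H.coassoc[of "\<one>\<^bsub>G\<^esub>" \<alpha> \<beta> h] ab h by simp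
  also have "tensor_map K C1 ?D (\<sigma> \<one>\<^bsub>G\<^esub>) (tensor_map K ?a ?b id id) \<dots> =
      tensor_map K C1 ?D (\<lambda>x. \<sigma> \<one>\<^bsub>G\<^esub> (id x)) (\<lambda>x. tensor_map K ?a ?b id id (\<Delta>H \<alpha> \<beta> x)) (\<Delta>H \<one>\<^bsub>G\<^esub> (\<alpha> \<otimes>\<^bsub>G\<^esub> \<beta>) h)"
    by (rule tensor_map_comp[OF v(1,8,1,5,4,5) module_hom_id D proj_one_hom
          tensor_map_hom[OF v(2,3,2,3) module_hom_id module_hom_id] d1])
  \<comment> \<open>\<sigma> and \<Delta> act on different factors, so their order may be exchanged.
    The \<open>id \<otimes> id\<close> left over from naturality disappears here.\<close>
  also have "\<dots> = tensor_map K C1 ?D (\<lambda>x. id (\<sigma> \<one>\<^bsub>G\<^esub> x)) (\<lambda>x. \<Delta>H \<alpha> \<beta> (id x)) (\<Delta>H \<one>\<^bsub>G\<^esub> (\<alpha> \<otimes>\<^bsub>G\<^esub> \<beta>) h)"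
  proof (rule tensor_map_cong[OF v(1,8,4,5) module_hom_compose[OF module_hom_id proj_one_hom]
        module_hom_compose[OF D tensor_map_hom[OF v(2,3,2,3) module_hom_id module_hom_id]]
        module_hom_compose[OF proj_one_hom module_hom_id] module_hom_compose[OF module_hom_id D] _ _ d1])
    fix x assume "x \<in> carrier (H (\<alpha> \<otimes>\<^bsub>G\<^esub> \<beta>))"
    then show "tensor_map K ?a ?b id id (\<Delta>H \<alpha> \<beta> x) = \<Delta>H \<alpha> \<beta> (id x)"
      using tensor_map_id[OF v(2,3)] module_hom_in[OF D] by simp
  qed simp
  also have "\<dots> = tensor_map K C1 ?D id (\<Delta>H \<alpha> \<beta>) (tensor_map K C1 (H (\<alpha> \<otimes>\<^bsub>G\<^esub> \<beta>)) (\<sigma> \<one>\<^bsub>G\<^esub>) id (\<Delta>H \<one>\<^bsub>G\<^esub> (\<alpha> \<otimes>\<^bsub>G\<^esub> \<beta>) h))"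
    by (rule tensor_map_comp[OF v(1,8,4,8,4,5) proj_one_hom module_hom_id module_hom_id D d1, symmetric])
  finally show ?thesis by (simp add: coisotropic_coaction_eq id_def)
qed

lemma coactH_hom: "\<alpha> \<in> carrier G \<Longrightarrow> coactH \<alpha> \<in> module_hom K (tensor K V1 (H \<alpha>)) (tensor K V1 (tensor K C1 (H \<alpha>)))"
  by (rule tensor_map_hom[OF _ _ _ _ module_hom_id coisotropic_coaction_hom]) (simp_all add: spaces)

lemma coactV_hom: "\<alpha> \<in> carrier G \<Longrightarrow> coactV \<alpha> \<in> module_hom K (tensor K V1 (H \<alpha>)) (tensor K V1 (tensor K C1 (H \<alpha>)))"
  by (rule module_hom_compose[OF tensor_map_hom[OF _ _ _ _ coaction_one_hom module_hom_id] tensor_assoc_hom])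
    (simp_all add: spaces)

text \<open>Puts \<open>Ind\<close> into the exact record form used by
  \<open>equalizer_vectorspace\<close> and \<open>tensor_equalizer\<close>.\<close>

lemma Ind_eq: "I \<alpha> = (tensor K V1 (H \<alpha>))\<lparr>carrier := {x \<in> carrier (tensor K V1 (H \<alpha>)). coactH \<alpha> x = coactV \<alpha> x}\<rparr>"
  by (simp add: Ind_def)

lemma Ind_vectorspace: "\<alpha> \<in> carrier G \<Longrightarrow> vectorspace K (I \<alpha>)"
  unfolding Ind_eq by (rule equalizer_vectorspace[OF _ _ coactH_hom coactV_hom]) (simp_all add: spaces)

lemma incl_hom: "id \<in> module_hom K (I \<alpha>) (tensor K V1 (H \<alpha>))"
  unfolding Ind_eq by (rule subspace_incl_hom) blast

text \<open>The right factor \<open>N\<close> is arbitrary because coassociativity is compared in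
  \<open>Ind(\<rho>)\<^sub>\<alpha> \<otimes> (H\<^sub>\<beta> \<otimes> H\<^sub>\<gamma>)\<close> and counitality in \<open>Ind(\<rho>)\<^sub>\<alpha> \<otimes> K\<close>.\<close>

definition Ind_tensor_embed where
  "Ind_tensor_embed \<alpha> N y = tensor_assoc K V1 (H \<alpha>) N (tensor_map K (tensor K V1 (H \<alpha>)) N id id y)"

lemma Ind_embed_eq: "Ind_embed K G H V \<alpha> \<beta> = Ind_tensor_embed \<alpha> (H \<beta>)"
  by (simp add: Ind_embed_def Ind_tensor_embed_def fun_eq_iff)

lemma incl_tensor_hom:
  "\<lbrakk>\<alpha> \<in> carrier G; vectorspace K N\<rbrakk> \<Longrightarrow>
    tensor_map K (tensor K V1 (H \<alpha>)) N id id \<in> module_hom K (tensor K (I \<alpha>) N) (tensor K (tensor K V1 (H \<alpha>)) N)"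
  by (rule tensor_map_hom[OF _ _ _ _ incl_hom module_hom_id]) (simp_all add: spaces Ind_vectorspace)

lemma Ind_tensor_embed_hom:
  assumes "\<alpha> \<in> carrier G" "vectorspace K N"
  shows "Ind_tensor_embed \<alpha> N \<in> module_hom K (tensor K (I \<alpha>) N) (tensor K V1 (tensor K (H \<alpha>) N))"
  unfolding Ind_tensor_embed_def[abs_def]
  by (rule module_hom_compose[OF incl_tensor_hom[OF assms] tensor_assoc_hom]) (simp_all add: spaces assms)

text \<open>The inclusion stays injective after tensoring with \<open>N\<close>, and the associator
  that follows has a left inverse.\<close>

lemma inj_on_Ind_tensor_embed:
  assumes a: "\<alpha> \<in> carrier G" and N: "vectorspace K N"
  shows "inj_on (Ind_tensor_embed \<alpha> N) (carrier (tensor K (I \<alpha>) N))"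
proof -
  let ?T = "tensor K V1 (H \<alpha>)"
  have v: "vectorspace K V1" "vectorspace K (H \<alpha>)" "vectorspace K ?T" "vectorspace K (I \<alpha>)"
    using a by (simp_all add: spaces Ind_vectorspace)
  have i: "inj_on (tensor_map K ?T N id id) (carrier (tensor K (I \<alpha>) N))"
    by (rule inj_on_tensor_map_left[OF v(4,3) N incl_hom inj_on_id])
  have "tensor_map K ?T N id id ` carrier (tensor K (I \<alpha>) N) \<subseteq> carrier (tensor K ?T N)"
    using module_hom_in[OF incl_tensor_hom[OF a N]] by blast
  from comp_inj_on[OF i inj_on_subset[OF inj_on_tensor_assoc[OF v(1,2) N] this]]
  show ?thesis by (simp add: Ind_tensor_embed_def[abs_def] comp_def)
qed

lemma id_comult_hom:
  "\<lbrakk>\<alpha> \<in> carrier G; \<beta> \<in> carrier G\<rbrakk> \<Longrightarrow> id_comult K G H \<Delta>H V \<alpha> \<beta> \<in>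
    module_hom K (tensor K V1 (H (\<alpha> \<otimes>\<^bsub>G\<^esub> \<beta>))) (tensor K V1 (tensor K (H \<alpha>) (H \<beta>)))"
  unfolding id_comult_def by (rule tensor_map_hom[OF _ _ _ _ module_hom_id H.comult_linear]) (simp_all add: spaces)

lemma Ind_in_tensor: "x \<in> carrier (I \<alpha>) \<Longrightarrow> x \<in> carrier (tensor K V1 (H \<alpha>))"
  by (simp add: Ind_eq)

text \<open>By exactness it suffices that the two maps defining \<open>Ind\<close>, tensored with
  \<open>H\<^sub>\<beta>\<close>, agree on the rebracketed element \<open>y\<close>. They are
  compared after the injective rebracketing \<open>?\<Phi>\<close>, along one chain of
  equations.\<close>

lemma id_comult_Ind:
  assumes ab: "\<alpha> \<in> carrier G" "\<beta> \<in> carrier G" and x: "x \<in> carrier (I (\<alpha> \<otimes>\<^bsub>G\<^esub> \<beta>))"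
  shows "id_comult K G H \<Delta>H V \<alpha> \<beta> x \<in> Ind_tensor_embed \<alpha> (H \<beta>) ` carrier (tensor K (I \<alpha>) (H \<beta>))"
proof -
  let ?a = "H \<alpha>" and ?b = "H \<beta>" and ?c = "H (\<alpha> \<otimes>\<^bsub>G\<^esub> \<beta>)"
  let ?D = "tensor K ?a ?b" and ?T = "tensor K V1 ?a" and ?R = "tensor K V1 C1" and ?L = "tensor K C1 ?a"
  let ?\<rho> = "\<rho> \<one>\<^bsub>G\<^esub> \<one>\<^bsub>G\<^esub>" and ?\<Delta> = "\<Delta>H \<alpha> \<beta>"
  have ab': "\<alpha> \<otimes>\<^bsub>G\<^esub> \<beta> \<in> carrier G" using ab by simp
  have a: "vectorspace K ?a" and b: "vectorspace K ?b" and c: "vectorspace K ?c"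
    and v: "vectorspace K V1" and e: "vectorspace K C1"
    using ab by (simp_all add: spaces)
  note D = tensor_vectorspace[OF a b] and T = tensor_vectorspace[OF v a]
    and R = tensor_vectorspace[OF v e] and L = tensor_vectorspace[OF e a]
  note dh = H.comult_linear[OF ab] and rh = coaction_one_hom and Lh = coisotropic_coaction_hom[OF ab(1)]
  have xT: "x \<in> carrier (tensor K V1 ?c)" by (rule Ind_in_tensor[OF x])
  define z where "z = id_comult K G H \<Delta>H V \<alpha> \<beta> x"
  have z_eq: "z = tensor_map K V1 ?D id ?\<Delta> x" by (simp add: z_def id_comult_def)
  have z: "z \<in> carrier (tensor K V1 ?D)"
    unfolding z_def by (rule module_hom_in[OF id_comult_hom[OF ab] xT])
  \<comment> \<open>Rebracketing isolates \<open>H\<^sub>\<beta>\<close> as the right factor, the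
    shape demanded by \<open>tensor_equalizer\<close>.\<close>
  define y where "y = tensor_assoc_inv K V1 ?a ?b z"
  have y: "y \<in> carrier (tensor K ?T ?b)"
    unfolding y_def by (rule module_hom_in[OF tensor_assoc_inv_hom[OF v a b] z])
  have yz: "tensor_assoc K V1 ?a ?b y = z"
    unfolding y_def by (rule tensor_assoc_assoc_inv[OF v a b z])
  let ?W = "tensor K V1 ?L"
  \<comment> \<open>Takes \<open>(V\<^sub>1 \<otimes> (C\<^sub>1 \<otimes> H\<^sub>\<alpha>))
    \<otimes> H\<^sub>\<beta>\<close> to the right-nested bracketing, where \<Delta> appears as a
    map on the innermost factor.\<close>
  let ?\<Phi> = "\<lambda>t. tensor_map K V1 (tensor K C1 ?D) id (tensor_assoc K C1 ?a ?b) (tensor_assoc K V1 ?L ?b t)"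
  have "?\<Phi> (tensor_map K ?W ?b (coactH \<alpha>) id y) =
      tensor_map K V1 (tensor K C1 ?D) id (tensor_assoc K C1 ?a ?b)
        (tensor_map K V1 (tensor K ?L ?b) id (tensor_map K ?L ?b (L \<alpha>) id) z)"
    using tensor_assoc_natural[OF v a b v L b module_hom_id Lh module_hom_id y] by (simp add: yz)
  also have "\<dots> = tensor_map K V1 (tensor K C1 ?D) (\<lambda>m. id (id m))
      (\<lambda>n. tensor_assoc K C1 ?a ?b (tensor_map K ?L ?b (L \<alpha>) id n)) z"
    by (rule tensor_map_comp[OF v D v tensor_vectorspace[OF L b] v tensor_vectorspace[OF e D] module_hom_id
          tensor_map_hom[OF a b L b Lh module_hom_id] module_hom_id tensor_assoc_hom[OF e a b] z])
  also have "\<dots> = tensor_map K V1 (tensor K C1 ?D) (\<lambda>m. id (id (id m)))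
      (\<lambda>n. tensor_assoc K C1 ?a ?b (tensor_map K ?L ?b (L \<alpha>) id (?\<Delta> n))) x"
    unfolding z_eq
    by (rule tensor_map_comp[OF v c v D v tensor_vectorspace[OF e D] module_hom_id dh
          module_hom_compose[OF module_hom_id module_hom_id]
          module_hom_compose[OF tensor_map_hom[OF a b L b Lh module_hom_id] tensor_assoc_hom[OF e a b]] xT])
  \<comment> \<open>Coassociativity of \<open>L\<close> is applied in the second factor.\<close>
  also have "\<dots> = tensor_map K V1 (tensor K C1 ?D) (\<lambda>m. id (id m))
      (\<lambda>n. tensor_map K C1 ?D id ?\<Delta> (L (\<alpha> \<otimes>\<^bsub>G\<^esub> \<beta>) n)) x"
    by (rule tensor_map_cong[OF v c v tensor_vectorspace[OF e D]
          module_hom_compose[OF module_hom_id module_hom_compose[OF module_hom_id module_hom_id]]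
          module_hom_compose[OF dh module_hom_compose[OF tensor_map_hom[OF a b L b Lh module_hom_id] tensor_assoc_hom[OF e a b]]]
          module_hom_compose[OF module_hom_id module_hom_id]
          module_hom_compose[OF coisotropic_coaction_hom[OF ab'] tensor_map_hom[OF e c e D module_hom_id dh]] _ coisotropic_coaction_coassoc[OF ab] xT])
      simp_all
  also have "\<dots> = tensor_map K V1 (tensor K C1 ?D) id (tensor_map K C1 ?D id ?\<Delta>) (coactH (\<alpha> \<otimes>\<^bsub>G\<^esub> \<beta>) x)"
    by (rule tensor_map_comp[OF v c v tensor_vectorspace[OF e c] v tensor_vectorspace[OF e D] module_hom_id
          coisotropic_coaction_hom[OF ab'] module_hom_id tensor_map_hom[OF e c e D module_hom_id dh] xT, symmetric])
  \<comment> \<open>The turning point: membership of \<open>x\<close> in \<open>Ind\<close>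
    exchanges the coaction on \<open>H\<close> for the one on \<open>V\<close>. The rest of the
    chain rebuilds the coaction on \<open>y\<close>.\<close>
  also have "coactH (\<alpha> \<otimes>\<^bsub>G\<^esub> \<beta>) x = coactV (\<alpha> \<otimes>\<^bsub>G\<^esub> \<beta>) x"
    using x by (simp add: Ind_eq)
  also have "tensor_map K V1 (tensor K C1 ?D) id (tensor_map K C1 ?D id ?\<Delta>) \<dots> =
      tensor_assoc K V1 C1 ?D (tensor_map K ?R ?D (tensor_map K V1 C1 id id) ?\<Delta> (tensor_map K ?R ?c ?\<rho> id x))"
    by (rule tensor_assoc_natural[OF v e c v e D module_hom_id module_hom_id dh
          module_hom_in[OF tensor_map_hom[OF v c R c rh module_hom_id] xT], symmetric])
  also have "tensor_map K ?R ?D (tensor_map K V1 C1 id id) ?\<Delta> (tensor_map K ?R ?c ?\<rho> id x) =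
      tensor_map K ?R ?D (\<lambda>m. tensor_map K V1 C1 id id (?\<rho> m)) (\<lambda>n. ?\<Delta> (id n)) x"
    by (rule tensor_map_comp[OF v c R c R D rh module_hom_id
          tensor_map_hom[OF v e v e module_hom_id module_hom_id] dh xT])
  \<comment> \<open>Interchange: \<rho> and \<Delta> act on different factors, so \<Delta> can come
    first and produce \<open>z\<close>. Identities on tensor products are written as
    \<open>id \<otimes> id\<close> to match \<open>tensor_assoc_natural\<close>.\<close>
  also have "\<dots> = tensor_map K ?R ?D (\<lambda>m. ?\<rho> (id m)) (\<lambda>n. tensor_map K ?a ?b id id (?\<Delta> n)) x"
    by (rule tensor_map_cong[OF v c R D
          module_hom_compose[OF rh tensor_map_hom[OF v e v e module_hom_id module_hom_id]]
          module_hom_compose[OF module_hom_id dh] module_hom_compose[OF module_hom_id rh]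
          module_hom_compose[OF dh tensor_map_hom[OF a b a b module_hom_id module_hom_id]] _ _ xT])
      (simp_all add: tensor_map_id[OF v e module_hom_in[OF rh]] tensor_map_id[OF a b module_hom_in[OF dh]])
  also have "\<dots> = tensor_map K ?R ?D ?\<rho> (tensor_map K ?a ?b id id) z"
    unfolding z_eq
    by (rule tensor_map_comp[OF v c v D R D module_hom_id dh rh
          tensor_map_hom[OF a b a b module_hom_id module_hom_id] xT, symmetric])
  also have "\<dots> = tensor_assoc K ?R ?a ?b (tensor_map K (tensor K ?R ?a) ?b (tensor_map K ?R ?a ?\<rho> id) id y)"
    unfolding yz[symmetric]
    by (rule tensor_assoc_natural[OF v a b R a b rh module_hom_id module_hom_id y, symmetric])
  \<comment> \<open>The pentagon trades two associators for three: two form \<open>?\<Phi>\<close>,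
    and the third is the one inside \<open>coactV\<close>.\<close>
  also have "tensor_assoc K V1 C1 ?D \<dots> =
      ?\<Phi> (tensor_map K ?W ?b (tensor_assoc K V1 C1 ?a) id (tensor_map K (tensor K ?R ?a) ?b (tensor_map K ?R ?a ?\<rho> id) id y))"
    by (rule tensor_pentagon[OF v e a b module_hom_in[OF tensor_map_hom[OF T b tensor_vectorspace[OF R a] b
          tensor_map_hom[OF v a R a rh module_hom_id] module_hom_id] y]])
  also have "tensor_map K ?W ?b (tensor_assoc K V1 C1 ?a) id (tensor_map K (tensor K ?R ?a) ?b (tensor_map K ?R ?a ?\<rho> id) id y)
      = tensor_map K ?W ?b (coactV \<alpha>) (\<lambda>n. id (id n)) y"
    by (rule tensor_map_comp[OF T b tensor_vectorspace[OF R a] b tensor_vectorspace[OF v L] b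
          tensor_map_hom[OF v a R a rh module_hom_id] module_hom_id tensor_assoc_hom[OF v e a] module_hom_id y])
  finally have \<Phi>: "?\<Phi> (tensor_map K ?W ?b (coactH \<alpha>) id y) = ?\<Phi> (tensor_map K ?W ?b (coactV \<alpha>) id y)"
    by (simp add: id_def)
  have in1: "tensor_map K ?W ?b (coactH \<alpha>) id y \<in> carrier (tensor K ?W ?b)"
    by (rule module_hom_in[OF tensor_map_hom[OF T b tensor_vectorspace[OF v L] b coactH_hom[OF ab(1)] module_hom_id] y])
  have in2: "tensor_map K ?W ?b (coactV \<alpha>) id y \<in> carrier (tensor K ?W ?b)"
    by (rule module_hom_in[OF tensor_map_hom[OF T b tensor_vectorspace[OF v L] b coactV_hom[OF ab(1)] module_hom_id] y])
  \<comment> \<open>Undoes the inner associator of \<open>?\<Phi>\<close>; the outer one is then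
    cancelled by injectivity.\<close>
  have inv: "tensor_map K V1 (tensor K ?L ?b) id (tensor_assoc_inv K C1 ?a ?b) (?\<Phi> t) = tensor_assoc K V1 ?L ?b t"
    if "t \<in> carrier (tensor K ?W ?b)" for t
    by (rule tensor_map_left_inverse[OF v tensor_vectorspace[OF L b] tensor_vectorspace[OF e D]
          tensor_assoc_hom[OF e a b] tensor_assoc_inv_hom[OF e a b] tensor_assoc_inv_assoc[OF e a b]
          module_hom_in[OF tensor_assoc_hom[OF v L b] that]])
  have "tensor_assoc K V1 ?L ?b (tensor_map K ?W ?b (coactH \<alpha>) id y) =
      tensor_assoc K V1 ?L ?b (tensor_map K ?W ?b (coactV \<alpha>) id y)"
    using arg_cong[OF \<Phi>, of "tensor_map K V1 (tensor K ?L ?b) id (tensor_assoc_inv K C1 ?a ?b)"]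
    unfolding inv[OF in1] inv[OF in2] .
  from inj_onD[OF inj_on_tensor_assoc[OF v L b] this in1 in2]
  have "tensor_map K ?W ?b (coactH \<alpha>) id y = tensor_map K ?W ?b (coactV \<alpha>) id y" .
  \<comment> \<open>Exactness turns the equation on \<open>y\<close> into a preimage in the tensor
    product of \<open>Ind\<close>.\<close>
  from tensor_equalizer[OF T tensor_vectorspace[OF v L] b coactH_hom[OF ab(1)] coactV_hom[OF ab(1)] y this]
  obtain w where w: "w \<in> carrier (tensor K (I \<alpha>) ?b)" "y = tensor_map K ?T ?b id id w"
    unfolding Ind_eq[symmetric] by (rule imageE)
  then have "z = Ind_tensor_embed \<alpha> ?b w" using yz by (simp add: Ind_tensor_embed_def)
  with w(1) show ?thesis unfolding z_def by blast
qed

section \<open>The coaction and its axioms\<close>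

abbreviation "\<theta> \<equiv> Ind_coaction K G H \<Delta>H C \<sigma> V \<rho>"

context
  fixes \<alpha> \<beta>
  assumes ab: "\<alpha> \<in> carrier G" "\<beta> \<in> carrier G"
begin

text \<open>The range inclusion makes \<open>inv_into\<close> return a genuine preimage. Later
  arguments use this equation and \<open>Ind_coaction_in\<close> in place of the choice made by
  \<open>inv_into\<close>.\<close>

lemma Ind_tensor_embed_coaction:
  assumes "x \<in> carrier (I (\<alpha> \<otimes>\<^bsub>G\<^esub> \<beta>))"
  shows "Ind_tensor_embed \<alpha> (H \<beta>) (\<theta> \<alpha> \<beta> x) = id_comult K G H \<Delta>H V \<alpha> \<beta> x"
  unfolding Ind_coaction_def Ind_embed_eq by (rule f_inv_into_f[OF id_comult_Ind[OF ab assms]])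

lemma Ind_coaction_in:
  assumes "x \<in> carrier (I (\<alpha> \<otimes>\<^bsub>G\<^esub> \<beta>))"
  shows "\<theta> \<alpha> \<beta> x \<in> carrier (tensor K (I \<alpha>) (H \<beta>))"
  unfolding Ind_coaction_def Ind_embed_eq by (rule inv_into_into[OF id_comult_Ind[OF ab assms]])

text \<open>The embedding need not be onto, so \<theta> is not simply the inverse of a linear
  bijection. Linearity is pulled back instead: both sides have the same image under the injective
  linear embedding.\<close>

lemma Ind_coaction_hom: "\<theta> \<alpha> \<beta> \<in> module_hom K (I (\<alpha> \<otimes>\<^bsub>G\<^esub> \<beta>)) (tensor K (I \<alpha>) (H \<beta>))"
proof -
  let ?E = "Ind_tensor_embed \<alpha> (H \<beta>)" and ?I = "I (\<alpha> \<otimes>\<^bsub>G\<^esub> \<beta>)"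
  have b: "vectorspace K (H \<beta>)" using ab by (simp add: spaces)
  have ab': "\<alpha> \<otimes>\<^bsub>G\<^esub> \<beta> \<in> carrier G" using ab by simp
  interpret X: vectorspace K ?I by (rule Ind_vectorspace[OF ab'])
  interpret T: vectorspace K "tensor K (I \<alpha>) (H \<beta>)" by (rule tensor_vectorspace[OF Ind_vectorspace[OF ab(1)] b])
  note E = Ind_tensor_embed_hom[OF ab(1) b] and inj = inj_onD[OF inj_on_Ind_tensor_embed[OF ab(1) b]]
  have d: "id_comult K G H \<Delta>H V \<alpha> \<beta> \<in> module_hom K ?I (tensor K V1 (tensor K (H \<alpha>) (H \<beta>)))"
    using module_hom_compose[OF incl_hom id_comult_hom[OF ab]] by simp
  show ?thesis
  proof (rule module_homI)
    fix x assume x: "x \<in> carrier ?I"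
    then show "\<theta> \<alpha> \<beta> x \<in> carrier (tensor K (I \<alpha>) (H \<beta>))" by (rule Ind_coaction_in)
    fix y assume y: "y \<in> carrier ?I"
    show "\<theta> \<alpha> \<beta> (x \<oplus>\<^bsub>?I\<^esub> y) = \<theta> \<alpha> \<beta> x \<oplus>\<^bsub>tensor K (I \<alpha>) (H \<beta>)\<^esub> \<theta> \<alpha> \<beta> y"
    proof (rule inj)
      show "?E (\<theta> \<alpha> \<beta> (x \<oplus>\<^bsub>?I\<^esub> y)) = ?E (\<theta> \<alpha> \<beta> x \<oplus>\<^bsub>tensor K (I \<alpha>) (H \<beta>)\<^esub> \<theta> \<alpha> \<beta> y)"
        by (simp only: module_hom_add[OF E] Ind_tensor_embed_coaction Ind_coaction_in x y X.add.m_closed module_hom_add[OF d])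
    qed (simp_all only: Ind_coaction_in x y X.add.m_closed T.add.m_closed)
  next
    fix k x assume k: "k \<in> carrier K" and x: "x \<in> carrier ?I"
    show "\<theta> \<alpha> \<beta> (k \<odot>\<^bsub>?I\<^esub> x) = k \<odot>\<^bsub>tensor K (I \<alpha>) (H \<beta>)\<^esub> \<theta> \<alpha> \<beta> x"
    proof (rule inj)
      show "?E (\<theta> \<alpha> \<beta> (k \<odot>\<^bsub>?I\<^esub> x)) = ?E (k \<odot>\<^bsub>tensor K (I \<alpha>) (H \<beta>)\<^esub> \<theta> \<alpha> \<beta> x)"
        by (simp only: module_hom_smult[OF E] Ind_tensor_embed_coaction Ind_coaction_in k x X.smult_closed module_hom_smult[OF d])
    qed (simp_all only: Ind_coaction_in k x X.smult_closed T.smult_closed)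
  qed
qed

end

text \<open>The embedding touches only the left factor apart from rebracketing. This carries the
  comultiplication and the counit of \<open>H\<close> past it in the last two axioms.\<close>

lemma Ind_tensor_embed_natural:
  assumes a: "\<alpha> \<in> carrier G" and N: "vectorspace K N" "vectorspace K N'" and f: "f \<in> module_hom K N N'"
    and x: "x \<in> carrier (tensor K (I \<alpha>) N)"
  shows "Ind_tensor_embed \<alpha> N' (tensor_map K (I \<alpha>) N' id f x) = tensor_map K V1 (tensor K (H \<alpha>) N') id (tensor_map K (H \<alpha>) N' id f) (Ind_tensor_embed \<alpha> N x)"
proof -
  let ?T = "tensor K V1 (H \<alpha>)"
  have i: "vectorspace K (I \<alpha>)" and v: "vectorspace K V1" and h: "vectorspace K (H \<alpha>)" and T: "vectorspace K ?T"
    using a by (simp_all add: spaces Ind_vectorspace)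
  have "tensor_map K ?T N' id id (tensor_map K (I \<alpha>) N' id f x) = tensor_map K ?T N' (\<lambda>m. id (id m)) (\<lambda>n. id (f n)) x"
    by (rule tensor_map_comp[OF i N(1) i N(2) T N(2) module_hom_id f incl_hom module_hom_id x])
  \<comment> \<open>The identity of \<open>V\<^sub>1 \<otimes> H\<^sub>\<alpha>\<close> is written
    as a tensor map so that \<open>tensor_assoc_natural\<close> applies.\<close>
  also have "\<dots> = tensor_map K ?T N' (\<lambda>m. tensor_map K V1 (H \<alpha>) id id (id m)) (\<lambda>n. f (id n)) x"
  proof (rule tensor_map_cong[OF i N(1) T N(2) module_hom_compose[OF incl_hom module_hom_id]
        module_hom_compose[OF f module_hom_id]
        module_hom_compose[OF incl_hom tensor_map_hom[OF v h v h module_hom_id module_hom_id]]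
        module_hom_compose[OF module_hom_id f] _ _ x])
    show "id (id m) = tensor_map K V1 (H \<alpha>) id id (id m)" if "m \<in> carrier (I \<alpha>)" for m
      using tensor_map_id[OF v h Ind_in_tensor[OF that]] by simp
  qed simp
  also have "\<dots> = tensor_map K ?T N' (tensor_map K V1 (H \<alpha>) id id) f (tensor_map K ?T N id id x)"
    by (rule tensor_map_comp[OF i N(1) T N(1) T N(2) incl_hom module_hom_id
          tensor_map_hom[OF v h v h module_hom_id module_hom_id] f x, symmetric])
  finally show ?thesis
    unfolding Ind_tensor_embed_def
    using tensor_assoc_natural[OF v h N(1) v h N(2) module_hom_id module_hom_id f
        module_hom_in[OF incl_tensor_hom[OF a N(1)] x]] by (simp only:)
qed

text \<open>Both sides are embedded into \<open>V\<^sub>1 \<otimes> (H\<^sub>\<alpha> \<otimes>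
  (H\<^sub>\<beta> \<otimes> H\<^sub>\<gamma>))\<close>. There the claim becomes coassociativity of
  \<open>H\<close> in the second factor.\<close>

lemma Ind_coaction_coassoc:
  assumes abc: "\<alpha> \<in> carrier G" "\<beta> \<in> carrier G" "\<gamma> \<in> carrier G"
    and x: "x \<in> carrier (I (\<alpha> \<otimes>\<^bsub>G\<^esub> \<beta> \<otimes>\<^bsub>G\<^esub> \<gamma>))"
  shows "tensor_assoc K (I \<alpha>) (H \<beta>) (H \<gamma>) (tensor_map K (tensor K (I \<alpha>) (H \<beta>)) (H \<gamma>) (\<theta> \<alpha> \<beta>) id (\<theta> (\<alpha> \<otimes>\<^bsub>G\<^esub> \<beta>) \<gamma> x)) =
    tensor_map K (I \<alpha>) (tensor K (H \<beta>) (H \<gamma>)) id (\<Delta>H \<beta> \<gamma>) (\<theta> \<alpha> (\<beta> \<otimes>\<^bsub>G\<^esub> \<gamma>) x)"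
    (is "?lhs = ?rhs")
proof -
  let ?a = "H \<alpha>" and ?b = "H \<beta>" and ?c = "H \<gamma>" and ?ab = "H (\<alpha> \<otimes>\<^bsub>G\<^esub> \<beta>)" and ?bc = "H (\<beta> \<otimes>\<^bsub>G\<^esub> \<gamma>)"
  let ?abc = "H (\<alpha> \<otimes>\<^bsub>G\<^esub> \<beta> \<otimes>\<^bsub>G\<^esub> \<gamma>)" and ?i = "I \<alpha>" and ?iab = "I (\<alpha> \<otimes>\<^bsub>G\<^esub> \<beta>)"
  let ?BC = "tensor K ?b ?c" and ?AB = "tensor K ?a ?b" and ?T = "tensor K V1 ?a" and ?Tab = "tensor K V1 ?ab"
  have gr: "\<alpha> \<otimes>\<^bsub>G\<^esub> \<beta> \<in> carrier G" "\<beta> \<otimes>\<^bsub>G\<^esub> \<gamma> \<in> carrier G" using abc by simp_all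
  \<comment> \<open>The two sides start from indices that agree by associativity in the group; this
    identifies the corresponding members of the families.\<close>
  have as: "\<alpha> \<otimes>\<^bsub>G\<^esub> (\<beta> \<otimes>\<^bsub>G\<^esub> \<gamma>) = \<alpha> \<otimes>\<^bsub>G\<^esub> \<beta> \<otimes>\<^bsub>G\<^esub> \<gamma>" using abc by (simp add: H.G.m_assoc)
  have v: "vectorspace K V1" and a: "vectorspace K ?a" and b: "vectorspace K ?b" and c: "vectorspace K ?c"
    and ab: "vectorspace K ?ab" and bc: "vectorspace K ?bc" and abc': "vectorspace K ?abc"
    and i: "vectorspace K ?i" and iab: "vectorspace K ?iab"
    using abc gr by (simp_all add: spaces Ind_vectorspace)
  note BC = tensor_vectorspace[OF b c] and AB = tensor_vectorspace[OF a b] and T = tensor_vectorspace[OF v a]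
    and Tab = tensor_vectorspace[OF v ab]
  note dab = H.comult_linear[OF abc(1,2)] and dbc = H.comult_linear[OF abc(2,3)]
  note dabc = H.comult_linear[OF gr(1) abc(3)] and dabc' = H.comult_linear[OF abc(1) gr(2), unfolded as]
  note tab = Ind_coaction_hom[OF abc(1,2)]
  have x': "x \<in> carrier (I (\<alpha> \<otimes>\<^bsub>G\<^esub> (\<beta> \<otimes>\<^bsub>G\<^esub> \<gamma>)))" using x by (simp only: as)
  have xT: "x \<in> carrier (tensor K V1 ?abc)" by (rule Ind_in_tensor[OF x])
  define y where "y = \<theta> (\<alpha> \<otimes>\<^bsub>G\<^esub> \<beta>) \<gamma> x"
  have y: "y \<in> carrier (tensor K ?iab ?c)" unfolding y_def by (rule Ind_coaction_in[OF gr(1) abc(3) x])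
  have ey: "Ind_tensor_embed (\<alpha> \<otimes>\<^bsub>G\<^esub> \<beta>) ?c y = tensor_map K V1 (tensor K ?ab ?c) id (\<Delta>H (\<alpha> \<otimes>\<^bsub>G\<^esub> \<beta>) \<gamma>) x"
    unfolding y_def by (simp add: Ind_tensor_embed_coaction[OF gr(1) abc(3) x] id_comult_def)
  define z where "z = \<theta> \<alpha> (\<beta> \<otimes>\<^bsub>G\<^esub> \<gamma>) x"
  have z: "z \<in> carrier (tensor K ?i ?bc)" unfolding z_def by (rule Ind_coaction_in[OF abc(1) gr(2) x'])
  have ez: "Ind_tensor_embed \<alpha> ?bc z = tensor_map K V1 (tensor K ?a ?bc) id (\<Delta>H \<alpha> (\<beta> \<otimes>\<^bsub>G\<^esub> \<gamma>)) x"
    unfolding z_def by (simp add: Ind_tensor_embed_coaction[OF abc(1) gr(2) x'] id_comult_def)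
  define w where "w = tensor_map K (tensor K ?i ?b) ?c (\<theta> \<alpha> \<beta>) id y"
  note ib = tensor_vectorspace[OF i b] and Tb = tensor_vectorspace[OF T b]
  note inc = tensor_map_hom[OF i b T b incl_hom module_hom_id]
  have w: "w \<in> carrier (tensor K (tensor K ?i ?b) ?c)"
    unfolding w_def by (rule module_hom_in[OF tensor_map_hom[OF iab c ib c tab module_hom_id] y])
  have aw: "tensor_assoc K ?i ?b ?c w \<in> carrier (tensor K ?i ?BC)"
    by (rule module_hom_in[OF tensor_assoc_hom[OF i b c] w])
  have r: "tensor_map K ?i ?BC id (\<Delta>H \<beta> \<gamma>) z \<in> carrier (tensor K ?i ?BC)"
    by (rule module_hom_in[OF tensor_map_hom[OF i bc i BC module_hom_id dbc] z])
  let ?U = "tensor K V1 (tensor K ?a ?BC)" and ?V = "tensor K V1 (tensor K ?AB ?c)"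
  note aBC = tensor_vectorspace[OF a BC] and ABc = tensor_vectorspace[OF AB c]
  have "Ind_tensor_embed \<alpha> ?BC (tensor_map K ?i ?BC id (\<Delta>H \<beta> \<gamma>) z) =
      tensor_map K V1 (tensor K ?a ?BC) id (tensor_map K ?a ?BC id (\<Delta>H \<beta> \<gamma>)) (Ind_tensor_embed \<alpha> ?bc z)"
    by (rule Ind_tensor_embed_natural[OF abc(1) bc BC dbc z])
  also have "\<dots> = tensor_map K V1 (tensor K ?a ?BC) (\<lambda>m. id (id m))
      (\<lambda>n. tensor_map K ?a ?BC id (\<Delta>H \<beta> \<gamma>) (\<Delta>H \<alpha> (\<beta> \<otimes>\<^bsub>G\<^esub> \<gamma>) n)) x"
    unfolding ez
    by (rule tensor_map_comp[OF v abc' v tensor_vectorspace[OF a bc] v aBC module_hom_id dabc' module_hom_id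
          tensor_map_hom[OF a bc a BC module_hom_id dbc] xT])
  also have "\<dots> = tensor_map K V1 (tensor K ?a ?BC) (\<lambda>m. id (id m))
      (\<lambda>n. tensor_assoc K ?a ?b ?c (tensor_map K ?AB ?c (\<Delta>H \<alpha> \<beta>) id (\<Delta>H (\<alpha> \<otimes>\<^bsub>G\<^esub> \<beta>) \<gamma> n))) x"
    by (rule tensor_map_cong[OF v abc' v aBC module_hom_compose[OF module_hom_id module_hom_id]
          module_hom_compose[OF dabc' tensor_map_hom[OF a bc a BC module_hom_id dbc]]
          module_hom_compose[OF module_hom_id module_hom_id]
          module_hom_compose[OF dabc module_hom_compose[OF tensor_map_hom[OF ab c AB c dab module_hom_id] tensor_assoc_hom[OF a b c]]]
          refl H.coassoc[OF abc, symmetric] xT])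
  also have "\<dots> = tensor_map K V1 (tensor K ?a ?BC) id
      (\<lambda>n. tensor_assoc K ?a ?b ?c (tensor_map K ?AB ?c (\<Delta>H \<alpha> \<beta>) id n)) (Ind_tensor_embed (\<alpha> \<otimes>\<^bsub>G\<^esub> \<beta>) ?c y)"
    unfolding ey
    by (rule tensor_map_comp[OF v abc' v tensor_vectorspace[OF ab c] v aBC module_hom_id dabc module_hom_id
          module_hom_compose[OF tensor_map_hom[OF ab c AB c dab module_hom_id] tensor_assoc_hom[OF a b c]] xT, symmetric])
  \<comment> \<open>The right side is now expressed through the embedded \<open>y\<close>; the left
    side is brought to the same expression below.\<close>
  finally have R: "Ind_tensor_embed \<alpha> ?BC (tensor_map K ?i ?BC id (\<Delta>H \<beta> \<gamma>) z) = tensor_map K V1 (tensor K ?a ?BC) id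
      (\<lambda>n. tensor_assoc K ?a ?b ?c (tensor_map K ?AB ?c (\<Delta>H \<alpha> \<beta>) id n)) (Ind_tensor_embed (\<alpha> \<otimes>\<^bsub>G\<^esub> \<beta>) ?c y)" .
  \<comment> \<open>The identity on the right factor is split as \<open>id \<otimes> id\<close>,
    which lets the inclusion pass through the associator.\<close>
  have "tensor_map K ?T ?BC id id (tensor_assoc K ?i ?b ?c w) =
      tensor_map K ?T ?BC id (tensor_map K ?b ?c id id) (tensor_assoc K ?i ?b ?c w)"
    by (rule tensor_map_cong[OF i BC T BC incl_hom module_hom_id incl_hom
          tensor_map_hom[OF b c b c module_hom_id module_hom_id] refl _ aw])
      (simp add: tensor_map_id[OF b c])
  also have "\<dots> = tensor_assoc K ?T ?b ?c (tensor_map K (tensor K ?T ?b) ?c (tensor_map K ?T ?b id id) id w)"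
    by (rule tensor_assoc_natural[OF i b c T b c incl_hom module_hom_id module_hom_id w, symmetric])
  finally have "Ind_tensor_embed \<alpha> ?BC (tensor_assoc K ?i ?b ?c w) = tensor_assoc K V1 ?a ?BC
      (tensor_assoc K ?T ?b ?c (tensor_map K (tensor K ?T ?b) ?c (tensor_map K ?T ?b id id) id w))"
    by (simp add: Ind_tensor_embed_def)
  \<comment> \<open>The pentagon produces the associator that completes the inner embedding of
    \<open>Ind(\<rho>)\<^sub>\<alpha> \<otimes> H\<^sub>\<beta>\<close>.\<close>
  also have "\<dots> = tensor_map K V1 (tensor K ?a ?BC) id (tensor_assoc K ?a ?b ?c)
      (tensor_assoc K V1 ?AB ?c (tensor_map K (tensor K V1 ?AB) ?c (tensor_assoc K V1 ?a ?b) id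
        (tensor_map K (tensor K ?T ?b) ?c (tensor_map K ?T ?b id id) id w)))"
    by (rule tensor_pentagon[OF v a b c module_hom_in[OF tensor_map_hom[OF ib c Tb c inc module_hom_id] w]])
  also have "tensor_map K (tensor K V1 ?AB) ?c (tensor_assoc K V1 ?a ?b) id
        (tensor_map K (tensor K ?T ?b) ?c (tensor_map K ?T ?b id id) id w) =
      tensor_map K (tensor K V1 ?AB) ?c (Ind_tensor_embed \<alpha> ?b) (\<lambda>n. id (id n)) w"
    unfolding Ind_tensor_embed_def[abs_def]
    by (rule tensor_map_comp[OF ib c Tb c tensor_vectorspace[OF v AB] c inc module_hom_id tensor_assoc_hom[OF v a b] module_hom_id w])
  also have "\<dots> = tensor_map K (tensor K V1 ?AB) ?c (\<lambda>m. Ind_tensor_embed \<alpha> ?b (\<theta> \<alpha> \<beta> m)) (\<lambda>n. id (id (id n))) y"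
    unfolding w_def
    by (rule tensor_map_comp[OF iab c ib c tensor_vectorspace[OF v AB] c tab module_hom_id Ind_tensor_embed_hom[OF abc(1) b]
          module_hom_compose[OF module_hom_id module_hom_id] y])
  \<comment> \<open>The inner embedding cancels the \<open>inv_into\<close> in \<theta> and leaves
    \<open>I \<otimes> \<Delta>\<close> on the left factor. The inner \<open>id\<close> is the
    inclusion, split off next to recover the embedded \<open>y\<close>.\<close>
  also have "\<dots> = tensor_map K (tensor K V1 ?AB) ?c (\<lambda>m. tensor_map K V1 ?AB id (\<Delta>H \<alpha> \<beta>) (id m)) (\<lambda>n. id (id n)) y"
    by (rule tensor_map_cong[OF iab c tensor_vectorspace[OF v AB] c module_hom_compose[OF tab Ind_tensor_embed_hom[OF abc(1) b]]
          module_hom_compose[OF module_hom_id module_hom_compose[OF module_hom_id module_hom_id]]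
          module_hom_compose[OF incl_hom tensor_map_hom[OF v ab v AB module_hom_id dab]]
          module_hom_compose[OF module_hom_id module_hom_id] _ _ y])
      (simp_all add: Ind_tensor_embed_coaction[OF abc(1,2)] id_comult_def)
  also have "\<dots> = tensor_map K (tensor K V1 ?AB) ?c (tensor_map K V1 ?AB id (\<Delta>H \<alpha> \<beta>)) id (tensor_map K ?Tab ?c id id y)"
    by (rule tensor_map_comp[OF iab c Tab c tensor_vectorspace[OF v AB] c incl_hom module_hom_id
          tensor_map_hom[OF v ab v AB module_hom_id dab] module_hom_id y, symmetric])
  also have "tensor_assoc K V1 ?AB ?c \<dots> = tensor_map K V1 (tensor K ?AB ?c) id (tensor_map K ?AB ?c (\<Delta>H \<alpha> \<beta>) id)
      (Ind_tensor_embed (\<alpha> \<otimes>\<^bsub>G\<^esub> \<beta>) ?c y)"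
    unfolding Ind_tensor_embed_def
    by (rule tensor_assoc_natural[OF v ab c v AB c module_hom_id dab module_hom_id
          module_hom_in[OF incl_tensor_hom[OF gr(1) c] y]])
  also have "tensor_map K V1 (tensor K ?a ?BC) id (tensor_assoc K ?a ?b ?c) \<dots> =
      tensor_map K V1 (tensor K ?a ?BC) (\<lambda>m. id (id m))
        (\<lambda>n. tensor_assoc K ?a ?b ?c (tensor_map K ?AB ?c (\<Delta>H \<alpha> \<beta>) id n)) (Ind_tensor_embed (\<alpha> \<otimes>\<^bsub>G\<^esub> \<beta>) ?c y)"
    by (rule tensor_map_comp[OF v tensor_vectorspace[OF ab c] v ABc v aBC module_hom_id
          tensor_map_hom[OF ab c AB c dab module_hom_id] module_hom_id tensor_assoc_hom[OF a b c]
          module_hom_in[OF Ind_tensor_embed_hom[OF gr(1) c] y]])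
  finally have "Ind_tensor_embed \<alpha> ?BC (tensor_assoc K ?i ?b ?c w) = Ind_tensor_embed \<alpha> ?BC (tensor_map K ?i ?BC id (\<Delta>H \<beta> \<gamma>) z)"
    unfolding R by (simp add: id_def)
  from inj_onD[OF inj_on_Ind_tensor_embed[OF abc(1) BC] this aw r] show ?thesis
    unfolding w_def y_def z_def .
qed

text \<open>Naturality of the unitor along the inclusion lets the value be computed in
  \<open>V\<^sub>1 \<otimes> H\<^sub>\<alpha>\<close>. There \<open>right_unitor_tensor\<close>
  confines it to the second factor, where the counit law of \<open>H\<close> applies.\<close>

lemma Ind_coaction_counit:
  assumes a: "\<alpha> \<in> carrier G" and x: "x \<in> carrier (I \<alpha>)"
  shows "right_unitor K (I \<alpha>) (tensor_map K (I \<alpha>) (ground K) id \<epsilon>H (\<theta> \<alpha> \<one>\<^bsub>G\<^esub> x)) = x"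
proof -
  let ?i = "I \<alpha>" and ?a = "H \<alpha>" and ?o = "H \<one>\<^bsub>G\<^esub>" and ?k = "ground K" and ?T = "tensor K V1 (H \<alpha>)"
  have v: "vectorspace K V1" and h: "vectorspace K ?a" and o: "vectorspace K ?o" and i: "vectorspace K ?i"
    using a by (simp_all add: spaces Ind_vectorspace)
  note g = ground_vectorspace[OF v] and T = tensor_vectorspace[OF v h]
  have one: "\<one>\<^bsub>G\<^esub> \<in> carrier G" by simp
  have a1: "\<alpha> \<otimes>\<^bsub>G\<^esub> \<one>\<^bsub>G\<^esub> = \<alpha>" using a by simp
  note e = H.counit_linear and d = H.comult_linear[OF a one, unfolded a1]
  have x1: "x \<in> carrier (I (\<alpha> \<otimes>\<^bsub>G\<^esub> \<one>\<^bsub>G\<^esub>))" using x by (simp only: a1)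
  have xT: "x \<in> carrier ?T" by (rule Ind_in_tensor[OF x])
  define y where "y = \<theta> \<alpha> \<one>\<^bsub>G\<^esub> x"
  have y: "y \<in> carrier (tensor K ?i ?o)" unfolding y_def by (rule Ind_coaction_in[OF a one x1])
  have ey: "Ind_tensor_embed \<alpha> ?o y = tensor_map K V1 (tensor K ?a ?o) id (\<Delta>H \<alpha> \<one>\<^bsub>G\<^esub>) x"
    unfolding y_def by (simp add: Ind_tensor_embed_coaction[OF a one x1] id_comult_def)
  have t: "tensor_map K ?i ?k id \<epsilon>H y \<in> carrier (tensor K ?i ?k)"
    by (rule module_hom_in[OF tensor_map_hom[OF i o i g module_hom_id e] y])
  have "right_unitor K ?i (tensor_map K ?i ?k id \<epsilon>H y) =
      right_unitor K ?T (tensor_map K ?T ?k id id (tensor_map K ?i ?k id \<epsilon>H y))"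
    using right_unitor_natural[OF i T incl_hom t] by simp
  also have "\<dots> = tensor_map K V1 ?a id (right_unitor K ?a) (Ind_tensor_embed \<alpha> ?k (tensor_map K ?i ?k id \<epsilon>H y))"
    unfolding Ind_tensor_embed_def by (rule right_unitor_tensor[OF v h module_hom_in[OF incl_tensor_hom[OF a g] t]])
  also have "Ind_tensor_embed \<alpha> ?k (tensor_map K ?i ?k id \<epsilon>H y) =
      tensor_map K V1 (tensor K ?a ?k) id (tensor_map K ?a ?k id \<epsilon>H) (Ind_tensor_embed \<alpha> ?o y)"
    by (rule Ind_tensor_embed_natural[OF a o g e y])
  also have "\<dots> = tensor_map K V1 (tensor K ?a ?k) (\<lambda>m. id (id m))
      (\<lambda>n. tensor_map K ?a ?k id \<epsilon>H (\<Delta>H \<alpha> \<one>\<^bsub>G\<^esub> n)) x"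
    unfolding ey
    by (rule tensor_map_comp[OF v h v tensor_vectorspace[OF h o] v tensor_vectorspace[OF h g] module_hom_id d
          module_hom_id tensor_map_hom[OF h o h g module_hom_id e] xT])
  also have "tensor_map K V1 ?a id (right_unitor K ?a) \<dots> = tensor_map K V1 ?a (\<lambda>m. id (id (id m)))
      (\<lambda>n. right_unitor K ?a (tensor_map K ?a ?k id \<epsilon>H (\<Delta>H \<alpha> \<one>\<^bsub>G\<^esub> n))) x"
    by (rule tensor_map_comp[OF v h v tensor_vectorspace[OF h g] v h module_hom_compose[OF module_hom_id module_hom_id]
          module_hom_compose[OF d tensor_map_hom[OF h o h g module_hom_id e]] module_hom_id right_unitor_hom[OF h] xT])
  also have "\<dots> = tensor_map K V1 ?a id id x"
    by (rule tensor_map_cong[OF v h v h module_hom_compose[OF module_hom_compose[OF module_hom_id module_hom_id] module_hom_id]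
          module_hom_compose[OF module_hom_compose[OF d tensor_map_hom[OF h o h g module_hom_id e]] right_unitor_hom[OF h]]
          module_hom_id module_hom_id _ _ xT])
      (simp_all add: H.counit_right[OF a])
  also have "\<dots> = x" by (rule tensor_map_id[OF v h xT])
  finally show ?thesis unfolding y_def .
qed

lemma Ind_comodule: "right_pi_comodule K G H \<Delta>H \<epsilon>H I \<theta>"
  by (intro right_pi_comodule.intro right_pi_comodule_axioms.intro H.pi_coalgebra_axioms Ind_vectorspace
      Ind_coaction_hom Ind_coaction_coassoc Ind_coaction_counit)

end

text \<open>Injectivity and the range inclusion show that \<open>Ind_coaction\<close> selects the
  unique preimage of \<open>I \<otimes> \<Delta>\<close>. The comodule in the last conjunct thus
  carries the intended restricted coaction rather than an arbitrary value of
  \<open>inv_into\<close>.\<close>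

theorem theorem2p6:
  fixes K :: "('k, 'z) ring_scheme" and G :: "('g, 'y) monoid_scheme"
    and H :: "'g \<Rightarrow> ('k, 'h) module" and \<Delta>H \<epsilon>H S
    and C :: "'g \<Rightarrow> ('k, 'c) module" and \<Delta>C \<epsilon>C act \<sigma>
    and V :: "'g \<Rightarrow> ('k, 'v) module" and \<rho>
  assumes hopf: "hopf_pi_coalgebra K G H \<Delta>H \<epsilon>H S"
    and coisotropic: "left_coisotropic_subgroup K G H \<Delta>H \<epsilon>H S C \<Delta>C \<epsilon>C act \<sigma>"
    and comodule: "right_pi_comodule K G C \<Delta>C \<epsilon>C V \<rho>"
  shows "(\<forall>\<alpha>\<in>carrier G. \<forall>\<beta>\<in>carrier G.
            inj_on (Ind_embed K G H V \<alpha> \<beta>)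
              (carrier (tensor K (Ind K G H \<Delta>H C \<sigma> V \<rho> \<alpha>) (H \<beta>))) \<and>
            id_comult K G H \<Delta>H V \<alpha> \<beta> ` carrier (Ind K G H \<Delta>H C \<sigma> V \<rho> (\<alpha> \<otimes>\<^bsub>G\<^esub> \<beta>))
              \<subseteq> Ind_embed K G H V \<alpha> \<beta> ` carrier (tensor K (Ind K G H \<Delta>H C \<sigma> V \<rho> \<alpha>) (H \<beta>))) \<and>
         right_pi_comodule K G H \<Delta>H \<epsilon>H
           (Ind K G H \<Delta>H C \<sigma> V \<rho>) (Ind_coaction K G H \<Delta>H C \<sigma> V \<rho>)"
proof -
  interpret coisotropic_comodule K G H \<Delta>H \<epsilon>H S C \<Delta>C \<epsilon>C act \<sigma> V \<rho>
    using coisotropic comodule by (rule coisotropic_comodule.intro)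
  show ?thesis
    unfolding Ind_embed_eq
    by (intro conjI ballI image_subsetI inj_on_Ind_tensor_embed id_comult_Ind H.space Ind_comodule)
qed

end
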